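(* Let $q\in(0,1)$ and let $n\ge 1$, $m\ge 2$ be integers, $N=n+m$. Let $Q_0:\mathscr{H}_0\to\mathscr{H}_0$ be the linear operator $$Q_0e(i_1,\dots,i_{N-1})=\mathrm{const}\cdot q^{2\sum_{j=1}^{N-1}(N-j)i_j}\,e(i_1,\dots,i_{N-1}),\qquad \mathrm{const}>0.$$ Then the linear functional $$\nu_q^0:\mathscr{D}(\Xi_{n,m})_q\to\mathbb{C},\qquad \nu_q^0(f)=\operatorname{Tr}(T_0(f)\cdot Q_0)$$ is well defined, positive (i.e. $\nu_q^0(f^*f)>0$ for all $f\neq0$), and $U_q\mathfrak{su}_{n,m}$-invariant (i.e. $\nu_q^0(af)=\varepsilon(a)\nu_q^0(f)$ for all $a\in U_q\mathfrak{su}_{n,m}$ and $f\in\mathscr{D}(\Xi_{n,m})_q$).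
   Context: Notation: $\mathbb{Z}_+=\{0,1,2,\dots\}$, $\mathbb{N}=\{1,2,\dots\}$; algebras are over $\mathbb{C}$. **Algebras.** $\mathrm{Pol}(\widetilde{\Xi}_{n,m})_q$ is the unital $*$-algebra with generators $t_1,\dots,t_N$ and relations $t_it_j=qt_jt_i$ for $i<j$; $t_it_j^*=qt_j^*t_i$ for $i\ne j$; $t_it_i^*=t_i^*t_i+(q^{-2}-1)\sum_{k=i+1}^N t_kt_k^*$ for $i>n$; $t_it_i^*=t_i^*t_i+(q^{-2}-1)\sum_{k=i+1}^n t_kt_k^*-(q^{-2}-1)\sum_{k=n+1}^N t_kt_k^*$ for $i\le n$; and $-\sum_{j=1}^n t_jt_j^*+\sum_{j=n+1}^N t_jt_j^*=0$. Put $\xi_j=\sum_{k=j}^N t_kt_k^*$ for $j>n$ and $\xi_j=-\sum_{k=j}^n t_kt_k^*+\sum_{k=n+1}^N t_kt_k^*$ for $j\le n$. Then $\xi_1=0$, the $\xi_k$ commute pairwise, $t_j\xi_k=q^2\xi_kt_j$, $t_j^*\xi_k=q^{-2}\xi_kt_j^*$ for $j<k$, and $t_j,t_j^*$ commute with $\xi_k$ for $j\ge k$. $\mathscr{D}(\Xi_{n,m})_q$ is the $*$-algebra of finite sums $$f=\sum_{I,J} t_1^{i_1}\cdots t_n^{i_n}t_{n+1}^{*i_{n+1}}\cdots t_N^{*i_N}\,f_{IJ}(\xi_2,\dots,\xi_N)\,t_N^{j_N}\cdots t_{n+1}^{j_{n+1}}t_n^{*j_n}\cdots t_1^{*j_1}$$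 over $I,J\in\mathbb{Z}_+^N$ with $i_kj_k=0$ for all $k$ and $i_1+\dots+i_n+j_{n+1}+\dots+j_N=j_1+\dots+j_n+i_{n+1}+\dots+i_N$, where each $f_{IJ}$ is a finite linear combination of terms $\xi_2^{k_2}\cdots\xi_n^{k_n}\,g(\xi_{n+1})\,\xi_{n+2}^{k_{n+2}}\cdots\xi_N^{k_N}$ with $k_i\in\mathbb{Z}_+$ and $g:q^{2\mathbb{Z}}\to\mathbb{C}$ finitely supported; the decomposition is unique. Multiplication and involution are determined by those of $\mathrm{Pol}(\widetilde{\Xi}_{n,m})_q$, by pointwise multiplication and complex conjugation of functions of $\xi_{n+1}$ on $q^{2\mathbb{Z}}$ ($\xi_{n+1}$ itself being the coordinate function), and by $t_jg(\xi_{n+1})=g(q^2\xi_{n+1})t_j$, $t_j^*g(\xi_{n+1})=g(q^{-2}\xi_{n+1})t_j^*$ for $j\le n$, while $g(\xi_{n+1})$ commutes with $t_j,t_j^*$ for $j>n$ and with all $\xi_k$. **Representation.** $\mathscr{H}_0$ is the pre-Hilbert space that is the linear span of an orthonormal basis $\{e(i_1,\dots,i_{N-1}): i_1\in\mathbb{Z};\ i_2,\dots,i_n\in-\mathbb{Z}_+;\ i_{n+1},\dots,i_{N-1}\in\mathbb{N}\}$. With $e=e(i_1,\dots,i_{N-1})$ and $S_j=\sum_{k=1}^{j-1}i_k$, the $*$-representation $T_0$ is given by $T_0(t_1)e=q^{i_1-1}e(i_1-1,i_2,\dots)$, $T_0(t_1^* )e=q^{i_1}e(i_1+1,i_2,\dots)$;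 for $1<j\le n$: $T_0(t_j)e=q^{S_j}(q^{2(i_j-1)}-1)^{1/2}e(\dots,i_j-1,\dots)$, $T_0(t_j^* )e=q^{S_j}(q^{2i_j}-1)^{1/2}e(\dots,i_j+1,\dots)$; for $n<j<N$: $T_0(t_j)e=q^{S_j}(1-q^{2(i_j-1)})^{1/2}e(\dots,i_j-1,\dots)$, $T_0(t_j^* )e=q^{S_j}(1-q^{2i_j})^{1/2}e(\dots,i_j+1,\dots)$; $T_0(t_N)e=T_0(t_N^* )e=q^{S_N}e$; and $T_0(g(\xi_{n+1}))e=g(q^{2(i_1+\dots+i_n)})e$. (A term with zero coefficient is $0$.) The trace is the sum of the diagonal matrix elements in the basis $e(i_1,\dots,i_{N-1})$; well-definedness of $\nu_q^0$ means that this series converges absolutely. **Quantum group.** $U_q\mathfrak{su}_{n,m}$ is the Hopf algebra $U_q\mathfrak{sl}_N$ with standard Drinfeld–Jimbo generators $E_j,F_j,K_j^{\pm1}$, $1\le j\le N-1$ ($K_iE_j=q^{a_{ij}}E_jK_i$, $K_iF_j=q^{-a_{ij}}F_jK_i$ with $(a_{ij})$ the Cartan matrix, $[E_i,F_j]=\delta_{ij}(K_i-K_i^{-1})/(q-q^{-1})$, $q$-Serre relations), $\Delta E_j=E_j\otimes1+K_j\otimes E_j$, $\Delta F_j=F_j\otimes K_j^{-1}+1\otimes F_j$, $\Delta K_j=K_j\otimes K_j$, $\varepsilon(E_j)=\varepsilon(F_j)=0$, $\varepsilon(K_j)=1$, $S(E_j)=-K_j^{-1}E_j$, $S(F_j)=-F_jK_j$,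 $S(K_j)=K_j^{-1}$, and involution $K_j^*=K_j$, $E_j^*=K_jF_j$, $F_j^*=E_jK_j^{-1}$ for $j\ne n$, $E_n^*=-K_nF_n$, $F_n^*=-E_nK_n^{-1}$. **Action.** $\mathscr{D}(\Xi_{n,m})_q$ is a $U_q\mathfrak{su}_{n,m}$-module algebra; the action on products is determined by $a(fg)=\sum(a_{(1)}f)(a_{(2)}g)$ and the following formulas (unlisted values of $E_j,F_j$ are $0$): $E_jt_{j+1}=q^{-1/2}t_j$; $F_jt_j=q^{1/2}t_{j+1}$; $K_jt_j=qt_j$, $K_jt_{j+1}=q^{-1}t_{j+1}$, $K_jt_i=t_i$ otherwise; $E_jt_j^*=-q^{-3/2}t_{j+1}^*$ for $j\ne n$, $E_nt_n^*=q^{-3/2}t_{n+1}^*$; $F_jt_{j+1}^*=-q^{3/2}t_j^*$ for $j\ne n$, $F_nt_{n+1}^*=q^{3/2}t_n^*$; $K_jt_j^*=q^{-1}t_j^*$, $K_jt_{j+1}^*=qt_{j+1}^*$, $K_jt_i^*=t_i^*$ otherwise; for a function $g$ of $\xi=\xi_{n+1}$: $E_ng(\xi)=q^{-1/2}t_n\frac{g(q^{-2}\xi)-g(\xi)}{q^{-2}\xi-\xi}t_{n+1}^*$, $F_ng(\xi)=q^{3/2}t_{n+1}\frac{g(q^{-2}\xi)-g(\xi)}{q^{-2}\xi-\xi}t_n^*$, $K_ng(\xi)=g(\xi)$, and $E_jg(\xi)=F_jg(\xi)=(K_j-1)g(\xi)=0$ for $j\ne n$. *)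

theory Defs
  imports "HOL-Analysis.Analysis" "HOL-Algebra.QuotRing" "HOL-Library.Poly_Mapping"
begin

section \<open>Free algebras and presented algebras over the complex numbers\<close>

text \<open>Words form an additively written, non-commutative monoid, so that \<open>'g word \<Rightarrow>\<^sub>0 complex\<close>
  with the convolution product is the free unital algebra on \<open>'g\<close>.\<close>

datatype 'g word = Word (letters: "'g list")

instantiation word :: (type) monoid_add
begin
definition zero_word :: "'a word" where "zero_word = Word []"
definition plus_word :: "'a word \<Rightarrow> 'a word \<Rightarrow> 'a word" where
  "plus_word u v = Word (letters u @ letters v)"
instance by standard (simp_all add: zero_word_def plus_word_def)
end

type_synonym 'g falg = "'g word \<Rightarrow>\<^sub>0 complex"

definition fgen :: "'g \<Rightarrow> 'g falg" where
  "fgen x = Poly_Mapping.single (Word [x]) 1"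

definition cscale :: "complex \<Rightarrow> ('b \<Rightarrow>\<^sub>0 complex) \<Rightarrow> ('b \<Rightarrow>\<^sub>0 complex)" where
  "cscale c f = Poly_Mapping.map ((*) c) f"

definition linext :: "('a \<Rightarrow> 'b \<Rightarrow>\<^sub>0 complex) \<Rightarrow> ('a \<Rightarrow>\<^sub>0 complex) \<Rightarrow> ('b \<Rightarrow>\<^sub>0 complex)" where
  "linext \<phi> f = (\<Sum>w\<in>Poly_Mapping.keys f. cscale (Poly_Mapping.lookup f w) (\<phi> w))"

definition free_algebra :: "'g set \<Rightarrow> 'g falg ring" where
  "free_algebra G =
     \<lparr>carrier = {f. \<forall>w\<in>Poly_Mapping.keys f. set (letters w) \<subseteq> G},
      mult = (*), one = 1, zero = 0, add = (+)\<rparr>"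

definition rel_ideal :: "'g set \<Rightarrow> ('g falg \<Rightarrow> 'g falg \<Rightarrow> bool) \<Rightarrow> 'g falg set" where
  "rel_ideal G R = genideal (free_algebra G) {l - r |l r. R l r}"

definition presented_algebra :: "'g set \<Rightarrow> ('g falg \<Rightarrow> 'g falg \<Rightarrow> bool) \<Rightarrow> 'g falg set ring" where
  "presented_algebra G R = free_algebra G Quot rel_ideal G R"

definition cls :: "'g set \<Rightarrow> ('g falg \<Rightarrow> 'g falg \<Rightarrow> bool) \<Rightarrow> 'g falg \<Rightarrow> 'g falg set" where
  "cls G R f = rel_ideal G R +>\<^bsub>free_algebra G\<^esub> f"

text \<open>A chosen representative of a coset. The maps defined through it below (\<open>T0\<close>, \<open>counit\<close>,
  \<open>act\<close>) are those induced on the quotient algebras and do not depend on the choice.\<close>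

definition crep :: "'g falg set \<Rightarrow> 'g falg" where
  "crep X = (SOME f. f \<in> X)"


section \<open>The algebra generated by the coordinates and the functions of \<open>\<xi>\<^bsub>n+1\<^esub>\<close>\<close>

text \<open>\<open>CT j\<close> and \<open>CTs j\<close> stand for \<open>t\<^sub>j\<close> and its adjoint. \<open>Chi k\<close> stands for the function of
  \<open>\<xi>\<^bsub>n+1\<^esub>\<close> which is 1 at the point \<open>q\<^bsup>2k\<^esup>\<close> and 0 at the other points of \<open>q\<^bsup>2\<int>\<^esup>\<close>; these functions
  are a basis of the finitely supported functions on \<open>q\<^bsup>2\<int>\<^esup>\<close>.
  Throughout, \<open>N = n + m\<close>.\<close>

datatype coord = CT nat | CTs nat | Chi int

abbreviation gt :: "nat \<Rightarrow> coord falg" where "gt j \<equiv> fgen (CT j)"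
abbreviation gts :: "nat \<Rightarrow> coord falg" where "gts j \<equiv> fgen (CTs j)"

definition coords :: "nat \<Rightarrow> coord set" where
  "coords N = CT ` {1..N} \<union> CTs ` {1..N} \<union> range Chi"

definition lattice_finite :: "real \<Rightarrow> (real \<Rightarrow> complex) \<Rightarrow> bool" where
  "lattice_finite q g \<longleftrightarrow> finite {k::int. g (q powi (2 * k)) \<noteq> 0}"

text \<open>\<open>fun_xi q g\<close> is \<open>g(\<xi>\<^bsub>n+1\<^esub>)\<close>; only the values of \<open>g\<close> on \<open>q\<^bsup>2\<int>\<^esup>\<close> matter.\<close>

definition fun_xi :: "real \<Rightarrow> (real \<Rightarrow> complex) \<Rightarrow> coord falg" where
  "fun_xi q g = (\<Sum>k | g (q powi (2 * k)) \<noteq> 0. cscale (g (q powi (2 * k))) (fgen (Chi k)))"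

definition pt_ind :: "real \<Rightarrow> int \<Rightarrow> real \<Rightarrow> complex" where
  "pt_ind q k x = (if x = q powi (2 * k) then 1 else 0)"

definition xi :: "nat \<Rightarrow> nat \<Rightarrow> nat \<Rightarrow> coord falg" where
  "xi n N j = (if j > n then (\<Sum>k=j..N. gt k * gts k)
               else - (\<Sum>k=j..n. gt k * gts k) + (\<Sum>k=Suc n..N. gt k * gts k))"

fun coord_star :: "coord \<Rightarrow> coord" where
  "coord_star (CT j) = CTs j"
| "coord_star (CTs j) = CT j"
| "coord_star (Chi k) = Chi k"

definition fstar :: "coord falg \<Rightarrow> coord falg" where
  "fstar f = (\<Sum>w\<in>Poly_Mapping.keys f.
     Poly_Mapping.single (Word (rev (map coord_star (letters w)))) (cnj (Poly_Mapping.lookup f w)))"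

inductive pol_rel :: "real \<Rightarrow> nat \<Rightarrow> nat \<Rightarrow> coord falg \<Rightarrow> coord falg \<Rightarrow> bool"
  for q n N where
  "\<lbrakk>i \<in> {1..N}; j \<in> {1..N}; i < j\<rbrakk> \<Longrightarrow> pol_rel q n N (gt i * gt j) (cscale q (gt j * gt i))"
| "\<lbrakk>i \<in> {1..N}; j \<in> {1..N}; i \<noteq> j\<rbrakk> \<Longrightarrow> pol_rel q n N (gt i * gts j) (cscale q (gts j * gt i))"
| "\<lbrakk>i \<in> {1..N}; i > n\<rbrakk> \<Longrightarrow> pol_rel q n N (gt i * gts i)
     (gts i * gt i + cscale (q powi (-2) - 1) (\<Sum>k=Suc i..N. gt k * gts k))"
| "\<lbrakk>i \<in> {1..N}; i \<le> n\<rbrakk> \<Longrightarrow> pol_rel q n N (gt i * gts i)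
     (gts i * gt i + cscale (q powi (-2) - 1) (\<Sum>k=Suc i..n. gt k * gts k)
                 - cscale (q powi (-2) - 1) (\<Sum>k=Suc n..N. gt k * gts k))"
| "pol_rel q n N (- (\<Sum>j=1..n. gt j * gts j) + (\<Sum>j=Suc n..N. gt j * gts j)) 0"

inductive fun_rel :: "real \<Rightarrow> nat \<Rightarrow> nat \<Rightarrow> coord falg \<Rightarrow> coord falg \<Rightarrow> bool"
  for q n N where
  "\<lbrakk>lattice_finite q g; lattice_finite q h\<rbrakk> \<Longrightarrow>
     fun_rel q n N (fun_xi q g * fun_xi q h) (fun_xi q (\<lambda>x. g x * h x))"
| "lattice_finite q g \<Longrightarrow>
     fun_rel q n N (xi n N (Suc n) * fun_xi q g) (fun_xi q (\<lambda>x. complex_of_real x * g x))"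
| "\<lbrakk>lattice_finite q g; j \<in> {1..n}\<rbrakk> \<Longrightarrow>
     fun_rel q n N (gt j * fun_xi q g) (fun_xi q (\<lambda>x. g (q powi 2 * x)) * gt j)"
| "\<lbrakk>lattice_finite q g; j \<in> {1..n}\<rbrakk> \<Longrightarrow>
     fun_rel q n N (gts j * fun_xi q g) (fun_xi q (\<lambda>x. g (q powi (-2) * x)) * gts j)"
| "\<lbrakk>lattice_finite q g; j \<in> {Suc n..N}\<rbrakk> \<Longrightarrow> fun_rel q n N (gt j * fun_xi q g) (fun_xi q g * gt j)"
| "\<lbrakk>lattice_finite q g; j \<in> {Suc n..N}\<rbrakk> \<Longrightarrow> fun_rel q n N (gts j * fun_xi q g) (fun_xi q g * gts j)"
| "\<lbrakk>lattice_finite q g; k \<in> {1..N}\<rbrakk> \<Longrightarrow>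
     fun_rel q n N (xi n N k * fun_xi q g) (fun_xi q g * xi n N k)"

text \<open>The defining relations of a \<open>*\<close>-algebra include the adjoints of the listed relations.\<close>

definition coord_rel :: "real \<Rightarrow> nat \<Rightarrow> nat \<Rightarrow> coord falg \<Rightarrow> coord falg \<Rightarrow> bool" where
  "coord_rel q n N l r \<longleftrightarrow>
     (\<exists>l' r'. (pol_rel q n N l' r' \<or> fun_rel q n N l' r') \<and>
        ((l = l' \<and> r = r') \<or> (l = fstar l' \<and> r = fstar r')))"

text \<open>\<open>A_alg\<close> is \<open>Pol(\<Xi>)\<^sub>q\<close> (with \<open>\<Xi>\<close> carrying a tilde) with the finitely supported functions of
  \<open>\<xi>\<^bsub>n+1\<^esub>\<close> adjoined; \<open>D_alg\<close> is realized inside it.\<close>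

definition A_alg :: "real \<Rightarrow> nat \<Rightarrow> nat \<Rightarrow> coord falg set ring" where
  "A_alg q n N = presented_algebra (coords N) (coord_rel q n N)"

definition A_cls :: "real \<Rightarrow> nat \<Rightarrow> nat \<Rightarrow> coord falg \<Rightarrow> coord falg set" where
  "A_cls q n N = cls (coords N) (coord_rel q n N)"

definition A_scale :: "real \<Rightarrow> nat \<Rightarrow> nat \<Rightarrow> complex \<Rightarrow> coord falg set \<Rightarrow> coord falg set" where
  "A_scale q n N c X = A_cls q n N (cscale c 1) \<otimes>\<^bsub>A_alg q n N\<^esub> X"

text \<open>The ideal of relations is stable under \<open>fstar\<close>, so the image of a coset is a coset.\<close>

definition A_star :: "coord falg set \<Rightarrow> coord falg set" where
  "A_star X = fstar ` X"

definition D_term ::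
  "real \<Rightarrow> nat \<Rightarrow> nat \<Rightarrow> (nat \<Rightarrow> nat) \<Rightarrow> (nat \<Rightarrow> nat) \<Rightarrow> (nat \<Rightarrow> nat) \<Rightarrow> (real \<Rightarrow> complex) \<Rightarrow> coord falg"
where
  "D_term q n N I J K g =
     prod_list (map (\<lambda>k. gt k ^ I k) [1..<Suc n]) *
     prod_list (map (\<lambda>k. gts k ^ I k) [Suc n..<Suc N]) *
     (prod_list (map (\<lambda>k. xi n N k ^ K k) [2..<Suc n]) *
      fun_xi q g *
      prod_list (map (\<lambda>k. xi n N k ^ K k) [n + 2..<Suc N])) *
     prod_list (map (\<lambda>k. gt k ^ J k) (rev [Suc n..<Suc N])) *
     prod_list (map (\<lambda>k. gts k ^ J k) (rev [1..<Suc n]))"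

definition D_alg :: "real \<Rightarrow> nat \<Rightarrow> nat \<Rightarrow> coord falg set set" where
  "D_alg q n N = A_cls q n N ` module.span cscale
     {D_term q n N I J K g | I J K g.
        (\<forall>k\<in>{1..N}. I k * J k = 0) \<and>
        (\<Sum>k=1..n. I k) + (\<Sum>k=Suc n..N. J k) = (\<Sum>k=1..n. J k) + (\<Sum>k=Suc n..N. I k) \<and>
        lattice_finite q g}"


section \<open>The representation\<close>

text \<open>Basis indices are functions \<open>i\<close> on \<open>{1..N-1}\<close>, extended by 0. The space \<open>\<H>\<^sub>0\<close> consists of
  the finitely supported functions on \<open>basis_idx n N\<close>.\<close>

definition basis_idx :: "nat \<Rightarrow> nat \<Rightarrow> (nat \<Rightarrow> int) set" where
  "basis_idx n N = {i. (\<forall>j\<in>{2..n}. i j \<le> 0) \<and> (\<forall>j\<in>{Suc n..<N}. i j \<ge> 1) \<and>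
                       (\<forall>j. j \<notin> {1..<N} \<longrightarrow> i j = 0)}"

type_synonym hvec = "(nat \<Rightarrow> int) \<Rightarrow>\<^sub>0 complex"

definition bvec :: "(nat \<Rightarrow> int) \<Rightarrow> hvec" where
  "bvec i = Poly_Mapping.single i 1"

definition Spre :: "nat \<Rightarrow> (nat \<Rightarrow> int) \<Rightarrow> int" where
  "Spre j i = (\<Sum>k=1..<j. i k)"

fun T0_gen :: "real \<Rightarrow> nat \<Rightarrow> nat \<Rightarrow> coord \<Rightarrow> (nat \<Rightarrow> int) \<Rightarrow> hvec" where
  "T0_gen q n N (CT j) i =
     (if j = 1 then cscale (q powi (i 1 - 1)) (bvec (i(1 := i 1 - 1)))
      else if j \<le> n then
        cscale (q powi Spre j i * sqrt (q powi (2 * (i j - 1)) - 1)) (bvec (i(j := i j - 1)))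
      else if j < N then
        cscale (q powi Spre j i * sqrt (1 - q powi (2 * (i j - 1)))) (bvec (i(j := i j - 1)))
      else cscale (q powi Spre N i) (bvec i))"
| "T0_gen q n N (CTs j) i =
     (if j = 1 then cscale (q powi i 1) (bvec (i(1 := i 1 + 1)))
      else if j \<le> n then
        cscale (q powi Spre j i * sqrt (q powi (2 * i j) - 1)) (bvec (i(j := i j + 1)))
      else if j < N then
        cscale (q powi Spre j i * sqrt (1 - q powi (2 * i j))) (bvec (i(j := i j + 1)))
      else cscale (q powi Spre N i) (bvec i))"
| "T0_gen q n N (Chi k) i = cscale (pt_ind q k (q powi (2 * (\<Sum>l=1..n. i l)))) (bvec i)"

definition T0_free :: "real \<Rightarrow> nat \<Rightarrow> nat \<Rightarrow> coord falg \<Rightarrow> hvec \<Rightarrow> hvec" where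
  "T0_free q n N f v =
     linext (\<lambda>w. foldr (\<lambda>x. linext (T0_gen q n N x)) (letters w) v) f"

definition T0 :: "real \<Rightarrow> nat \<Rightarrow> nat \<Rightarrow> coord falg set \<Rightarrow> hvec \<Rightarrow> hvec" where
  "T0 q n N X = T0_free q n N (crep X)"

definition Q0 :: "real \<Rightarrow> real \<Rightarrow> nat \<Rightarrow> hvec \<Rightarrow> hvec" where
  "Q0 c q N = linext (\<lambda>i. cscale (c * q powi (2 * (\<Sum>j=1..<N. (int N - int j) * i j))) (bvec i))"

definition trace_converges :: "nat \<Rightarrow> nat \<Rightarrow> (hvec \<Rightarrow> hvec) \<Rightarrow> bool" where
  "trace_converges n N B \<longleftrightarrow> (\<lambda>i. norm (Poly_Mapping.lookup (B (bvec i)) i)) summable_on basis_idx n N"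

definition Tr :: "nat \<Rightarrow> nat \<Rightarrow> (hvec \<Rightarrow> hvec) \<Rightarrow> complex" where
  "Tr n N B = (\<Sum>\<^sub>\<infinity>i\<in>basis_idx n N. Poly_Mapping.lookup (B (bvec i)) i)"

definition nu :: "real \<Rightarrow> real \<Rightarrow> nat \<Rightarrow> nat \<Rightarrow> coord falg set \<Rightarrow> complex" where
  "nu c q n N X = Tr n N (T0 q n N X \<circ> Q0 c q N)"


section \<open>The quantum group\<close>

datatype ugen = UE nat | UF nat | UK nat | UKinv nat

abbreviation uE :: "nat \<Rightarrow> ugen falg" where "uE j \<equiv> fgen (UE j)"
abbreviation uF :: "nat \<Rightarrow> ugen falg" where "uF j \<equiv> fgen (UF j)"
abbreviation uK :: "nat \<Rightarrow> ugen falg" where "uK j \<equiv> fgen (UK j)"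
abbreviation uKinv :: "nat \<Rightarrow> ugen falg" where "uKinv j \<equiv> fgen (UKinv j)"

definition ugens :: "nat \<Rightarrow> ugen set" where
  "ugens N = UE ` {1..<N} \<union> UF ` {1..<N} \<union> UK ` {1..<N} \<union> UKinv ` {1..<N}"

definition cartan :: "nat \<Rightarrow> nat \<Rightarrow> int" where
  "cartan i j = (if i = j then 2 else if i = Suc j \<or> j = Suc i then - 1 else 0)"

inductive uq_rel :: "real \<Rightarrow> nat \<Rightarrow> ugen falg \<Rightarrow> ugen falg \<Rightarrow> bool" for q N where
  "i \<in> {1..<N} \<Longrightarrow> uq_rel q N (uK i * uKinv i) 1"
| "i \<in> {1..<N} \<Longrightarrow> uq_rel q N (uKinv i * uK i) 1"
| "\<lbrakk>i \<in> {1..<N}; j \<in> {1..<N}\<rbrakk> \<Longrightarrow> uq_rel q N (uK i * uK j) (uK j * uK i)"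
| "\<lbrakk>i \<in> {1..<N}; j \<in> {1..<N}\<rbrakk> \<Longrightarrow>
     uq_rel q N (uK i * uE j) (cscale (q powi cartan i j) (uE j * uK i))"
| "\<lbrakk>i \<in> {1..<N}; j \<in> {1..<N}\<rbrakk> \<Longrightarrow>
     uq_rel q N (uK i * uF j) (cscale (q powi (- cartan i j)) (uF j * uK i))"
| "\<lbrakk>i \<in> {1..<N}; j \<in> {1..<N}\<rbrakk> \<Longrightarrow>
     uq_rel q N (uE i * uF j - uF j * uE i)
       (if i = j then cscale (1 / (q - 1 / q)) (uK i - uKinv i) else 0)"
| "\<lbrakk>i \<in> {1..<N}; j \<in> {1..<N}; cartan i j = 0\<rbrakk> \<Longrightarrow> uq_rel q N (uE i * uE j) (uE j * uE i)"
| "\<lbrakk>i \<in> {1..<N}; j \<in> {1..<N}; cartan i j = 0\<rbrakk> \<Longrightarrow> uq_rel q N (uF i * uF j) (uF j * uF i)"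
| "\<lbrakk>i \<in> {1..<N}; j \<in> {1..<N}; cartan i j = - 1\<rbrakk> \<Longrightarrow>
     uq_rel q N (uE i * uE i * uE j - cscale (q + 1 / q) (uE i * uE j * uE i) + uE j * uE i * uE i) 0"
| "\<lbrakk>i \<in> {1..<N}; j \<in> {1..<N}; cartan i j = - 1\<rbrakk> \<Longrightarrow>
     uq_rel q N (uF i * uF i * uF j - cscale (q + 1 / q) (uF i * uF j * uF i) + uF j * uF i * uF i) 0"

definition Uq :: "real \<Rightarrow> nat \<Rightarrow> ugen falg set ring" where
  "Uq q N = presented_algebra (ugens N) (uq_rel q N)"

fun counit_gen :: "ugen \<Rightarrow> complex" where
  "counit_gen (UE j) = 0"
| "counit_gen (UF j) = 0"
| "counit_gen (UK j) = 1"
| "counit_gen (UKinv j) = 1"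

definition counit_free :: "ugen falg \<Rightarrow> complex" where
  "counit_free a = (\<Sum>w\<in>Poly_Mapping.keys a.
     Poly_Mapping.lookup a w * prod_list (map counit_gen (letters w)))"

definition counit :: "ugen falg set \<Rightarrow> complex" where
  "counit a = counit_free (crep a)"


section \<open>The action\<close>

text \<open>\<open>K\<^sub>j\<close> acts diagonally on the generators, with eigenvalue \<open>K_weight q j x\<close>.\<close>

fun K_weight :: "real \<Rightarrow> nat \<Rightarrow> coord \<Rightarrow> real" where
  "K_weight q j (CT i) = (if i = j then q else if i = Suc j then 1 / q else 1)"
| "K_weight q j (CTs i) = (if i = j then 1 / q else if i = Suc j then q else 1)"
| "K_weight q j (Chi k) = 1"

definition q_diff :: "real \<Rightarrow> (real \<Rightarrow> complex) \<Rightarrow> real \<Rightarrow> complex" where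
  "q_diff q g x = (g (q powi (-2) * x) - g x) / complex_of_real (q powi (-2) * x - x)"

fun E_gen :: "real \<Rightarrow> nat \<Rightarrow> nat \<Rightarrow> coord \<Rightarrow> coord falg" where
  "E_gen q n j (CT i) = (if i = Suc j then cscale (q powr (-1/2)) (gt j) else 0)"
| "E_gen q n j (CTs i) =
     (if i = j then cscale (if j = n then q powr (-3/2) else - (q powr (-3/2))) (gts (Suc j)) else 0)"
| "E_gen q n j (Chi k) =
     (if j = n then cscale (q powr (-1/2)) (gt n * fun_xi q (q_diff q (pt_ind q k)) * gts (Suc n)) else 0)"

fun F_gen :: "real \<Rightarrow> nat \<Rightarrow> nat \<Rightarrow> coord \<Rightarrow> coord falg" where
  "F_gen q n j (CT i) = (if i = j then cscale (q powr (1/2)) (gt (Suc j)) else 0)"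
| "F_gen q n j (CTs i) =
     (if i = Suc j then cscale (if j = n then q powr (3/2) else - (q powr (3/2))) (gts j) else 0)"
| "F_gen q n j (Chi k) =
     (if j = n then cscale (q powr (3/2)) (gt (Suc n) * fun_xi q (q_diff q (pt_ind q k)) * gts n) else 0)"

text \<open>On products the action is given by the coproduct:
  \<open>E(fg) = (Ef)g + (Kf)(Eg)\<close>, \<open>F(fg) = (Ff)(K\<^bsup>-1\<^esup>g) + f(Fg)\<close>, \<open>K(fg) = (Kf)(Kg)\<close>.\<close>

definition K_word :: "real \<Rightarrow> nat \<Rightarrow> coord list \<Rightarrow> coord falg" where
  "K_word q j xs = cscale (\<Prod>x\<leftarrow>xs. K_weight q j x) (Poly_Mapping.single (Word xs) 1)"

definition Kinv_word :: "real \<Rightarrow> nat \<Rightarrow> coord list \<Rightarrow> coord falg" where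
  "Kinv_word q j xs = cscale (\<Prod>x\<leftarrow>xs. 1 / K_weight q j x) (Poly_Mapping.single (Word xs) 1)"

primrec E_word :: "real \<Rightarrow> nat \<Rightarrow> nat \<Rightarrow> coord list \<Rightarrow> coord falg" where
  "E_word q n j [] = 0"
| "E_word q n j (x # xs) =
     E_gen q n j x * Poly_Mapping.single (Word xs) 1 + K_word q j [x] * E_word q n j xs"

primrec F_word :: "real \<Rightarrow> nat \<Rightarrow> nat \<Rightarrow> coord list \<Rightarrow> coord falg" where
  "F_word q n j [] = 0"
| "F_word q n j (x # xs) = F_gen q n j x * Kinv_word q j xs + fgen x * F_word q n j xs"

fun act_gen :: "real \<Rightarrow> nat \<Rightarrow> ugen \<Rightarrow> coord falg \<Rightarrow> coord falg" where
  "act_gen q n (UE j) f = linext (\<lambda>w. E_word q n j (letters w)) f"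
| "act_gen q n (UF j) f = linext (\<lambda>w. F_word q n j (letters w)) f"
| "act_gen q n (UK j) f = linext (\<lambda>w. K_word q j (letters w)) f"
| "act_gen q n (UKinv j) f = linext (\<lambda>w. Kinv_word q j (letters w)) f"

definition act_free :: "real \<Rightarrow> nat \<Rightarrow> ugen falg \<Rightarrow> coord falg \<Rightarrow> coord falg" where
  "act_free q n a f = linext (\<lambda>w. foldr (act_gen q n) (letters w) f) a"

definition act :: "real \<Rightarrow> nat \<Rightarrow> nat \<Rightarrow> ugen falg set \<Rightarrow> coord falg set \<Rightarrow> coord falg set" where
  "act q n N a X = A_cls q n N (act_free q n (crep a) (crep X))"

end

theory Submission
  imports Defs "HOL-Library.Function_Algebras"
begin

text \<open>In the representation \<open>T\<^sub>0\<close> all generators are weighted shifts of the basis, and the action of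
  \<open>E\<^sub>j\<close> is twisted inner: \<open>T\<^sub>0(E\<^sub>j f) = X\<^sub>j T\<^sub>0(f) - T\<^sub>0(K\<^sub>j f) X\<^sub>j\<close>, where \<open>X\<^sub>j\<close> is a multiple of
  \<open>t\<^sub>j \<xi>\<^bsub>j+1\<^esub>\<^bsup>-1\<^esup> t\<^bsub>j+1\<^esub>\<^sup>*\<close>. The action of \<open>F\<^sub>j\<close> is conjugate to that of \<open>E\<^sub>j\<close> under the involution.
  Hence the action preserves the kernel of \<open>T\<^sub>0\<close> (taken together with its torus twists, to account for
  \<open>K\<^bsub>N-1\<^esub>\<close>, which no diagonal operator implements), so that representatives may be chosen freely. Since
  \<open>K\<^sub>j\<close> multiplies a word of the weight that matters by \<open>q\<^bsup>-2\<^esup>\<close> and \<open>Q\<^sub>0\<^bsup>-1\<^esup> X\<^sub>j Q\<^sub>0 = q\<^sup>2 X\<^sub>j\<close>, invariance is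
  cyclicity of the trace. The traces converge because in the coordinates \<open>S\<^sub>2, \<dots>, S\<^sub>N\<close> the operator
  \<open>Q\<^sub>0\<close> is the product of the \<open>q\<^bsup>2 S\<^sub>l\<^esup>\<close>, every \<open>S\<^sub>l\<close> is at least \<open>S\<^bsub>n+1\<^esub>\<close>, and a finitely supported function
  of \<open>\<xi>\<^bsub>n+1\<^esub>\<close> fixes \<open>S\<^bsub>n+1\<^esub>\<close>. Positivity follows from \<open>\<nu>(f\<^sup>* f) = \<Sum>\<^sub>i Q\<^sub>0(i) \<parallel>T\<^sub>0(f) e\<^sub>i\<parallel>\<^sup>2\<close> once \<open>T\<^sub>0\<close> is
  faithful on normally ordered elements, and this is linear independence of characters.\<close>

section \<open>Linear maps between spaces of finitely supported functions\<close>

text \<open>The factor \<xi>_{j+1}^{-1} in X_j is forced: by the relations the q-commutator of t_j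
  t_{j+1}^* with t_{j+1} is a multiple of t_j \<xi>_{j+1}, whereas E_j t_{j+1} is a multiple of t_j.
  The price is that X_j is unbounded, growing like q^{-S_{j+1}}. As Q_0 contains q^{2 S_{j+1}}, one
  of the two factors q^{S_{j+1}} can be spent on X_j, and the other still yields a geometric series.
  A second obstacle is that t_N acts diagonally: the shift produced by a word does not show how
  often t_N occurs in it, although K_{N-1} rescales t_N. In the algebra of the theorem the letters
  t_k are balanced by adjoints, and this recovers the missing exponent. Hence the degree of words is
  followed from the outset, together with the presence of a function of \<xi>_{n+1}, on which
  convergence rests. No defining relation is ever differentiated by E_j or F_j. Representatives are
  compared modulo a two-sided ideal, stable under the involution, which contains the relations and
  on which the trace vanishes.\<close>

lemma lookup_cscale [simp]: "Poly_Mapping.lookup (cscale c f) k = c * Poly_Mapping.lookup f k"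
  by (simp add: cscale_def Poly_Mapping.map.rep_eq when_def)

interpretation pm: module "cscale :: complex \<Rightarrow> ('b \<Rightarrow>\<^sub>0 complex) \<Rightarrow> ('b \<Rightarrow>\<^sub>0 complex)"
  by unfold_locales (auto intro!: poly_mapping_eqI simp: lookup_add algebra_simps)

abbreviation clin :: "(('a \<Rightarrow>\<^sub>0 complex) \<Rightarrow> ('b \<Rightarrow>\<^sub>0 complex)) \<Rightarrow> bool" where
  "clin \<equiv> module_hom cscale cscale"

lemma clinI:
  assumes "\<And>x y. F (x + y) = F x + F y" "\<And>c x. F (cscale c x) = cscale c (F x)"
  shows "clin F"
  using assms by unfold_locales

lemmas clin_add = module_hom.add
lemmas clin_diff = module_hom.diff
lemmas clin_scale = module_hom.scale
lemmas clin_zero = module_hom.zero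
lemmas clin_sum = module_hom.sum

lemma clin_comp: "clin F \<Longrightarrow> clin G \<Longrightarrow> clin (\<lambda>x. F (G x))"
  using module_hom_compose[of cscale cscale G cscale F] by (simp add: o_def)

lemma cscale_single [simp]: "cscale c (Poly_Mapping.single w d) = Poly_Mapping.single w (c * d)"
  by (rule poly_mapping_eqI) (auto simp: lookup_single when_def)

lemma linext_superset:
  assumes "finite A" "Poly_Mapping.keys f \<subseteq> A"
  shows "linext \<phi> f = (\<Sum>w\<in>A. cscale (Poly_Mapping.lookup f w) (\<phi> w))"
  unfolding linext_def using assms
  by (intro sum.mono_neutral_left) (auto simp: in_keys_iff)

lemma clin_linext [simp, intro]: "clin (linext \<phi>)"
proof (rule clinI)
  fix f g :: "'a \<Rightarrow>\<^sub>0 complex"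
  let ?A = "Poly_Mapping.keys f \<union> Poly_Mapping.keys g"
  have "Poly_Mapping.keys (f + g) \<subseteq> ?A" by (rule keys_add)
  then show "linext \<phi> (f + g) = linext \<phi> f + linext \<phi> g"
    by (simp add: linext_superset[of ?A] lookup_add pm.scale_left_distrib sum.distrib)
next
  fix c and f :: "'a \<Rightarrow>\<^sub>0 complex"
  have "Poly_Mapping.keys (cscale c f) \<subseteq> Poly_Mapping.keys f" by (auto simp: in_keys_iff)
  then show "linext \<phi> (cscale c f) = cscale c (linext \<phi> f)"
    by (simp add: linext_superset[of "Poly_Mapping.keys f"] pm.scale_sum_right)
qed

lemma linext_single [simp]: "linext \<phi> (Poly_Mapping.single w c) = cscale c (\<phi> w)"
  by (cases "c = 0") (simp_all add: linext_def)

lemma poly_mapping_expand: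
  "f = (\<Sum>w\<in>Poly_Mapping.keys f. cscale (Poly_Mapping.lookup f w) (Poly_Mapping.single w 1))"
  for f :: "'a \<Rightarrow>\<^sub>0 complex"
  by (rule poly_mapping_eqI)
    (simp add: lookup_sum lookup_single when_def in_keys_iff sum.delta' if_distrib cong: if_cong)

lemma clin_eqI:
  assumes "clin F" "clin G"
    and "\<And>w. w \<in> Poly_Mapping.keys f \<Longrightarrow> F (Poly_Mapping.single w 1) = G (Poly_Mapping.single w 1)"
  shows "F f = G f"
proof -
  have "F f = (\<Sum>w\<in>Poly_Mapping.keys f. cscale (Poly_Mapping.lookup f w) (F (Poly_Mapping.single w 1)))"
    by (subst poly_mapping_expand[of f], subst clin_sum[OF assms(1)])
      (simp only: clin_scale[OF assms(1)])
  also have "\<dots> = (\<Sum>w\<in>Poly_Mapping.keys f. cscale (Poly_Mapping.lookup f w) (G (Poly_Mapping.single w 1)))"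
    by (simp add: assms(3))
  also have "\<dots> = G f"
    by (subst (3) poly_mapping_expand[of f], subst clin_sum[OF assms(2)])
      (simp only: clin_scale[OF assms(2)])
  finally show ?thesis .
qed

lemma lookup_linext:
  "Poly_Mapping.lookup (linext \<phi> f) k =
     (\<Sum>w\<in>Poly_Mapping.keys f. Poly_Mapping.lookup f w * Poly_Mapping.lookup (\<phi> w) k)"
  by (simp add: linext_def lookup_sum)

lemma linext_linear_param:
  assumes "\<And>w. clin (\<lambda>v. \<phi> w v)"
  shows "clin (\<lambda>v. linext (\<lambda>w. \<phi> w v) f)"
  by (rule clinI)
    (simp_all add: linext_def clin_add[OF assms] clin_scale[OF assms] pm.scale_right_distrib
      sum.distrib pm.scale_sum_right mult.commute)

lemma cscale_mult_left: "cscale c f * g = cscale c (f * g)"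
  for f g :: "'a::monoid_add \<Rightarrow>\<^sub>0 complex"
  by (simp add: cscale_def mult_map_scale_conv_mult mult.assoc)

lemma clin_mult_left: "clin (\<lambda>f. f * g)" for g :: "'a::monoid_add \<Rightarrow>\<^sub>0 complex"
  by (rule clinI) (simp_all add: distrib_right cscale_mult_left)

lemma cscale_eq_mult: "cscale c f = Poly_Mapping.single 0 c * f"
  for f :: "'a::monoid_add \<Rightarrow>\<^sub>0 complex"
  by (simp only: cscale_def mult_map_scale_conv_mult)

text \<open>The product is noncommutative, so this is the centrality of the constants
  \<open>single 0 c\<close>, which is checked on basis vectors.\<close>

lemma cscale_mult_right: "f * cscale c g = cscale c (f * g)"
  for f g :: "'a::monoid_add \<Rightarrow>\<^sub>0 complex"
proof -
  let ?s = "Poly_Mapping.single (0::'a) c"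
  have "f * ?s = ?s * f"
  proof (rule clin_eqI[where F = "\<lambda>f. f * ?s" and G = "\<lambda>f. ?s * f"])
    show "clin (\<lambda>f. f * ?s)" by (rule clin_mult_left)
    have "?s * cscale d h = cscale d (?s * h)" for d h
      by (simp only: cscale_eq_mult[symmetric] pm.scale_scale mult.commute)
    then show "clin (\<lambda>f. ?s * f)" by (intro clinI) (simp_all only: distrib_left)
    show "Poly_Mapping.single w 1 * ?s = ?s * Poly_Mapping.single w 1" for w
      by (simp add: mult_single)
  qed
  then show ?thesis
    by (metis cscale_eq_mult mult.assoc)
qed

lemma clin_mult_right: "clin (\<lambda>g. f * g)" for f :: "'a::monoid_add \<Rightarrow>\<^sub>0 complex"
  by (rule clinI) (simp_all add: distrib_left cscale_mult_right)

section \<open>Free algebras\<close>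

abbreviation wsingle :: "'g list \<Rightarrow> 'g falg" where
  "wsingle xs \<equiv> Poly_Mapping.single (Word xs) 1"

lemma word_plus [simp]: "Word xs + Word ys = Word (xs @ ys)"
  by (simp add: plus_word_def)

lemma letters_plus [simp]: "letters (u + v) = letters u @ letters v"
  by (simp add: plus_word_def)

lemma wsingle_mult: "wsingle xs * wsingle ys = wsingle (xs @ ys)"
  by (simp add: mult_single)

lemma fgen_mult_wsingle: "fgen x * wsingle xs = wsingle (x # xs)"
  by (simp add: fgen_def mult_single)

lemma wsingle_Nil: "wsingle [] = 1"
  by (simp add: zero_word_def[symmetric])

lemma clin_mult_eqI:
  fixes f g :: "'g falg"
  assumes "clin F" "\<And>f. clin (H f)" "\<And>g. clin (\<lambda>f. H f g)"
    and "\<And>xs ys. Word xs \<in> Poly_Mapping.keys f \<Longrightarrow> Word ys \<in> Poly_Mapping.keys g \<Longrightarrow>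
      F (wsingle (xs @ ys)) = H (wsingle xs) (wsingle ys)"
  shows "F (f * g) = H f g"
proof (rule clin_eqI[where F = "\<lambda>f. F (f * g)" and G = "\<lambda>f. H f g"])
  show "clin (\<lambda>f. F (f * g))" by (intro clin_comp[OF assms(1)] clin_mult_left)
  show "clin (\<lambda>f. H f g)" by (rule assms(3))
  fix u assume u: "u \<in> Poly_Mapping.keys f"
  show "F (Poly_Mapping.single u 1 * g) = H (Poly_Mapping.single u 1) g"
  proof (rule clin_eqI[where F = "\<lambda>g. F (Poly_Mapping.single u 1 * g)"])
    show "clin (\<lambda>g. F (Poly_Mapping.single u 1 * g))"
      by (intro clin_comp[OF assms(1)] clin_mult_right)
    show "clin (H (Poly_Mapping.single u 1))" by (rule assms(2))
    fix v assume "v \<in> Poly_Mapping.keys g"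
    then show "F (Poly_Mapping.single u 1 * Poly_Mapping.single v 1) =
      H (Poly_Mapping.single u 1) (Poly_Mapping.single v 1)"
      using assms(4)[of "letters u" "letters v"] u by (simp add: mult_single plus_word_def)
  qed
qed

text \<open>The module over a free algebra determined by one operator per letter;
  \<open>T0_free\<close> and \<open>act_free\<close> are both instances.\<close>

definition frep :: "('g \<Rightarrow> ('b \<Rightarrow>\<^sub>0 complex) \<Rightarrow> ('b \<Rightarrow>\<^sub>0 complex)) \<Rightarrow> 'g falg \<Rightarrow> ('b \<Rightarrow>\<^sub>0 complex) \<Rightarrow> ('b \<Rightarrow>\<^sub>0 complex)"
  where "frep \<Phi> a v = linext (\<lambda>w. foldr \<Phi> (letters w) v) a"

lemma clin_foldr: "(\<And>x. clin (\<Phi> x)) \<Longrightarrow> clin (foldr \<Phi> xs)"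
proof (induction xs)
  case Nil then show ?case by (simp add: clinI)
next
  case (Cons x xs) then show ?case
    using clin_comp[of "\<Phi> x" "foldr \<Phi> xs"] by (simp add: o_def)
qed

lemma clin_frep_left [simp, intro]: "clin (\<lambda>a. frep \<Phi> a v)"
  unfolding frep_def by simp

lemma clin_frep_right: "(\<And>x. clin (\<Phi> x)) \<Longrightarrow> clin (frep \<Phi> a)"
  unfolding frep_def by (intro linext_linear_param clin_foldr)

lemma frep_wsingle: "frep \<Phi> (wsingle xs) v = foldr \<Phi> xs v"
  by (simp add: frep_def)

lemma frep_mult:
  assumes "\<And>x. clin (\<Phi> x)"
  shows "frep \<Phi> (a * b) v = frep \<Phi> a (frep \<Phi> b v)"
proof (rule clin_mult_eqI[where F = "\<lambda>a. frep \<Phi> a v"])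
  show "clin (\<lambda>b. frep \<Phi> a (frep \<Phi> b v))" for a
    by (intro clin_comp[OF clin_frep_right] assms clin_frep_left)
qed (simp_all add: frep_wsingle)

lemma frep_one: "frep \<Phi> 1 v = v"
  using frep_wsingle[of \<Phi> "[]" v] by (simp add: wsingle_Nil)

lemma frep_fgen: "frep \<Phi> (fgen x) v = \<Phi> x v"
  using frep_wsingle[of \<Phi> "[x]" v] by (simp add: fgen_def)

text \<open>Carriers, degrees and supports are all conditions on single words, and this treats them
  uniformly.\<close>

definition wspan :: "('g list \<Rightarrow> bool) \<Rightarrow> 'g falg set" where
  "wspan P = {f. \<forall>u\<in>Poly_Mapping.keys f. P (letters u)}"

lemma wspan_0 [simp, intro]: "0 \<in> wspan P"
  by (simp add: wspan_def)

lemma wspan_add [intro]: "f \<in> wspan P \<Longrightarrow> g \<in> wspan P \<Longrightarrow> f + g \<in> wspan P"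
  unfolding wspan_def using keys_add[of f g] by auto

lemma wspan_cscale [intro]: "f \<in> wspan P \<Longrightarrow> cscale c f \<in> wspan P"
  unfolding wspan_def by (auto simp: in_keys_iff)

lemma wspan_minus [intro]: "f \<in> wspan P \<Longrightarrow> - f \<in> wspan P"
  unfolding wspan_def by (auto simp: in_keys_iff)

lemma wspan_diff [intro]: "f \<in> wspan P \<Longrightarrow> g \<in> wspan P \<Longrightarrow> f - g \<in> wspan P"
  using wspan_add[of f P "- g"] by auto

lemma wspan_sum: "(\<And>i. i \<in> A \<Longrightarrow> f i \<in> wspan P) \<Longrightarrow> sum f A \<in> wspan P"
  by (induction A rule: infinite_finite_induct) auto

lemma wspan_linext: "(\<And>w. w \<in> Poly_Mapping.keys f \<Longrightarrow> \<phi> w \<in> wspan P) \<Longrightarrow> linext \<phi> f \<in> wspan P"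
  unfolding linext_def by (intro wspan_sum wspan_cscale) auto

lemma wspan_wsingle [simp]: "wsingle xs \<in> wspan P \<longleftrightarrow> P xs"
  by (simp add: wspan_def)

lemma wspan_fgen [simp]: "fgen x \<in> wspan P \<longleftrightarrow> P [x]"
  by (simp add: fgen_def)

lemma wspan_one [simp]: "1 \<in> wspan P \<longleftrightarrow> P []"
  using wspan_wsingle[of "[]" P] by (simp add: wsingle_Nil)

lemma wspan_mult:
  assumes "f \<in> wspan P" "g \<in> wspan Q" "\<And>xs ys. P xs \<Longrightarrow> Q ys \<Longrightarrow> R (xs @ ys)"
  shows "f * g \<in> wspan R"
  using assms keys_mult[of f g] by (fastforce simp: wspan_def)

lemma wspan_mono: "(\<And>xs. P xs \<Longrightarrow> Q xs) \<Longrightarrow> f \<in> wspan P \<Longrightarrow> f \<in> wspan Q"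
  by (auto simp: wspan_def)

lemma free_algebra_carrier: "carrier (free_algebra G) = wspan (\<lambda>xs. set xs \<subseteq> G)"
  by (simp add: free_algebra_def wspan_def)

lemma free_algebra_ops [simp]:
  "mult (free_algebra G) = (*)" "one (free_algebra G) = 1"
  "zero (free_algebra G) = 0" "add (free_algebra G) = (+)"
  by (simp_all add: free_algebra_def)

lemma ring_free_algebra: "ring (free_algebra G)"
proof (rule ringI)
  show "abelian_group (free_algebra G)"
  proof (rule abelian_groupI)
    fix x assume "x \<in> carrier (free_algebra G)"
    then show "\<exists>y\<in>carrier (free_algebra G). y \<oplus>\<^bsub>free_algebra G\<^esub> x = \<zero>\<^bsub>free_algebra G\<^esub>"
      by (intro bexI[of _ "- x"]) (auto simp: free_algebra_carrier)
  qed (auto simp: free_algebra_carrier add_ac)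
  show "Group.monoid (free_algebra G)"
  proof (rule monoidI)
    fix x y assume "x \<in> carrier (free_algebra G)" "y \<in> carrier (free_algebra G)"
    then show "x \<otimes>\<^bsub>free_algebra G\<^esub> y \<in> carrier (free_algebra G)"
      unfolding free_algebra_carrier free_algebra_ops
      by (rule wspan_mult) simp
  qed (simp_all add: free_algebra_carrier mult.assoc)
qed (auto simp: free_algebra_carrier distrib_left distrib_right)

section \<open>Ideals of relations, cosets and chosen representatives\<close>

lemma rel_ideal_minimal:
  assumes "ideal I (free_algebra G)" "\<And>l r. R l r \<Longrightarrow> l - r \<in> I"
  shows "rel_ideal G R \<subseteq> I"
  unfolding rel_ideal_def
  by (rule ring.genideal_minimal[OF ring_free_algebra]) (use assms in auto)

lemma rel_ideal_carrier:
  assumes "\<And>l r. R l r \<Longrightarrow> l - r \<in> carrier (free_algebra G)"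
  shows "rel_ideal G R \<subseteq> carrier (free_algebra G)"
  using assms by (intro rel_ideal_minimal ring.oneideal ring_free_algebra)

lemma zero_in_rel_ideal: "0 \<in> rel_ideal G R"
proof -
  have "0 \<in> I" if "ideal I (free_algebra G)" for I
    using additive_subgroup.zero_closed[OF ideal.axioms(1)[OF that]] by simp
  then show ?thesis unfolding rel_ideal_def genideal_def by blast
qed

lemma coset_iff: "f \<in> I +>\<^bsub>free_algebra G\<^esub> d \<longleftrightarrow> f - d \<in> I"
  unfolding a_r_coset_def' free_algebra_ops
proof (safe)
  assume "f - d \<in> I" then show "f \<in> (\<Union>h\<in>I. {h + d})"
    by (intro UN_I[of "f - d"]) simp_all
qed simp

lemma cls_iff: "f \<in> cls G R d \<longleftrightarrow> f - d \<in> rel_ideal G R"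
  by (simp add: cls_def coset_iff)

lemma self_in_cls: "d \<in> cls G R d"
  by (simp add: cls_iff zero_in_rel_ideal)

lemma crep_in: "f \<in> X \<Longrightarrow> crep X \<in> X"
  unfolding crep_def by (rule someI)

lemma presented_algebra_carrier:
  "carrier (presented_algebra G R) = cls G R ` carrier (free_algebra G)"
  by (auto simp: presented_algebra_def FactRing_def A_RCOSETS_def' cls_def)

lemma presented_algebra_zero: "\<zero>\<^bsub>presented_algebra G R\<^esub> = cls G R 0"
  by (simp add: presented_algebra_def FactRing_def set_eq_iff cls_iff)

lemma presented_algebra_add_iff:
  "f \<in> X \<oplus>\<^bsub>presented_algebra G R\<^esub> Y \<longleftrightarrow> (\<exists>a\<in>X. \<exists>b\<in>Y. f = a + b)"
  by (simp add: presented_algebra_def FactRing_def set_add_def')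

lemma presented_algebra_mult_iff:
  "f \<in> X \<otimes>\<^bsub>presented_algebra G R\<^esub> Y \<longleftrightarrow> (\<exists>a\<in>X. \<exists>b\<in>Y. f - a * b \<in> rel_ideal G R)"
  by (simp add: presented_algebra_def FactRing_def rcoset_mult_def coset_iff)

section \<open>Torus action and involution\<close>

fun wt :: "(nat \<Rightarrow> complex) \<Rightarrow> coord \<Rightarrow> complex" where
  "wt w (CT j) = w j"
| "wt w (CTs j) = inverse (w j)"
| "wt w (Chi k) = 1"

text \<open>The full torus of rescalings of t_j by w_j. \<open>K_j\<close> is its point
  \<open>kwt q j\<close>. The involution carries w to the inverse conjugate, so complex parameters
  are allowed.\<close>

definition torus :: "(nat \<Rightarrow> complex) \<Rightarrow> coord falg \<Rightarrow> coord falg" where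
  "torus w = linext (\<lambda>u. cscale (\<Prod>x\<leftarrow>letters u. wt w x) (Poly_Mapping.single u 1))"

lemma clin_torus [simp, intro]: "clin (torus w)"
  by (simp add: torus_def)

lemma torus_wsingle: "torus w (wsingle xs) = cscale (\<Prod>x\<leftarrow>xs. wt w x) (wsingle xs)"
  by (simp add: torus_def)

lemma torus_single: "torus w (Poly_Mapping.single (Word xs) a) = Poly_Mapping.single (Word xs) (a * (\<Prod>x\<leftarrow>xs. wt w x))"
  by (simp add: torus_def)

lemma torus_fgen: "torus w (fgen x) = cscale (wt w x) (fgen x)"
  using torus_wsingle[of w "[x]"] by (simp add: fgen_def)

lemma torus_mult: "torus w (f * g) = torus w f * torus w g"
proof (rule clin_mult_eqI[where F = "torus w" and H = "\<lambda>f g. torus w f * torus w g"])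
  show "clin (\<lambda>g. torus w f * torus w g)" for f
    by (intro clin_comp[OF clin_mult_right]) simp
  show "clin (\<lambda>f. torus w f * torus w g)" for g
    by (intro clin_comp[OF clin_mult_left]) simp
qed (simp_all add: torus_wsingle cscale_mult_left cscale_mult_right mult_single)

lemma torus_torus: "torus w (torus w' f) = torus (\<lambda>j. w j * w' j) f"
proof (rule clin_eqI[where F = "\<lambda>f. torus w (torus w' f)"])
  have wt: "wt w x * wt w' x = wt (\<lambda>j. w j * w' j) x" for x
    by (cases x) simp_all
  have "prod_list (map (wt w) xs) * prod_list (map (wt w') xs) = prod_list (map (wt (\<lambda>j. w j * w' j)) xs)" for xs
    by (induction xs) (simp_all add: wt[symmetric] mult_ac)
  then show "torus w (torus w' (Poly_Mapping.single u 1)) = torus (\<lambda>j. w j * w' j) (Poly_Mapping.single u 1)" for u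
    by (cases u) (simp add: torus_single mult.commute)
qed (auto intro: clin_comp)

lemma torus_id: "torus (\<lambda>_. 1) f = f"
proof (rule clin_eqI)
  have "wt (\<lambda>_. 1) x = 1" for x by (cases x) simp_all
  then have "prod_list (map (wt (\<lambda>_. 1)) xs) = 1" for xs by (induction xs) simp_all
  then show "torus (\<lambda>_. 1) (Poly_Mapping.single u 1) = Poly_Mapping.single u 1" for u
    by (cases u) (simp add: torus_wsingle)
qed (auto intro: clinI)

lemma torus_wspan: "f \<in> wspan P \<Longrightarrow> torus w f \<in> wspan P"
  unfolding torus_def by (intro wspan_linext wspan_cscale) (auto simp: wspan_def)

text \<open>The involution is conjugate linear, so \<open>clin_eqI\<close> does not apply to it;
  additivity suffices if monomials with arbitrary coefficients are compared.\<close>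

lemma additive_eqI:
  fixes F G :: "('a \<Rightarrow>\<^sub>0 complex) \<Rightarrow> 'b::ab_group_add"
  assumes "\<And>x y. F (x + y) = F x + F y" "\<And>x y. G (x + y) = G x + G y"
    and "\<And>w c. w \<in> Poly_Mapping.keys f \<Longrightarrow> F (Poly_Mapping.single w c) = G (Poly_Mapping.single w c)"
  shows "F f = G f"
proof -
  have z: "F 0 = 0" "G 0 = 0" using assms(1)[of 0 0] assms(2)[of 0 0] by simp_all
  have s: "F (sum h A) = (\<Sum>x\<in>A. F (h x))" "G (sum h A) = (\<Sum>x\<in>A. G (h x))" for h and A :: "'a set"
    by (induction A rule: infinite_finite_induct) (simp_all add: assms z)
  have e: "f = (\<Sum>w\<in>Poly_Mapping.keys f. Poly_Mapping.single w (Poly_Mapping.lookup f w))"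
    using poly_mapping_expand[of f] by simp
  show ?thesis by (subst (1 2) e) (simp add: s assms(3))
qed

lemma coord_star_invol [simp]: "coord_star (coord_star x) = x"
  by (cases x) simp_all

lemma map_coord_star_invol [simp]: "map (coord_star \<circ> coord_star) xs = xs"
  by (simp add: o_def)

lemma star_word_invol [simp]: "rev (map coord_star (rev (map coord_star xs))) = xs"
  by (induction xs) simp_all

lemma lookup_fstar:
  "Poly_Mapping.lookup (fstar f) (Word xs) = cnj (Poly_Mapping.lookup f (Word (rev (map coord_star xs))))"
proof -
  let ?s = "\<lambda>u. Word (rev (map coord_star (letters u)))"
  have inv: "?s u = Word xs \<longleftrightarrow> u = ?s (Word xs)" for u
    by (cases u) (metis star_word_invol word.sel)
  have "Poly_Mapping.lookup (fstar f) (Word xs) =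
    (\<Sum>u\<in>Poly_Mapping.keys f. if u = ?s (Word xs) then cnj (Poly_Mapping.lookup f u) else 0)"
    unfolding fstar_def lookup_sum
    by (intro sum.cong refl) (auto simp: lookup_single when_def inv)
  also have "\<dots> = cnj (Poly_Mapping.lookup f (?s (Word xs)))"
    by (simp add: sum.delta in_keys_iff)
  finally show ?thesis by simp
qed

lemma falg_eqI: "(\<And>xs. Poly_Mapping.lookup f (Word xs) = Poly_Mapping.lookup g (Word xs)) \<Longrightarrow> f = g"
  by (rule poly_mapping_eqI) (metis word.exhaust)

lemma fstar_add: "fstar (f + g) = fstar f + fstar g"
  by (rule falg_eqI) (simp add: lookup_fstar lookup_add)

lemma fstar_diff: "fstar (f - g) = fstar f - fstar g"
  by (rule falg_eqI) (simp add: lookup_fstar lookup_minus)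

lemma fstar_zero [simp]: "fstar 0 = 0"
  by (rule falg_eqI) (simp add: lookup_fstar)

lemma fstar_sum: "fstar (sum h A) = (\<Sum>x\<in>A. fstar (h x))"
  by (induction A rule: infinite_finite_induct) (simp_all add: fstar_add)

lemma fstar_cscale: "fstar (cscale c f) = cscale (cnj c) (fstar f)"
  by (rule falg_eqI) (simp add: lookup_fstar)

lemma fstar_fstar [simp]: "fstar (fstar f) = f"
  by (rule falg_eqI) (simp add: lookup_fstar rev_map)

lemma fstar_single: "fstar (Poly_Mapping.single (Word xs) a) = Poly_Mapping.single (Word (rev (map coord_star xs))) (cnj a)"
  by (rule falg_eqI) (auto simp: lookup_fstar lookup_single when_def rev_map)

lemma fstar_fgen: "fstar (fgen x) = fgen (coord_star x)"
  by (simp add: fgen_def fstar_single)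

lemma fstar_mult: "fstar (f * g) = fstar g * fstar f"
proof (rule additive_eqI[where F = "\<lambda>f. fstar (f * g)"])
  fix u a
  show "fstar (Poly_Mapping.single u a * g) = fstar g * fstar (Poly_Mapping.single u a)"
  proof (rule additive_eqI[where F = "\<lambda>g. fstar (Poly_Mapping.single u a * g)"])
    show "fstar (Poly_Mapping.single u a * Poly_Mapping.single v b) =
      fstar (Poly_Mapping.single v b) * fstar (Poly_Mapping.single u a)" for v b
      by (cases u; cases v) (simp add: mult_single fstar_single mult.commute)
  qed (simp_all add: fstar_add distrib_left distrib_right)
qed (simp_all add: fstar_add distrib_left distrib_right)

lemma wspan_fstar:
  assumes "f \<in> wspan P" "\<And>xs. P xs \<Longrightarrow> Q (rev (map coord_star xs))"
  shows "fstar f \<in> wspan Q"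
proof -
  have "Q xs" if "Poly_Mapping.lookup f (Word (rev (map coord_star xs))) \<noteq> 0" for xs
  proof -
    have "P (rev (map coord_star xs))" using assms(1) that
      by (force simp: wspan_def in_keys_iff)
    from assms(2)[OF this] show ?thesis by (simp add: rev_map)
  qed
  then show ?thesis
    by (auto simp: wspan_def in_keys_iff) (metis lookup_fstar word.exhaust_sel complex_cnj_zero)
qed

lemma torus_fstar: "torus w (fstar f) = fstar (torus (\<lambda>j. inverse (cnj (w j))) f)"
proof (rule additive_eqI[where F = "\<lambda>f. torus w (fstar f)"])
  let ?w = "\<lambda>j. inverse (cnj (w j))"
  have a: "cnj (wt ?w x) = wt w (coord_star x)" for x
    by (cases x) simp_all
  have "cnj (\<Prod>x\<leftarrow>xs. wt ?w x) = (\<Prod>x\<leftarrow>rev (map coord_star xs). wt w x)" for xs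
    by (induction xs) (simp_all add: a mult.commute)
  then show "torus w (fstar (Poly_Mapping.single u a)) = fstar (torus ?w (Poly_Mapping.single u a))" for u a
    by (cases u) (simp add: torus_def fstar_single mult.commute)
qed (simp_all add: fstar_add clin_add[OF clin_torus])

section \<open>The action on words\<close>

definition kwt :: "real \<Rightarrow> nat \<Rightarrow> nat \<Rightarrow> complex" where
  "kwt q j i = (if i = j then q else if i = Suc j then 1 / q else 1)"

lemma K_weight_wt: "complex_of_real (K_weight q j x) = wt (kwt q j) x"
  by (cases x) (auto simp: kwt_def divide_inverse)

lemma K_weight_wt_inverse: "complex_of_real (1 / K_weight q j x) = wt (\<lambda>i. inverse (kwt q j i)) x"
  by (cases x) (auto simp: kwt_def divide_inverse)

lemma of_real_prod_list: "of_real (prod_list xs) = prod_list (map of_real xs)"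
  by (induction xs) simp_all

lemma K_word_torus: "K_word q j xs = torus (kwt q j) (wsingle xs)"
  by (simp add: K_word_def torus_wsingle of_real_prod_list o_def K_weight_wt)

lemma act_gen_UK: "act_gen q n (UK j) = torus (kwt q j)"
  by (simp add: fun_eq_iff K_word_def torus_def of_real_prod_list o_def K_weight_wt)

lemma act_gen_UKinv: "act_gen q n (UKinv j) = torus (\<lambda>i. inverse (kwt q j i))"
  by (simp add: fun_eq_iff Kinv_word_def torus_def of_real_prod_list o_def K_weight_wt_inverse del: of_real_divide)

lemma clin_act_gen [simp, intro]: "clin (act_gen q n u)"
proof (cases u)
  case (UE j)
  then have "act_gen q n u = linext (\<lambda>w. E_word q n j (letters w))" by (simp add: fun_eq_iff)
  then show ?thesis by simp
next
  case (UF j)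
  then have "act_gen q n u = linext (\<lambda>w. F_word q n j (letters w))" by (simp add: fun_eq_iff)
  then show ?thesis by simp
next
  case (UK j) then show ?thesis using clin_torus by (simp only: act_gen_UK)
next
  case (UKinv j) then show ?thesis using clin_torus by (simp only: act_gen_UKinv)
qed

lemma torus_fun_xi: "torus w (fun_xi q g) = fun_xi q g"
  by (simp add: fun_xi_def clin_sum[OF clin_torus] clin_scale[OF clin_torus] torus_fgen)

lemma torus_gt_gts: "w j \<noteq> 0 \<Longrightarrow> torus w (gt j * gts j) = gt j * gts j"
  by (simp add: torus_mult torus_fgen cscale_mult_left cscale_mult_right)

lemma torus_gts_gt: "w j \<noteq> 0 \<Longrightarrow> torus w (gts j * gt j) = gts j * gt j"
  by (simp add: torus_mult torus_fgen cscale_mult_left cscale_mult_right)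

text \<open>\<open>E_j\<close> trades t_{j+1} for t_j, and dually, which has torus weight w_j /
  w_{j+1}.\<close>

lemma torus_E_gen:
  assumes "\<And>i. w i \<noteq> 0"
  shows "torus w (E_gen q n j x) = cscale (w j / w (Suc j) * wt w x) (E_gen q n j x)"
  using assms
  by (cases x) (auto simp: clin_scale[OF clin_torus] torus_mult torus_fgen torus_fun_xi
      cscale_mult_left cscale_mult_right clin_zero[OF clin_torus] field_simps)

lemma torus_E_word:
  assumes "\<And>i. w i \<noteq> 0"
  shows "torus w (E_word q n j xs) = cscale (w j / w (Suc j) * (\<Prod>x\<leftarrow>xs. wt w x)) (E_word q n j xs)"
proof (induction xs)
  case Nil
  then show ?case by (simp add: clin_zero[OF clin_torus])
next
  case (Cons x xs)
  have K: "torus w (K_word q j [x]) = cscale (wt w x) (K_word q j [x])"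
    by (simp add: K_word_def torus_single mult.commute)
  have xs: "torus w (wsingle xs) = cscale (\<Prod>x\<leftarrow>xs. wt w x) (wsingle xs)"
    by (rule torus_wsingle)
  have wt: "wt w x \<noteq> 0" for x using assms by (cases x) simp_all
  show ?case
    by (simp add: clin_add[OF clin_torus] torus_mult Cons.IH xs torus_E_gen[OF assms] K
        del: cscale_single add: cscale_mult_left cscale_mult_right pm.scale_right_distrib mult_ac)
qed

text \<open>The recursion splits off the first letter of a word. The involution reverses words, so
  the passage to \<open>F_j\<close> needs the twisted Leibniz rule at the last letter too.\<close>

lemma E_word_append:
  "E_word q n j (xs @ ys) = E_word q n j xs * wsingle ys + K_word q j xs * E_word q n j ys"
proof (induction xs)
  case Nil
  then show ?case by (simp add: K_word_def wsingle_Nil)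
next
  case (Cons x xs)
  have "K_word q j (x # xs) = K_word q j [x] * K_word q j xs"
    by (simp add: K_word_torus torus_mult[symmetric] wsingle_mult)
  then show ?case
    by (simp add: Cons.IH distrib_left distrib_right mult.assoc wsingle_mult[symmetric] add.assoc)
qed

lemma fstar_fun_xi: "fstar (fun_xi q g) = fun_xi q (\<lambda>x. cnj (g x))"
  by (simp add: fun_xi_def fstar_sum fstar_cscale fstar_fgen)

text \<open>This is the rule that the adjoint of a f is S(a)^* f^*, for a = E_j: here S(E_j)^* is
  -q^{-2} F_j for j \<noteq> n and q^{-2} F_n for j = n.\<close>

lemma F_gen_star:
  assumes "0 < q"
  shows "F_gen q n j x = cscale (if j = n then q^2 else - (q^2)) (fstar (E_gen q n j (coord_star x)))"
proof -
  have p: "q powr (3/2) = q^2 * q powr (-1/2)" "q powr (1/2) = q^2 * q powr (-3/2)"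
    using assms by (simp_all add: powr_add[symmetric] powr_realpow[symmetric] flip: powr_numeral)
  have r: "cnj (q_diff q (pt_ind q k) y) = q_diff q (pt_ind q k) y" for k y
    by (simp add: q_diff_def pt_ind_def)
  show ?thesis
    by (cases x) (auto simp: fstar_cscale fstar_fgen fstar_mult fstar_fun_xi r p mult.assoc simp del: powr_half_sqrt)
qed

lemma F_word_star:
  assumes "0 < q"
  shows "F_word q n j xs =
    cscale (if j = n then q^2 else - (q^2)) (fstar (E_word q n j (rev (map coord_star xs))))"
proof (induction xs)
  case (Cons x xs)
  have w: "K_weight q j (coord_star y) = 1 / K_weight q j y" for y
    using assms by (cases y) auto
  have p: "(\<Prod>y\<leftarrow>rev (map coord_star xs). K_weight q j y) = (\<Prod>y\<leftarrow>xs. 1 / K_weight q j y)"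
    by (induction xs) (simp_all add: w mult.commute)
  have K: "fstar (K_word q j (rev (map coord_star xs))) = Kinv_word q j xs"
    by (simp add: K_word_def Kinv_word_def fstar_single p del: rev_map)
  have s: "fstar (wsingle [coord_star x]) = fgen x"
    by (simp add: fstar_single fgen_def)
  show ?case
    by (simp add: E_word_append fstar_add fstar_mult K s Cons.IH F_gen_star[OF assms] wsingle_Nil
        pm.scale_right_distrib cscale_mult_left cscale_mult_right add.commute)
qed simp

lemma act_gen_UF:
  assumes "0 < q"
  shows "act_gen q n (UF j) f =
    cscale (if j = n then q^2 else - (q^2)) (fstar (act_gen q n (UE j) (fstar f)))"
proof (rule additive_eqI[where F = "act_gen q n (UF j)"])
  show "act_gen q n (UF j) (Poly_Mapping.single u a) =
    cscale (if j = n then q^2 else - (q^2)) (fstar (act_gen q n (UE j) (fstar (Poly_Mapping.single u a))))" for u a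
    by (cases u) (simp add: fstar_single fstar_cscale F_word_star[OF assms] mult.commute)
qed (simp_all add: clin_add[OF clin_act_gen] fstar_add pm.scale_right_distrib del: act_gen.simps)

section \<open>Degree and support of words\<close>

fun cdeg :: "coord \<Rightarrow> int" where
  "cdeg (CT j) = 1"
| "cdeg (CTs j) = -1"
| "cdeg (Chi k) = 0"

definition has_chi :: "coord list \<Rightarrow> bool" where
  "has_chi xs \<longleftrightarrow> (\<exists>k. Chi k \<in> set xs)"

text \<open>The flag \<open>True\<close> demands an indicator function in every word, the source of
  convergence; \<open>False\<close> demands nothing. The number d is the degree for the common
  rescaling of all t_j.\<close>

definition homog :: "nat \<Rightarrow> bool \<Rightarrow> int \<Rightarrow> coord list \<Rightarrow> bool" where
  "homog N b d xs \<longleftrightarrow> set xs \<subseteq> coords N \<and> (b \<longrightarrow> has_chi xs) \<and> (\<Sum>x\<leftarrow>xs. cdeg x) = d"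

lemma homog_mult:
  "f \<in> wspan (homog N b d) \<Longrightarrow> g \<in> wspan (homog N b' d') \<Longrightarrow> b'' = (b \<or> b') \<Longrightarrow> d'' = d + d' \<Longrightarrow>
    f * g \<in> wspan (homog N b'' d'')"
  by (rule wspan_mult[of f "homog N b d" g "homog N b' d'"]) (auto simp: homog_def has_chi_def)

lemma homog_carrier: "f \<in> wspan (homog N b d) \<Longrightarrow> f \<in> carrier (free_algebra (coords N))"
  unfolding free_algebra_carrier by (rule wspan_mono[of "homog N b d"]) (auto simp: homog_def)

lemma coords_iff [simp]:
  "CT j \<in> coords N \<longleftrightarrow> j \<in> {1..N}" "CTs j \<in> coords N \<longleftrightarrow> j \<in> {1..N}" "Chi k \<in> coords N"
  by (auto simp: coords_def)

lemma homog_star: "homog N b d xs \<Longrightarrow> homog N b (- d) (rev (map coord_star xs))"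
proof -
  have "coord_star x \<in> coords N \<longleftrightarrow> x \<in> coords N" for x by (cases x) simp_all
  moreover have "cdeg (coord_star x) = - cdeg x" for x by (cases x) simp_all
  then have "(\<Sum>x\<leftarrow>map coord_star xs. cdeg x) = - (\<Sum>x\<leftarrow>xs. cdeg x)"
    by (induction xs) simp_all
  moreover have "has_chi xs \<Longrightarrow> has_chi (rev (map coord_star xs))"
    unfolding has_chi_def by (force simp: image_iff)
  ultimately show "homog N b d xs \<Longrightarrow> homog N b (- d) (rev (map coord_star xs))"
    by (auto simp: homog_def rev_map[symmetric])
qed

lemma homog_fstar: "f \<in> wspan (homog N b d) \<Longrightarrow> fstar f \<in> wspan (homog N b (- d))"
  by (rule wspan_fstar[of f "homog N b d"]) (auto intro: homog_star)

lemma homog_fgen: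
  assumes "x \<in> coords N" "b \<longleftrightarrow> (\<exists>k. x = Chi k)"
  shows "fgen x \<in> wspan (homog N b (cdeg x))"
  using assms by (cases x) (auto simp: homog_def has_chi_def)

lemma homog_gt [intro]: "j \<in> {1..N} \<Longrightarrow> gt j \<in> wspan (homog N False 1)"
  and homog_gts [intro]: "j \<in> {1..N} \<Longrightarrow> gts j \<in> wspan (homog N False (-1))"
  using homog_fgen[of "CT j" N False] homog_fgen[of "CTs j" N False] by auto

lemma homog_fun_xi [intro]: "fun_xi q g \<in> wspan (homog N True 0)"
  unfolding fun_xi_def
  using homog_fgen[of "Chi k" N True for k] by (intro wspan_sum wspan_cscale) simp

lemma homog_gt_gts: "j \<in> {1..N} \<Longrightarrow> gt j * gts j \<in> wspan (homog N False 0)"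
  by (rule homog_mult[OF homog_gt homog_gts]) auto

lemma homog_xi [intro]:
  assumes "1 \<le> k" "n \<le> N"
  shows "xi n N k \<in> wspan (homog N False 0)"
  unfolding xi_def using assms by (auto intro!: wspan_add wspan_minus wspan_sum homog_gt_gts)

lemma homog_power: "f \<in> wspan (homog N False d) \<Longrightarrow> f ^ p \<in> wspan (homog N False (int p * d))"
proof (induction p)
  case 0 then show ?case by (simp add: homog_def)
next
  case (Suc p) then show ?case
    by (auto intro!: homog_mult simp: algebra_simps)
qed

lemma homog_prod_list:
  "(\<And>k. k \<in> set ks \<Longrightarrow> f k \<in> wspan (homog N False (d k))) \<Longrightarrow>
    prod_list (map f ks) \<in> wspan (homog N False (\<Sum>k\<leftarrow>ks. d k))"
proof (induction ks)
  case Nil then show ?case by (simp add: homog_def)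
next
  case (Cons k ks) then show ?case by (auto intro!: homog_mult)
qed

lemma homog_E_gen:
  assumes "x \<in> coords N" "1 \<le> j" "j < N" "b \<longleftrightarrow> (\<exists>k. x = Chi k)"
  shows "E_gen q n j x \<in> wspan (homog N b (cdeg x))"
proof (cases x)
  case (Chi k)
  have "gt n * fun_xi q (q_diff q (pt_ind q k)) * gts (Suc n) \<in> wspan (homog N True 0)" if "j = n"
    using that assms
    by (intro homog_mult[OF homog_mult[OF homog_gt homog_fun_xi] homog_gts]) auto
  then show ?thesis using Chi assms by auto
next
  case (CT i)
  then show ?thesis using assms wspan_cscale[OF homog_gt] by simp
next
  case (CTs i)
  then show ?thesis using assms wspan_cscale[OF homog_gts] by simp
qed

lemma homog_E_word:
  assumes "set xs \<subseteq> coords N" "1 \<le> j" "j < N"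
  shows "E_word q n j xs \<in> wspan (homog N (has_chi xs) (\<Sum>x\<leftarrow>xs. cdeg x))"
  using assms(1)
proof (induction xs)
  case (Cons x xs)
  let ?b = "\<exists>k. x = Chi k" and ?d = "\<Sum>x\<leftarrow>xs. cdeg x"
  have b: "has_chi (x # xs) \<longleftrightarrow> ?b \<or> has_chi xs" by (auto simp: has_chi_def)
  have "E_gen q n j x * wsingle xs \<in> wspan (homog N (has_chi (x # xs)) (cdeg x + ?d))"
    using Cons.prems assms(2,3)
    by (intro homog_mult[where b = ?b and b' = "has_chi xs" and d = "cdeg x" and d' = ?d] homog_E_gen) (auto simp: b homog_def)
  moreover have "K_word q j [x] * E_word q n j xs \<in> wspan (homog N (has_chi (x # xs)) (cdeg x + ?d))"
    unfolding K_word_torus using Cons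
    by (intro homog_mult[where b = ?b and b' = "has_chi xs" and d = "cdeg x" and d' = ?d] torus_wspan)
      (auto simp: b, auto simp: homog_def has_chi_def)
  ultimately show ?case by auto
qed simp

lemma homog_act_gen:
  assumes "0 < q" "f \<in> wspan (homog N b d)" "u \<in> ugens N"
  shows "act_gen q n u f \<in> wspan (homog N b d)"
proof -
  have E: "act_gen q n (UE j) f \<in> wspan (homog N b d)"
    if f: "f \<in> wspan (homog N b d)" and j: "1 \<le> j" "j < N" for j f d
    unfolding act_gen.simps
  proof (rule wspan_linext)
    fix u assume "u \<in> Poly_Mapping.keys f"
    then have u: "homog N b d (letters u)" using f by (auto simp: wspan_def)
    show "E_word q n j (letters u) \<in> wspan (homog N b d)"
      by (rule wspan_mono[OF _ homog_E_word]) (use u j in \<open>auto simp: homog_def\<close>)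
  qed
  show ?thesis
  proof (cases u)
    case (UE j) then show ?thesis using E assms by (auto simp: ugens_def)
  next
    case (UF j)
    have "fstar (act_gen q n (UE j) (fstar f)) \<in> wspan (homog N b d)"
      using homog_fstar[OF E[OF homog_fstar[OF assms(2)]]] UF assms(3) by (auto simp: ugens_def)
    then show ?thesis unfolding UF act_gen_UF[OF assms(1)] by auto
  next
    case (UK j) then show ?thesis using assms by (simp add: act_gen_UK torus_wspan del: act_gen.simps)
  next
    case (UKinv j) then show ?thesis using assms by (simp add: act_gen_UKinv torus_wspan del: act_gen.simps)
  qed
qed

lemma carrier_act_gen:
  assumes "0 < q" "f \<in> carrier (free_algebra (coords N))" "u \<in> ugens N"
  shows "act_gen q n u f \<in> carrier (free_algebra (coords N))"
proof -
  have "act_gen q n u f = linext (\<lambda>w. act_gen q n u (Poly_Mapping.single w 1)) f"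
    by (rule clin_eqI) (simp_all del: act_gen.simps)
  also have "\<dots> \<in> wspan (\<lambda>xs. set xs \<subseteq> coords N)"
  proof (rule wspan_linext)
  fix w assume w: "w \<in> Poly_Mapping.keys f"
  \<comment> \<open>The words of f may differ in degree, so \<open>homog_act_gen\<close> is applied
    to each word with its own degree.\<close>
  have "Poly_Mapping.single w 1 \<in> wspan (homog N False (\<Sum>x\<leftarrow>letters w. cdeg x))"
    using assms(2) w by (auto simp: free_algebra_carrier wspan_def homog_def)
  from homog_act_gen[OF assms(1) this assms(3)]
  show "act_gen q n u (Poly_Mapping.single w 1) \<in> wspan (\<lambda>xs. set xs \<subseteq> coords N)"
    unfolding free_algebra_carrier[symmetric] by (rule homog_carrier)
  qed
  finally show ?thesis by (simp add: free_algebra_carrier)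
qed

section \<open>The representation as weighted shifts\<close>

text \<open>As a simp rule, \<open>plus_fun_apply\<close> would unfold eta-expanded sums that occur in
  induction hypotheses.\<close>

declare plus_fun_apply [simp del] zero_fun_apply [simp del]

locale quantum_cone =
  fixes q c :: real and n m N :: nat
  assumes q0: "0 < q" and q1: "q < 1" and n1: "1 \<le> n" and m2: "2 \<le> m"
    and N_eq: "N = n + m" and c0: "0 < c"
begin

lemma q_nz [simp]: "q \<noteq> 0" using q0 by simp

lemma nN: "n < N" "Suc n < N" "1 < N" using n1 m2 N_eq by auto

lemma qpow_pos [simp]: "0 < q powi a" using q0 by simp

lemma qpow_nonneg [simp]: "0 \<le> q powi a" using q0 by simp

lemma qpow_nz [simp]: "q powi a \<noteq> 0" by simp

lemma qpow_add: "q powi (a + b) = q powi a * q powi b"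
  by (simp add: power_int_add)

lemma qpow_diff: "q powi (a - b) = q powi a / q powi b"
  by (simp add: power_int_diff)

lemma qpow_double: "q powi (2 * a) = q powi a * q powi a"
  using qpow_add[of a a] by simp

lemma qpow_antimono: "a \<le> b \<Longrightarrow> q powi b \<le> q powi a"
  using q0 q1 by (intro power_int_decreasing) auto

lemma qpow_eq_iff: "q powi a = q powi b \<longleftrightarrow> a = b"
proof
  show "a = b" if "q powi a = q powi b"
    using that power_int_strict_decreasing[of a b q] power_int_strict_decreasing[of b a q] q0 q1
    by (cases a b rule: linorder_cases) auto
qed simp

lemma qpow_ge_1: "a \<le> 0 \<Longrightarrow> 1 \<le> q powi a"
  using qpow_antimono[of a 0] by simp

lemma qpow_le_1: "0 \<le> a \<Longrightarrow> q powi a \<le> 1"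
  using qpow_antimono[of 0 a] by simp

abbreviation B :: "(nat \<Rightarrow> int) set" where "B \<equiv> basis_idx n N"

abbreviation T :: "coord falg \<Rightarrow> hvec \<Rightarrow> hvec" where "T \<equiv> T0_free q n N"

text \<open>There is no coordinate \<open>i\<^sub>N\<close>: \<open>t\<^sub>N\<close> acts diagonally, which the convention \<open>dl N = 0\<close> expresses.\<close>

definition dl :: "nat \<Rightarrow> nat \<Rightarrow> int" where
  "dl j = (\<lambda>k. if k = j \<and> j < N then 1 else 0)"

lemma Spre_add [simp]: "Spre j (i + s) = Spre j i + Spre j s"
  by (simp add: Spre_def sum.distrib plus_fun_apply)

lemma Spre_diff [simp]: "Spre j (i - s) = Spre j i - Spre j s"
  by (simp add: Spre_def sum_subtractf)

lemma Spre_uminus [simp]: "Spre j (- s) = - Spre j s"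
  by (simp add: Spre_def sum_negf)

lemma Spre_zero [simp]: "Spre j 0 = 0"
  by (simp add: Spre_def zero_fun_apply)

lemma Spre_dl [simp]: "1 \<le> k \<Longrightarrow> Spre j (dl k) = (if k < j \<and> k < N then 1 else 0)"
  by (auto simp: Spre_def dl_def sum.delta)

lemma Spre_Suc: "1 \<le> j \<Longrightarrow> Spre (Suc j) i = Spre j i + i j"
  by (simp add: Spre_def atLeastLessThanSuc)

lemma Spre_1 [simp]: "Spre (Suc 0) i = 0"
  by (simp add: Spre_def)

lemma dl_apply: "dl j k = (if k = j \<and> j < N then 1 else 0)"
  by (simp add: dl_def)

definition rho :: "nat \<Rightarrow> int \<Rightarrow> real" where
  "rho j a = (if j = 1 then q powi a else if j \<le> n then sqrt (q powi (2 * a) - 1)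
     else if j < N then sqrt (1 - q powi (2 * a)) else 1)"

definition rr :: "nat \<Rightarrow> int \<Rightarrow> real" where
  "rr j a = (if j = 1 then q powi (2 * a) else if j \<le> n then q powi (2 * a) - 1
     else if j < N then 1 - q powi (2 * a) else 1)"

text \<open>The real square root is extended to negative arguments as an odd function, where the
  product would come out with the wrong sign. On B the hypothesis is supplied by
  \<open>rr_nonneg\<close>.\<close>

lemma rho_sq: "0 \<le> rr j a \<Longrightarrow> rho j a * rho j a = rr j a"
  by (auto simp: rho_def rr_def qpow_double split: if_splits)

lemma rho_N [simp]: "rho N a = 1" "rr N a = 1"
  using nN by (simp_all add: rho_def rr_def)

fun coef :: "coord \<Rightarrow> (nat \<Rightarrow> int) \<Rightarrow> real" where
  "coef (CT j) i = q powi Spre j i * rho j (i j - 1)"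
| "coef (CTs j) i = q powi Spre j i * rho j (i j)"
| "coef (Chi k) i = (if Spre (Suc n) i = k then 1 else 0)"

fun shf :: "coord \<Rightarrow> nat \<Rightarrow> int" where
  "shf (CT j) = - dl j"
| "shf (CTs j) = dl j"
| "shf (Chi k) = 0"

lemma T0_gen_coef:
  assumes "x \<in> coords N"
  shows "T0_gen q n N x i = cscale (coef x i) (bvec (i + shf x))"
proof -
  have u: "i(j := i j - 1) = i - dl j" "i(j := i j + 1) = i + dl j" if "j < N" for j
    using that by (auto simp: dl_def plus_fun_apply)
  have d: "dl N = 0" by (auto simp: dl_def zero_fun_def)
  show ?thesis
  proof (cases x)
    case (CT j)
    then have "1 \<le> j" "j \<le> N" using assms by auto
    then consider "j = 1" | "1 < j" "j \<le> n" | "n < j" "j < N" | "j = N" by linarith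
    then show ?thesis
      using CT nN n1 by cases (simp_all add: rho_def u d)
  next
    case (CTs j)
    then have "1 \<le> j" "j \<le> N" using assms by auto
    then consider "j = 1" | "1 < j" "j \<le> n" | "n < j" "j < N" | "j = N" by linarith
    then show ?thesis
      using CTs nN n1 by cases (simp_all add: rho_def u d)
  next
    case (Chi k)
    have "(\<Sum>l=1..n. i l) = Spre (Suc n) i"
      by (simp add: Spre_def atLeastLessThanSuc_atLeastAtMost)
    then show ?thesis using Chi by (simp add: pt_ind_def qpow_eq_iff)
  qed
qed

lemma T_frep: "T = frep (\<lambda>x. linext (T0_gen q n N x))"
  by (simp add: fun_eq_iff T0_free_def frep_def)

lemma clin_T_left [simp, intro]: "clin (\<lambda>f. T f v)"
  by (simp add: T_frep)

lemma clin_T [simp, intro]: "clin (T f)"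
  unfolding T_frep by (rule clin_frep_right) simp

lemma T_mult: "T (f * g) v = T f (T g v)"
  unfolding T_frep by (rule frep_mult) simp

lemma T_one [simp]: "T 1 v = v"
  unfolding T_frep by (rule frep_one)

lemma T_fgen: "x \<in> coords N \<Longrightarrow> T (fgen x) (bvec i) = cscale (coef x i) (bvec (i + shf x))"
  by (simp add: T_frep frep_fgen bvec_def[of i] T0_gen_coef)

lemmas T_add = clin_add[OF clin_T_left]
lemmas T_diff = clin_diff[OF clin_T_left]
lemmas T_cscale = clin_scale[OF clin_T_left]
lemmas T_sum = clin_sum[OF clin_T_left]
lemmas T_0 [simp] = clin_zero[OF clin_T_left]
lemmas T_addv = clin_add[OF clin_T]
lemmas T_diffv = clin_diff[OF clin_T]
lemmas T_cscalev = clin_scale[OF clin_T]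
lemmas T_0v [simp] = clin_zero[OF clin_T]

section \<open>The invariant subspace spanned by the admissible indices\<close>

definition H :: "hvec set" where "H = {v. Poly_Mapping.keys v \<subseteq> B}"

lemma H_bvec: "bvec i \<in> H \<longleftrightarrow> i \<in> B"
  by (simp add: H_def bvec_def)

lemma H_cscale: "v \<in> H \<Longrightarrow> cscale a v \<in> H"
  by (auto simp: H_def in_keys_iff)

lemma H_0 [simp]: "0 \<in> H"
  by (simp add: H_def)

lemma H_add: "v \<in> H \<Longrightarrow> w \<in> H \<Longrightarrow> v + w \<in> H"
  using keys_add[of v w] by (auto simp: H_def)

lemma H_sum: "(\<And>x. x \<in> A \<Longrightarrow> f x \<in> H) \<Longrightarrow> sum f A \<in> H"
  by (induction A rule: infinite_finite_induct) (auto intro: H_add)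

lemma H_linext: "v \<in> H \<Longrightarrow> (\<And>i. i \<in> B \<Longrightarrow> \<phi> i \<in> H) \<Longrightarrow> linext \<phi> v \<in> H"
  unfolding linext_def by (intro H_sum H_cscale) (auto simp: H_def)

lemma eq_on_H:
  assumes "clin F" "clin G" "v \<in> H" "\<And>i. i \<in> B \<Longrightarrow> F (bvec i) = G (bvec i)"
  shows "F v = G v"
  by (rule clin_eqI[OF assms(1,2)]) (use assms(3,4) in \<open>auto simp: H_def bvec_def\<close>)

lemma clin_zero_fun: "clin (\<lambda>_. 0)"
  by (rule clinI) simp_all

lemma basis_iff:
  "i \<in> B \<longleftrightarrow> (\<forall>j\<in>{2..n}. i j \<le> 0) \<and> (\<forall>j\<in>{Suc n..<N}. 1 \<le> i j) \<and> (\<forall>j. j \<notin> {1..<N} \<longrightarrow> i j = 0)"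
  by (simp add: basis_idx_def)

lemma basisD:
  assumes "i \<in> B"
  shows "2 \<le> k \<Longrightarrow> k \<le> n \<Longrightarrow> i k \<le> 0" "n < k \<Longrightarrow> k < N \<Longrightarrow> 1 \<le> i k" "k = 0 \<or> N \<le> k \<Longrightarrow> i k = 0"
  using assms by (auto simp: basis_iff)

lemma basisI:
  assumes "\<And>k. 2 \<le> k \<Longrightarrow> k \<le> n \<Longrightarrow> i k \<le> 0" "\<And>k. n < k \<Longrightarrow> k < N \<Longrightarrow> 1 \<le> i k"
    "\<And>k. k = 0 \<or> N \<le> k \<Longrightarrow> i k = 0"
  shows "i \<in> B"
  unfolding basis_iff using assms by (meson atLeastAtMost_iff atLeastLessThan_iff not_less Suc_le_eq less_one)

text \<open>Each wall of B lies exactly where the coefficient of the step across it vanishes: i_j =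
  1 for t_j with n < j < N, and i_j = 0 for the adjoint of t_j with 2 \<le> j \<le> n.\<close>

lemma basis_shift:
  assumes i: "i \<in> B" and x: "x \<in> coords N"
  shows "coef x i = 0 \<or> i + shf x \<in> B"
proof (cases x)
  case (CT j)
  then have j: "1 \<le> j" "j \<le> N" using x by auto
  have s: "(i + shf x) k = (if k = j \<and> j < N then i k - 1 else i k)" for k
    by (simp add: CT plus_fun_apply dl_def)
  show ?thesis
  proof (cases "n < j \<and> j < N \<and> i j = 1")
    case True
    then show ?thesis using n1 CT by (auto simp: rho_def)
  next
    case False
    have "i + shf x \<in> B"
    proof (rule basisI)
      show "(i + shf x) k \<le> 0" if "2 \<le> k" "k \<le> n" for k
        using basisD(1)[OF i that] by (auto simp: s)
      show "1 \<le> (i + shf x) k" if "n < k" "k < N" for k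
        using basisD(2)[OF i that] False that by (auto simp: s)
      show "(i + shf x) k = 0" if "k = 0 \<or> N \<le> k" for k
        using basisD(3)[OF i that] that j by (auto simp: s)
    qed
    then show ?thesis ..
  qed
next
  case (CTs j)
  then have j: "1 \<le> j" "j \<le> N" using x by auto
  have s: "(i + shf x) k = (if k = j \<and> j < N then i k + 1 else i k)" for k
    by (simp add: CTs plus_fun_apply dl_def)
  show ?thesis
  proof (cases "2 \<le> j \<and> j \<le> n \<and> i j = 0")
    case True
    then show ?thesis using n1 CTs by (auto simp: rho_def)
  next
    case False
    have "i + shf x \<in> B"
    proof (rule basisI)
      show "(i + shf x) k \<le> 0" if "2 \<le> k" "k \<le> n" for k
        using basisD(1)[OF i that] False that by (auto simp: s)
      show "1 \<le> (i + shf x) k" if "n < k" "k < N" for k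
        using basisD(2)[OF i that] by (auto simp: s)
      show "(i + shf x) k = 0" if "k = 0 \<or> N \<le> k" for k
        using basisD(3)[OF i that] that j by (auto simp: s)
    qed
    then show ?thesis ..
  qed
qed (use assms in auto)

lemma rr_nonneg:
  assumes "i \<in> B" "1 \<le> j" "j \<le> N"
  shows "0 \<le> rr j (i j)" "0 \<le> rr j (i j - 1)"
proof -
  consider "j = 1" | "1 < j" "j \<le> n" "i j \<le> 0" | "n < j" "j < N" "1 \<le> i j" | "j = N"
    using assms by (force simp: basis_iff)
  then have "0 \<le> rr j (i j) \<and> 0 \<le> rr j (i j - 1)"
    using nN n1 by cases (auto simp: rr_def intro!: qpow_ge_1 qpow_le_1)
  then show "0 \<le> rr j (i j)" "0 \<le> rr j (i j - 1)" by auto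
qed

section \<open>Words as weighted shifts, and adjoints\<close>

fun wshf :: "coord list \<Rightarrow> nat \<Rightarrow> int" where
  "wshf [] = 0"
| "wshf (x # xs) = wshf xs + shf x"

fun wcoef :: "coord list \<Rightarrow> (nat \<Rightarrow> int) \<Rightarrow> real" where
  "wcoef [] i = 1"
| "wcoef (x # xs) i = coef x (i + wshf xs) * wcoef xs i"

lemma T_word:
  "set xs \<subseteq> coords N \<Longrightarrow> T (wsingle xs) (bvec i) = cscale (wcoef xs i) (bvec (i + wshf xs))"
proof (induction xs)
  case Nil then show ?case by (simp add: wsingle_Nil)
next
  case (Cons x xs)
  then show ?case
    by (simp add: fgen_mult_wsingle[symmetric] T_mult T_fgen T_cscalev add.assoc[symmetric] mult.commute)
qed

lemma wcoef_basis:
  "i \<in> B \<Longrightarrow> set xs \<subseteq> coords N \<Longrightarrow> wcoef xs i = 0 \<or> i + wshf xs \<in> B"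
proof (induction xs)
  case (Cons x xs)
  then show ?case
    using basis_shift[of "i + wshf xs" x] by (auto simp: add.assoc[symmetric])
qed simp

lemma T_H:
  assumes "f \<in> carrier (free_algebra (coords N))" "v \<in> H"
  shows "T f v \<in> H"
proof -
  have word: "T (wsingle xs) w \<in> H" if "set xs \<subseteq> coords N" "w \<in> H" for xs w
  proof -
    have "T (wsingle xs) w = linext (\<lambda>i. T (wsingle xs) (bvec i)) w"
      by (rule clin_eqI) (simp_all add: bvec_def)
    also have "\<dots> \<in> H"
    proof (rule H_linext[OF that(2)])
      fix i assume "i \<in> B"
      then show "T (wsingle xs) (bvec i) \<in> H"
        using wcoef_basis[OF _ that(1)] that(1) by (force simp: T_word H_bvec intro: H_cscale)
    qed
    finally show ?thesis .
  qed
  have "T f v = linext (\<lambda>u. T (Poly_Mapping.single u 1) v) f"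
    by (rule clin_eqI[where F = "\<lambda>f. T f v"]) simp_all
  also have "\<dots> \<in> H"
    unfolding linext_def
  proof (intro H_sum H_cscale)
    fix u assume "u \<in> Poly_Mapping.keys f"
    then show "T (Poly_Mapping.single u 1) v \<in> H"
      using assms word[of "letters u" v] by (auto simp: free_algebra_carrier wspan_def)
  qed
  finally show ?thesis .
qed

lemma wshf_append: "wshf (xs @ ys) = wshf ys + wshf xs"
  by (induction xs) (simp_all add: add.assoc)

lemma wcoef_append: "wcoef (xs @ ys) i = wcoef xs (i + wshf ys) * wcoef ys i"
  by (induction xs) (simp_all add: wshf_append add.assoc)

lemma shf_star: "shf (coord_star x) = - shf x"
  by (cases x) simp_all

lemma wshf_star: "wshf (rev (map coord_star xs)) = - wshf xs"
  by (induction xs) (simp_all add: wshf_append shf_star)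

text \<open>The step back along the adjoint letter has the same real weight, and the * property of
  the representation reduces to this.\<close>

lemma coef_star:
  assumes "x \<in> coords N"
  shows "coef (coord_star x) (i + shf x) = coef x i"
proof -
  have "rho j (i j + dl j j - 1) = rho j (i j)" "rho j (i j - dl j j) = rho j (i j - 1)" if "j \<le> N" for j
    using that by (cases "j = N"; simp add: dl_def)+
  then show ?thesis using assms by (cases x) (auto simp: plus_fun_apply zero_fun_apply)
qed

lemma wcoef_star:
  "set xs \<subseteq> coords N \<Longrightarrow> wcoef (rev (map coord_star xs)) (i + wshf xs) = wcoef xs i"
proof (induction xs)
  case (Cons x xs)
  have e: "i + (wshf xs + shf x) = i + wshf xs + shf x" "i + wshf xs + shf x + shf (coord_star x) = i + wshf xs"
    by (simp_all add: shf_star add.assoc)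
  have "wcoef (rev (map coord_star (x # xs))) (i + wshf (x # xs)) =
      wcoef (rev (map coord_star xs)) (i + wshf xs) * coef (coord_star x) (i + wshf xs + shf x)"
    by (simp only: list.map rev.simps wcoef_append wshf.simps wcoef.simps e add_0_left add_0_right mult_1_right)
  also have "\<dots> = wcoef (x # xs) i"
    using Cons coef_star[of x "i + wshf xs"] by (simp add: mult.commute)
  finally show ?case .
qed simp

lemma T_adjoint:
  assumes "f \<in> carrier (free_algebra (coords N))"
  shows "Poly_Mapping.lookup (T (fstar f) (bvec i)) k = cnj (Poly_Mapping.lookup (T f (bvec k)) i)"
proof (rule additive_eqI[where F = "\<lambda>f. Poly_Mapping.lookup (T (fstar f) (bvec i)) k"])
  fix u a assume "u \<in> Poly_Mapping.keys f"
  then have u: "set (letters u) \<subseteq> coords N" using assms by (auto simp: free_algebra_carrier wspan_def)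
  obtain xs where xs: "u = Word xs" by (cases u)
  let ?ys = "rev (map coord_star xs)"
  have "coord_star x \<in> coords N \<longleftrightarrow> x \<in> coords N" for x by (cases x) simp_all
  then have ys: "set ?ys \<subseteq> coords N" using u xs by auto
  have s: "Poly_Mapping.single v b = cscale b (Poly_Mapping.single v 1)" for v :: "coord word" and b by simp
  have e: "i + wshf ?ys = k \<longleftrightarrow> k + wshf xs = i" by (auto simp: wshf_star)
  show "Poly_Mapping.lookup (T (fstar (Poly_Mapping.single u a)) (bvec i)) k =
    cnj (Poly_Mapping.lookup (T (Poly_Mapping.single u a) (bvec k)) i)"
    unfolding xs fstar_single
    apply (subst (1 2) s)
    unfolding T_cscale T_word[OF ys] T_word[OF u[unfolded xs word.sel]]
    using wcoef_star[of xs k] u xs by (auto simp: bvec_def lookup_single when_def e)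
qed (simp_all add: fstar_add T_add lookup_add)

section \<open>The defining relations in the representation\<close>

definition eps :: "nat \<Rightarrow> real" where "eps j = (if j \<le> n then -1 else 1)"

text \<open>The eigenvalue of \<xi>_j on the basis vector with index i. The value 0 at j = 1 is the
  relation \<xi>_1 = 0, and at j = N + 1 it is the empty sum; with these boundary values t_j t_j^*
  acts as \<open>eps j\<close> times \<xi>_j - \<xi>_{j+1} for every j, including 1 and N.\<close>

definition xiv :: "nat \<Rightarrow> (nat \<Rightarrow> int) \<Rightarrow> real" where
  "xiv j i = (if 2 \<le> j \<and> j \<le> N then q powi (2 * Spre j i) else 0)"

lemma rr_xiv:
  assumes "1 \<le> j" "j \<le> N"
  shows "q powi (2 * Spre j i) * rr j (i j) = eps j * (xiv j i - xiv (Suc j) i)"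
    "q powi (2 * Spre j i) * rr j (i j - 1) = eps j * (xiv j i - q powi (-2) * xiv (Suc j) i)"
proof -
  have s: "Spre (Suc j) i = Spre j i + i j" using assms by (simp add: Spre_Suc)
  consider "j = 1" | "1 < j" "j \<le> n" | "n < j" "1 < j" "j < N" | "j = N" using assms n1 by linarith
  then have "q powi (2 * Spre j i) * rr j (i j) = eps j * (xiv j i - xiv (Suc j) i) \<and>
    q powi (2 * Spre j i) * rr j (i j - 1) = eps j * (xiv j i - q powi (-2) * xiv (Suc j) i)"
    using nN n1 by cases (simp_all add: rr_def eps_def xiv_def s Spre_Suc algebra_simps qpow_add qpow_diff power_int_minus divide_inverse)
  then show "q powi (2 * Spre j i) * rr j (i j) = eps j * (xiv j i - xiv (Suc j) i)"
    "q powi (2 * Spre j i) * rr j (i j - 1) = eps j * (xiv j i - q powi (-2) * xiv (Suc j) i)"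
    by auto
qed

lemma T_gt_gts:
  assumes "i \<in> B" "1 \<le> j" "j \<le> N"
  shows "T (gt j * gts j) (bvec i) = cscale (eps j * (xiv j i - xiv (Suc j) i)) (bvec i)"
proof -
  have "coef (CT j) (i + dl j) = coef (CTs j) i"
    using coef_star[of "CTs j" i] assms by simp
  then have "T (gt j * gts j) (bvec i) = cscale (of_real (coef (CTs j) i * coef (CTs j) i)) (bvec i)"
    using assms by (simp add: T_mult T_fgen T_cscalev del: coef.simps)
  also have "coef (CTs j) i * coef (CTs j) i = q powi (2 * Spre j i) * rr j (i j)"
    using rho_sq[OF rr_nonneg(1)[OF assms]] by (simp add: qpow_double)
  finally show ?thesis using assms by (simp add: rr_xiv(1))
qed

lemma T_gts_gt:
  assumes "i \<in> B" "1 \<le> j" "j \<le> N"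
  shows "T (gts j * gt j) (bvec i) = cscale (eps j * (xiv j i - q powi (-2) * xiv (Suc j) i)) (bvec i)"
proof -
  have "coef (CTs j) (i - dl j) = coef (CT j) i"
    using coef_star[of "CT j" i] assms by simp
  then have "T (gts j * gt j) (bvec i) = cscale (of_real (coef (CT j) i * coef (CT j) i)) (bvec i)"
    using assms by (simp add: T_mult T_fgen T_cscalev del: coef.simps)
  also have "coef (CT j) i * coef (CT j) i = q powi (2 * Spre j i) * rr j (i j - 1)"
    using rho_sq[OF rr_nonneg(2)[OF assms]] by (simp add: qpow_double)
  finally show ?thesis using assms by (simp add: rr_xiv(2))
qed

text \<open>The differences \<xi>_k - \<xi>_{k+1} telescope over a range on which the sign
  \<open>eps\<close> is constant.\<close>

lemma T_sum_gt_gts: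
  assumes "i \<in> B" "1 \<le> a" "a \<le> Suc b" "b \<le> N" "\<And>k. a \<le> k \<Longrightarrow> k \<le> b \<Longrightarrow> eps k = e"
  shows "T (\<Sum>k=a..b. gt k * gts k) (bvec i) = cscale (e * (xiv a i - xiv (Suc b) i)) (bvec i)"
proof -
  have "T (\<Sum>k=a..b. gt k * gts k) (bvec i) = (\<Sum>k=a..b. cscale (of_real (e * (xiv k i - xiv (Suc k) i))) (bvec i))"
    unfolding T_sum using assms by (intro sum.cong) (auto simp: T_gt_gts)
  also have "\<dots> = cscale (\<Sum>k=a..b. of_real (e * (xiv k i - xiv (Suc k) i))) (bvec i)"
    by (simp add: pm.scale_sum_left)
  also have "(\<Sum>k=a..b. complex_of_real (e * (xiv k i - xiv (Suc k) i))) = of_real (e * (\<Sum>k=a..b. xiv k i - xiv (Suc k) i))"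
    by (simp add: sum_distrib_left)
  also have "(\<Sum>k=a..b. xiv k i - xiv (Suc k) i) = xiv a i - xiv (Suc b) i"
    using sum_Suc_diff[of a b "\<lambda>k. - xiv k i"] assms(3) by simp
  finally show ?thesis .
qed

lemma xiv_simps [simp]: "xiv (Suc N) i = 0" "xiv (Suc 0) i = 0"
  by (simp_all add: xiv_def)

lemma T_xi:
  assumes "i \<in> B" "1 \<le> k" "k \<le> N"
  shows "T (xi n N k) (bvec i) = cscale (xiv k i) (bvec i)"
proof (cases "n < k")
  case True
  then show ?thesis
    using T_sum_gt_gts[OF assms(1,2), of N 1] assms by (simp add: xi_def eps_def)
next
  case False
  then show ?thesis
    using T_sum_gt_gts[OF assms(1,2), of n "-1"] T_sum_gt_gts[OF assms(1), of "Suc n" N 1] assms nN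
    by (simp add: xi_def eps_def T_diff pm.scale_left_diff_distrib)
qed

lemma T_fun_xi:
  assumes "lattice_finite q g"
  shows "T (fun_xi q g) (bvec i) = cscale (g (q powi (2 * Spre (Suc n) i))) (bvec i)"
proof -
  let ?A = "{k. g (q powi (2 * k)) \<noteq> 0}"
  have fin: "finite ?A" using assms by (simp add: lattice_finite_def)
  have "T (fun_xi q g) (bvec i) =
    (\<Sum>k\<in>?A. cscale (if k = Spre (Suc n) i then g (q powi (2 * k)) else 0) (bvec i))"
    unfolding fun_xi_def T_sum by (intro sum.cong) (auto simp: T_cscale T_fgen)
  also have "\<dots> = cscale (\<Sum>k\<in>?A. if k = Spre (Suc n) i then g (q powi (2 * k)) else 0) (bvec i)"
    by (simp add: pm.scale_sum_left)
  finally show ?thesis by (auto simp: sum.delta[OF fin])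
qed

section \<open>The ideal of elements killed under every torus twist\<close>

abbreviation C :: "coord falg set" where "C \<equiv> carrier (free_algebra (coords N))"

lemma C_closed [simp]:
  "0 \<in> C" "1 \<in> C"
  "f \<in> C \<Longrightarrow> g \<in> C \<Longrightarrow> f + g \<in> C"
  "f \<in> C \<Longrightarrow> g \<in> C \<Longrightarrow> f - g \<in> C"
  "f \<in> C \<Longrightarrow> - f \<in> C"
  "f \<in> C \<Longrightarrow> cscale a f \<in> C"
  "x \<in> coords N \<Longrightarrow> fgen x \<in> C"
  "f \<in> C \<Longrightarrow> torus w f \<in> C"
  by (auto simp: free_algebra_carrier intro: torus_wspan)

lemma C_mult [simp]: "f \<in> C \<Longrightarrow> g \<in> C \<Longrightarrow> f * g \<in> C"
  using ring.ring_simprules(5)[OF ring_free_algebra] by fastforce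

lemma C_sum: "(\<And>x. x \<in> A \<Longrightarrow> f x \<in> C) \<Longrightarrow> sum f A \<in> C"
  by (induction A rule: infinite_finite_induct) auto

lemma C_fstar [simp]:
  assumes "f \<in> C" shows "fstar f \<in> C"
proof -
  have "coord_star x \<in> coords N \<longleftrightarrow> x \<in> coords N" for x by (cases x) simp_all
  then show ?thesis
    using assms unfolding free_algebra_carrier
    by (intro wspan_fstar[of f "\<lambda>xs. set xs \<subseteq> coords N"]) auto
qed

lemma C_fun_xi [simp]: "fun_xi q g \<in> C"
  unfolding fun_xi_def by (intro C_sum) auto

lemma C_xi [simp]: "1 \<le> k \<Longrightarrow> xi n N k \<in> C"
  by (rule homog_carrier[OF homog_xi]) (use nN in auto)

lemma C_sum_gt_gts: "1 \<le> a \<Longrightarrow> b \<le> N \<Longrightarrow> (\<Sum>k=a..b. gt k * gts k) \<in> C"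
  by (intro C_sum C_mult) auto

text \<open>Conjugation by a diagonal operator can rescale T(t_k) for k < N but leaves the diagonal
  operator T(t_N) unchanged. Quantifying over all twists makes the set visibly stable under every
  \<open>K_j\<close> and its inverse.\<close>

definition kern :: "coord falg set" where
  "kern = {f \<in> C. \<forall>w. (\<forall>j. w j \<noteq> 0) \<longrightarrow> (\<forall>i\<in>B. T (torus w f) (bvec i) = 0)}"

lemma kern_torus_H:
  assumes "f \<in> kern" "\<And>j. w j \<noteq> 0" "v \<in> H"
  shows "T (torus w f) v = 0"
  by (rule eq_on_H[OF clin_T clin_zero_fun assms(3)]) (use assms in \<open>auto simp: kern_def\<close>)

lemma kern_H: "f \<in> kern \<Longrightarrow> v \<in> H \<Longrightarrow> T f v = 0"
  using kern_torus_H[of f "\<lambda>_. 1" v] by (simp add: torus_id)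

lemma kern_C: "f \<in> kern \<Longrightarrow> f \<in> C"
  by (simp add: kern_def)

lemmas torus_add = clin_add[OF clin_torus]
lemmas torus_diff = clin_diff[OF clin_torus]
lemmas torus_cscale = clin_scale[OF clin_torus]
lemmas torus_sum = clin_sum[OF clin_torus]

lemma kern_add: "f \<in> kern \<Longrightarrow> g \<in> kern \<Longrightarrow> f + g \<in> kern"
  by (auto simp: kern_def torus_add T_add)

lemma kern_cscale: "f \<in> kern \<Longrightarrow> cscale a f \<in> kern"
  by (auto simp: kern_def torus_cscale T_cscale)

lemma kern_diff: "f \<in> kern \<Longrightarrow> g \<in> kern \<Longrightarrow> f - g \<in> kern"
  by (auto simp: kern_def torus_diff T_diff)

lemma kern_0: "0 \<in> kern"
  by (auto simp: kern_def clin_zero[OF clin_torus])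

lemma kern_uminus: "f \<in> kern \<Longrightarrow> - f \<in> kern"
  using kern_diff[OF kern_0] by simp

lemma kern_mult_left: "f \<in> kern \<Longrightarrow> g \<in> C \<Longrightarrow> g * f \<in> kern"
  by (auto simp: kern_def torus_mult T_mult)

lemma kern_mult_right:
  assumes "f \<in> kern" "g \<in> C" shows "f * g \<in> kern"
proof -
  have "T (torus w f) (T (torus w g) (bvec i)) = 0" if "\<And>j. w j \<noteq> 0" "i \<in> B" for w i
    using assms that by (intro kern_torus_H T_H) (auto simp: H_bvec)
  then show ?thesis using assms by (auto simp: kern_def torus_mult T_mult)
qed

lemma ideal_kern: "ideal kern (free_algebra (coords N))"
proof (rule idealI[OF ring_free_algebra])
  interpret R: ring "free_algebra (coords N)" by (rule ring_free_algebra)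
  show "subgroup kern (add_monoid (free_algebra (coords N)))"
  proof (rule R.add.subgroupI)
    show "kern \<subseteq> C" by (auto simp: kern_C)
    show "kern \<noteq> {}" using kern_0 by auto
    fix f assume f: "f \<in> kern"
    have "\<ominus>\<^bsub>free_algebra (coords N)\<^esub> f = - f"
      using kern_C[OF f] by (intro R.minus_equality) simp_all
    then show "\<ominus>\<^bsub>free_algebra (coords N)\<^esub> f \<in> kern"
      using kern_uminus[OF f] by simp
  qed (auto intro: kern_add)
qed (auto intro: kern_mult_left kern_mult_right)

text \<open>Matrix entries of the adjoint are conjugates of transposed entries of f, twisted by the
  inverse conjugate of w. They vanish for k in B because f lies in \<open>kern\<close>, and for k
  outside B because T preserves H.\<close>

lemma kern_fstar:
  assumes f: "f \<in> kern" shows "fstar f \<in> kern"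
proof -
  have "T (torus w (fstar f)) (bvec i) = 0" if w: "\<And>j. w j \<noteq> 0" and i: "i \<in> B" for w i
  proof (rule poly_mapping_eqI)
    fix k
    let ?g = "torus (\<lambda>j. inverse (cnj (w j))) f"
    have g: "?g \<in> C" using kern_C[OF f] by simp
    show "Poly_Mapping.lookup (T (torus w (fstar f)) (bvec i)) k = Poly_Mapping.lookup 0 k"
    proof (cases "k \<in> B")
      case True
      then have "T ?g (bvec k) = 0" using w by (intro kern_torus_H f) (auto simp: H_bvec)
      then show ?thesis by (simp add: torus_fstar T_adjoint[OF g])
    next
      case False
      have "T (torus w (fstar f)) (bvec i) \<in> H"
        using kern_C[OF f] i by (intro T_H) (auto simp: H_bvec)
      then show ?thesis using False by (auto simp: H_def in_keys_iff)
    qed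
  qed
  then show ?thesis using kern_C[OF f] by (auto simp: kern_def)
qed

text \<open>Both sides of every listed relation have a common torus weight, so a twist only
  multiplies the relation by a scalar and the untwisted identity is what remains to be
  checked.\<close>

lemma rel_kernI:
  assumes "l \<in> C" "r \<in> C"
    and "\<And>w. (\<And>j. w j \<noteq> 0) \<Longrightarrow> \<exists>s. torus w l = cscale s l \<and> torus w r = cscale s r"
    and "\<And>i. i \<in> B \<Longrightarrow> T l (bvec i) = T r (bvec i)"
  shows "l - r \<in> kern"
proof -
  have "T (torus w (l - r)) (bvec i) = 0" if w: "\<And>j. w j \<noteq> 0" and "i \<in> B" for w i
  proof -
    obtain s where "torus w l = cscale s l" "torus w r = cscale s r" using assms(3)[of w] w by blast
    then show ?thesis using assms(4)[OF that(2)] by (simp add: torus_diff T_diff T_cscale)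
  qed
  then show ?thesis using assms(1,2) by (auto simp: kern_def)
qed

lemma rel_kernI_invariant:
  assumes "l \<in> C" "r \<in> C"
    and "\<And>w. (\<And>j. w j \<noteq> 0) \<Longrightarrow> torus w l = l \<and> torus w r = r"
    and "\<And>i. i \<in> B \<Longrightarrow> T l (bvec i) = T r (bvec i)"
  shows "l - r \<in> kern"
  using assms(3) by (intro rel_kernI[OF assms(1,2) _ assms(4)] exI[of _ 1]) auto

lemma T_gen2:
  assumes "x \<in> coords N" "y \<in> coords N"
  shows "T (fgen x * fgen y) (bvec i) = cscale (coef y i * coef x (i + shf y)) (bvec (i + shf y + shf x))"
  using assms by (simp add: T_mult T_fgen T_cscalev)

lemma gen2_rel_kern:
  assumes "x \<in> coords N" "y \<in> coords N"
    and "\<And>i. i \<in> B \<Longrightarrow> coef y i * coef x (i + shf y) = s * (coef x i * coef y (i + shf x))"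
  shows "fgen x * fgen y - cscale s (fgen y * fgen x) \<in> kern"
proof (rule rel_kernI)
  show "T (fgen x * fgen y) (bvec i) = T (cscale s (fgen y * fgen x)) (bvec i)" if "i \<in> B" for i
  proof -
    have e: "i + shf y + shf x = i + shf x + shf y"
      by (simp add: add.assoc add.commute[of "shf x"])
    show ?thesis using assms(1,2)
      by (simp add: T_gen2 T_cscale e assms(3)[OF that] flip: of_real_mult)
  qed
  show "\<exists>a. torus w (fgen x * fgen y) = cscale a (fgen x * fgen y) \<and>
     torus w (cscale s (fgen y * fgen x)) = cscale a (cscale s (fgen y * fgen x))" for w
    by (intro exI[of _ "wt w x * wt w y"])
      (simp add: torus_mult torus_fgen torus_cscale cscale_mult_left cscale_mult_right mult_ac)
qed (use assms in auto)

text \<open>The weight of t_j depends on S_j and i_j only, and a step in another direction k changes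
  S_j exactly when k < j.\<close>

lemma coef_shift_gen:
  assumes "1 \<le> j" "1 \<le> k" "j \<noteq> k" "k \<le> N" "j \<le> N"
  shows "coef (CT j) (i + shf (CT k)) = (if k < j then inverse q else 1) * coef (CT j) i"
    "coef (CT j) (i + shf (CTs k)) = (if k < j then q else 1) * coef (CT j) i"
    "coef (CTs j) (i + shf (CT k)) = (if k < j then inverse q else 1) * coef (CTs j) i"
    "coef (CTs j) (i + shf (CTs k)) = (if k < j then q else 1) * coef (CTs j) i"
  using assms by (auto simp: plus_fun_apply dl_apply qpow_add qpow_diff divide_inverse)

lemma torus_xi: "(\<And>j. w j \<noteq> 0) \<Longrightarrow> torus w (xi n N k) = xi n N k"
  by (simp add: xi_def torus_add torus_sum torus_gt_gts torus_diff)

lemma T_sum_gt_gts_lo: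
  "i \<in> B \<Longrightarrow> 1 \<le> a \<Longrightarrow> a \<le> Suc n \<Longrightarrow>
    T (\<Sum>k=a..n. gt k * gts k) (bvec i) = cscale (xiv (Suc n) i - xiv a i) (bvec i)"
  using T_sum_gt_gts[of i a n "-1"] nN by (simp add: eps_def)

lemma T_sum_gt_gts_hi:
  "i \<in> B \<Longrightarrow> n < a \<Longrightarrow> a \<le> Suc N \<Longrightarrow>
    T (\<Sum>k=a..N. gt k * gts k) (bvec i) = cscale (xiv a i) (bvec i)"
  using T_sum_gt_gts[of i a N 1] nN n1 by (simp add: eps_def)

lemma pol_rel_kern:
  assumes "pol_rel q n N l r" shows "l \<in> C \<and> r \<in> C \<and> l - r \<in> kern"
  using assms
proof cases
  case (1 i j)
  have "l - r \<in> kern" unfolding 1 using 1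
    by (intro gen2_rel_kern) (auto simp: coef_shift_gen simp del: coef.simps shf.simps)
  then show ?thesis using 1 by simp
next
  case (2 i j)
  have "l - r \<in> kern" unfolding 2 using 2
    by (intro gen2_rel_kern) (auto simp: coef_shift_gen simp del: coef.simps shf.simps)
  then show ?thesis using 2 by simp
next
  case (3 i)
  have i: "1 \<le> i" "i \<le> N" using 3 by auto
  have C: "l \<in> C" "r \<in> C" unfolding 3 using 3(4) i nN n1 by (simp_all add: C_sum_gt_gts)
  moreover have "l - r \<in> kern"
  proof (rule rel_kernI_invariant[OF C])
    fix b assume b: "b \<in> B"
    show "T l (bvec b) = T r (bvec b)"
      unfolding 3(1,2) T_add T_cscale T_gt_gts[OF b i] T_gts_gt[OF b i]
        T_sum_gt_gts_hi[OF b, of "Suc i", OF less_SucI[OF 3(4)] Suc_le_mono[THEN iffD2, OF i(2)]]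
        pm.scale_scale pm.scale_left_distrib[symmetric]
      using 3(4) by (intro arg_cong[where f = "\<lambda>a. cscale a (bvec b)"]) (simp add: eps_def algebra_simps)
  qed (simp add: 3 torus_add torus_gt_gts torus_gts_gt torus_cscale torus_sum)
  ultimately show ?thesis by blast
next
  case (4 i)
  have i: "1 \<le> i" "i \<le> N" using 4 by auto
  have C: "l \<in> C" "r \<in> C" unfolding 4 using 4(4) i nN n1 by (simp_all add: C_sum_gt_gts)
  moreover have "l - r \<in> kern"
  proof (rule rel_kernI_invariant[OF C])
    fix b assume b: "b \<in> B"
    show "T l (bvec b) = T r (bvec b)"
      unfolding 4(1,2) T_diff T_add T_cscale T_gt_gts[OF b i] T_gts_gt[OF b i]
        T_sum_gt_gts_lo[OF b, of "Suc i", OF _ Suc_le_mono[THEN iffD2, OF 4(4)], simplified]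
        T_sum_gt_gts_hi[OF b lessI Suc_le_mono[THEN iffD2, OF less_imp_le[OF nN(1)]]]
        pm.scale_scale pm.scale_left_distrib[symmetric] pm.scale_left_diff_distrib[symmetric]
      using 4(4) by (intro arg_cong[where f = "\<lambda>a. cscale a (bvec b)"]) (simp add: eps_def algebra_simps)
  qed (simp add: 4 torus_add torus_diff torus_gt_gts torus_gts_gt torus_cscale torus_sum)
  ultimately show ?thesis by blast
next
  case 5
  have C: "l \<in> C" "r \<in> C" unfolding 5 using  nN n1 by (simp_all add: C_sum_gt_gts)
  moreover have "l - r \<in> kern"
  proof (rule rel_kernI_invariant[OF C])
    fix b assume b: "b \<in> B"
    show "T l (bvec b) = T r (bvec b)"
      unfolding 5
      using T_sum_gt_gts_lo[OF b, of 1] T_sum_gt_gts_hi[OF b, of "Suc n"] nN n1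
      by (simp add: T_diff)
  qed (simp add: 5 torus_diff torus_gt_gts torus_sum clin_zero[OF clin_torus])
  ultimately show ?thesis by blast
qed

lemma lattice_finite_shift:
  assumes "lattice_finite q g" shows "lattice_finite q (\<lambda>x. g (q powi (2 * a) * x))"
proof -
  have "{k. g (q powi (2 * a) * q powi (2 * k)) \<noteq> 0} = (\<lambda>k. a + k) -` {k. g (q powi (2 * k)) \<noteq> 0}"
    by (auto simp: qpow_add[symmetric] distrib_left)
  moreover have "inj (\<lambda>k::int. a + k)" by (auto intro: injI)
  ultimately show ?thesis
    using assms finite_vimageI[of "{k. g (q powi (2 * k)) \<noteq> 0}" "\<lambda>k. a + k"]
    unfolding lattice_finite_def by simp
qed

lemma lattice_finite_mult:
  "lattice_finite q g \<Longrightarrow> lattice_finite q (\<lambda>x. g x * h x)" "lattice_finite q g \<Longrightarrow> lattice_finite q (\<lambda>x. h x * g x)"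
  unfolding lattice_finite_def by (auto elim!: rev_finite_subset)

lemma fun_rel_kern:
  assumes "fun_rel q n N l r" shows "l \<in> C \<and> r \<in> C \<and> l - r \<in> kern"
  using assms
proof cases
  case (1 g h)
  have C: "l \<in> C" "r \<in> C" unfolding 1 using  nN n1 by simp_all
  moreover have "l - r \<in> kern"
  proof (rule rel_kernI_invariant[OF C])
    show "T l (bvec b) = T r (bvec b)" for b
      unfolding 1 using 1 lattice_finite_mult[of g h] by (simp add: T_mult T_fun_xi T_cscalev mult.commute)
  qed (simp add: 1 torus_mult torus_fun_xi)
  ultimately show ?thesis by blast
next
  case (2 g)
  have C: "l \<in> C" "r \<in> C" unfolding 2 using  nN n1 by simp_all
  moreover have "l - r \<in> kern"
  proof (rule rel_kernI_invariant[OF C])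
    show "T l (bvec b) = T r (bvec b)" if "b \<in> B" for b
      unfolding 2 using 2 lattice_finite_mult(2)[of g of_real] nN n1 that
      by (simp add: T_mult T_fun_xi T_cscalev T_xi xiv_def mult.commute)
  qed (simp add: 2 torus_mult torus_fun_xi torus_xi)
  ultimately show ?thesis by blast
next
  case (3 g j)
  have C: "l \<in> C" "r \<in> C" unfolding 3 using 3(4) nN n1 by simp_all
  moreover have "l - r \<in> kern"
  proof (rule rel_kernI[OF C])
    fix b
    have "q powi 2 * q powi (2 * (Spre (Suc n) b - 1)) = q powi (2 * Spre (Suc n) b)"
      unfolding qpow_add[symmetric] by simp
    then show "T l (bvec b) = T r (bvec b)"
      unfolding 3 using 3 lattice_finite_shift[of g 1] nN
      by (simp add: T_mult T_fun_xi T_cscalev T_fgen mult.commute del: coef.simps)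
    show "\<exists>s. torus w l = cscale s l \<and> torus w r = cscale s r" for w
      by (intro exI[of _ "w j"])
        (simp add: 3 torus_mult torus_fun_xi torus_fgen cscale_mult_left cscale_mult_right)
  qed
  ultimately show ?thesis by blast
next
  case (4 g j)
  have C: "l \<in> C" "r \<in> C" unfolding 4 using 4(4) nN n1 by simp_all
  moreover have "l - r \<in> kern"
  proof (rule rel_kernI[OF C])
    fix b
    have "q powi (-2) * q powi (2 * (Spre (Suc n) b + 1)) = q powi (2 * Spre (Suc n) b)"
      unfolding qpow_add[symmetric] by simp
    then show "T l (bvec b) = T r (bvec b)"
      unfolding 4 using 4 lattice_finite_shift[of g "-1"] nN
      by (simp add: T_mult T_fun_xi T_cscalev T_fgen mult.commute del: coef.simps)
    show "\<exists>s. torus w l = cscale s l \<and> torus w r = cscale s r" for w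
      by (intro exI[of _ "inverse (w j)"])
        (simp add: 4 torus_mult torus_fun_xi torus_fgen cscale_mult_left cscale_mult_right)
  qed
  ultimately show ?thesis by blast
next
  case (5 g j)
  have C: "l \<in> C" "r \<in> C" unfolding 5 using 5(4) nN n1 by simp_all
  moreover have "l - r \<in> kern"
  proof (rule rel_kernI[OF C])
    fix b
    show "T l (bvec b) = T r (bvec b)"
      unfolding 5 using 5 nN
      by (simp add: T_mult T_fun_xi T_cscalev T_fgen mult.commute del: coef.simps)
    show "\<exists>s. torus w l = cscale s l \<and> torus w r = cscale s r" for w
      by (intro exI[of _ "w j"])
        (simp add: 5 torus_mult torus_fun_xi torus_fgen cscale_mult_left cscale_mult_right)
  qed
  ultimately show ?thesis by blast
next
  case (6 g j)
  have C: "l \<in> C" "r \<in> C" unfolding 6 using 6(4) nN n1 by simp_all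
  moreover have "l - r \<in> kern"
  proof (rule rel_kernI[OF C])
    fix b
    show "T l (bvec b) = T r (bvec b)"
      unfolding 6 using 6 nN
      by (simp add: T_mult T_fun_xi T_cscalev T_fgen mult.commute del: coef.simps)
    show "\<exists>s. torus w l = cscale s l \<and> torus w r = cscale s r" for w
      by (intro exI[of _ "inverse (w j)"])
        (simp add: 6 torus_mult torus_fun_xi torus_fgen cscale_mult_left cscale_mult_right)
  qed
  ultimately show ?thesis by blast
next
  case (7 g k)
  have C: "l \<in> C" "r \<in> C" unfolding 7 using 7(4) nN n1 by simp_all
  moreover have "l - r \<in> kern"
  proof (rule rel_kernI_invariant[OF C])
    show "T l (bvec b) = T r (bvec b)" if "b \<in> B" for b
      unfolding 7 using 7 that
      by (simp add: T_mult T_fun_xi T_cscalev T_xi mult.commute)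
  qed (simp add: 7 torus_mult torus_fun_xi torus_xi)
  ultimately show ?thesis by blast
qed

lemma rel_ideal_kern: "rel_ideal (coords N) (coord_rel q n N) \<subseteq> kern"
proof (rule rel_ideal_minimal[OF ideal_kern])
  fix l r assume "coord_rel q n N l r"
  then obtain l' r' where "pol_rel q n N l' r' \<or> fun_rel q n N l' r'"
    "(l = l' \<and> r = r') \<or> (l = fstar l' \<and> r = fstar r')" by (auto simp: coord_rel_def)
  moreover from this(1) have "l' - r' \<in> kern"
    using pol_rel_kern fun_rel_kern by blast
  ultimately show "l - r \<in> kern"
    using kern_fstar by (auto simp: fstar_diff[symmetric])
qed

section \<open>The action is twisted inner in the representation\<close>

text \<open>The twisted commutator of the unnormalised operator with t_{j+1} is
  \<open>eps (Suc j)\<close> (1 - q^{-2}) t_j; the constant turns this into E_j t_{j+1} = q^{-1/2}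
  t_j.\<close>

definition alpha :: "nat \<Rightarrow> real" where
  "alpha j = eps (Suc j) * q powr (-1/2) / (1 - q powi (-2))"

text \<open>\<open>X j\<close> is \<open>alpha j\<close> times \<open>t\<^sub>j \<xi>\<^bsub>j+1\<^esub>\<^bsup>-1\<^esup> t\<^bsub>j+1\<^esub>\<^sup>*\<close>, which is meaningful on \<open>\<H>\<^sub>0\<close> because \<open>\<xi>\<^bsub>j+1\<^esub>\<close> is
  invertible there.\<close>

definition xc :: "nat \<Rightarrow> (nat \<Rightarrow> int) \<Rightarrow> real" where
  "xc j i = alpha j * q powi (- i j) * rho j (i j - 1) * rho (Suc j) (i (Suc j))"

definition tau :: "nat \<Rightarrow> nat \<Rightarrow> int" where
  "tau j = dl (Suc j) - dl j"

definition X :: "nat \<Rightarrow> hvec \<Rightarrow> hvec" where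
  "X j = linext (\<lambda>i. cscale (xc j i) (bvec (i + tau j)))"

lemma clin_sub: "clin F \<Longrightarrow> clin G \<Longrightarrow> clin (\<lambda>x. F x - G x)"
  by (rule clinI) (simp_all add: clin_add clin_scale pm.scale_right_diff_distrib)

lemma clin_cscale: "clin F \<Longrightarrow> clin (\<lambda>x. cscale a (F x))"
  by (rule clinI) (simp_all add: clin_add clin_scale pm.scale_right_distrib mult.commute)

lemma clin_X [simp, intro]: "clin (X j)"
  by (simp add: X_def)

lemma X_bvec: "X j (bvec i) = cscale (xc j i) (bvec (i + tau j))"
  by (simp add: X_def bvec_def[of i])

lemma rho_dl:
  assumes "l \<le> N"
  shows "rho l (i l + dl k l + a) = rho l (i l + (if l = k then 1 else 0) + a)"
    "rho l (i l - dl k l + a) = rho l (i l - (if l = k then 1 else 0) + a)"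
  using assms by (cases "l = N"; simp add: dl_apply)+

lemma xc_basis:
  assumes "i \<in> B" "1 \<le> j" "j < N"
  shows "xc j i = 0 \<or> i + tau j \<in> B"
proof (cases "xc j i = 0")
  case False
  then have "coef (CTs (Suc j)) i \<noteq> 0" and r: "rho j (i j - 1) \<noteq> 0" by (auto simp: xc_def)
  then have b: "i + dl (Suc j) \<in> B" using basis_shift[OF assms(1), of "CTs (Suc j)"] assms by auto
  have "coef (CT j) (i + dl (Suc j)) \<noteq> 0"
    using r assms by (simp add: plus_fun_apply dl_apply)
  then have "i + dl (Suc j) + - dl j \<in> B" using basis_shift[OF b, of "CT j"] assms by auto
  then show ?thesis by (simp add: tau_def add_diff_eq)
qed simp

lemma X_H: "v \<in> H \<Longrightarrow> 1 \<le> j \<Longrightarrow> j < N \<Longrightarrow> X j v \<in> H"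
  unfolding X_def
proof (rule H_linext)
  fix i assume "i \<in> B" "1 \<le> j" "j < N"
  then show "cscale (xc j i) (bvec (i + tau j)) \<in> H"
    using xc_basis[of i j] by (cases "xc j i = 0") (simp_all add: H_bvec H_cscale)
qed

text \<open>In the coordinates S_2, ..., S_N the operator X_j is a shift along the single axis
  S_{j+1}. Both the K-weights and the behaviour of Q_0 are read off from this.\<close>

lemma Spre_tau:
  assumes "1 \<le> j" "j < N" "l \<le> N"
  shows "Spre l (tau j) = (if l = Suc j then -1 else 0)"
  using assms by (auto simp: tau_def)

lemma coef_tau:
  assumes "1 \<le> j" "j < N" "l \<le> N"
  shows "coef (CT l) (i + tau j) = q powi (Spre l i - (if l = Suc j then 1 else 0)) *
      rho l (i l + (if l = Suc j then 1 else 0) - (if l = j then 1 else 0) - 1)"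
    "coef (CTs l) (i + tau j) = q powi (Spre l i - (if l = Suc j then 1 else 0)) *
      rho l (i l + (if l = Suc j then 1 else 0) - (if l = j then 1 else 0))"
proof -
  have t: "(i + tau j) l = i l + dl (Suc j) l - dl j l" by (simp add: tau_def plus_fun_apply)
  have "rho l (i l + dl (Suc j) l - dl j l + a) =
      rho l (i l + (if l = Suc j then 1 else 0) - (if l = j then 1 else 0) + a)" for a
    using assms by (cases "l = N") (auto simp: dl_apply)
  from this[of "-1"] this[of 0]
  show "coef (CT l) (i + tau j) = q powi (Spre l i - (if l = Suc j then 1 else 0)) *
      rho l (i l + (if l = Suc j then 1 else 0) - (if l = j then 1 else 0) - 1)"
    "coef (CTs l) (i + tau j) = q powi (Spre l i - (if l = Suc j then 1 else 0)) *
      rho l (i l + (if l = Suc j then 1 else 0) - (if l = j then 1 else 0))"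
    by (simp_all add: t Spre_tau[OF assms])
qed

lemma xc_shf:
  assumes "1 \<le> j" "j < N" "l \<le> N"
  shows "xc j (i + shf (CT l)) = alpha j * q powi (- i j + (if l = j then 1 else 0)) *
      rho j (i j - (if l = j then 1 else 0) - 1) * rho (Suc j) (i (Suc j) - (if l = Suc j then 1 else 0))"
    "xc j (i + shf (CTs l)) = alpha j * q powi (- i j - (if l = j then 1 else 0)) *
      rho j (i j + (if l = j then 1 else 0) - 1) * rho (Suc j) (i (Suc j) + (if l = Suc j then 1 else 0))"
proof -
  have r: "rho (Suc j) (i (Suc j) + dl l (Suc j)) = rho (Suc j) (i (Suc j) + (if l = Suc j then 1 else 0))"
    "rho (Suc j) (i (Suc j) - dl l (Suc j)) = rho (Suc j) (i (Suc j) - (if l = Suc j then 1 else 0))"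
    using rho_dl[of "Suc j" i l 0] assms by (auto simp: eq_commute)
  have d: "dl l j = (if l = j then 1 else 0)" using assms by (auto simp: dl_apply)
  show "xc j (i + shf (CT l)) = alpha j * q powi (- i j + (if l = j then 1 else 0)) *
      rho j (i j - (if l = j then 1 else 0) - 1) * rho (Suc j) (i (Suc j) - (if l = Suc j then 1 else 0))"
    "xc j (i + shf (CTs l)) = alpha j * q powi (- i j - (if l = j then 1 else 0)) *
      rho j (i j + (if l = j then 1 else 0) - 1) * rho (Suc j) (i (Suc j) + (if l = Suc j then 1 else 0))"
    by (simp_all add: xc_def plus_fun_apply r d)
qed

lemma rr_diff1: "2 \<le> l \<Longrightarrow> l \<le> N \<Longrightarrow> rr l (a - 1) - q powi (-2) * rr l a = eps l * (1 - q powi (-2))"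
  using nN by (auto simp: rr_def eps_def qpow_diff algebra_simps power_int_minus divide_inverse)

lemma rr_diff2: "1 \<le> l \<Longrightarrow> l < N \<Longrightarrow> rr l a - rr l (a - 1) = - eps l * q powi (2 * a) * (1 - q powi (-2))"
  using nN n1 by (auto simp: rr_def eps_def qpow_diff algebra_simps power_int_minus divide_inverse)

lemma q2_ne: "1 - q powi (-2) \<noteq> 0"
  using qpow_eq_iff[of "-2" 0] by simp

lemma alpha_eps: "alpha j * eps (Suc j) * (1 - q powi (-2)) = q powr (-1/2)"
  using q2_ne by (simp add: alpha_def eps_def)

text \<open>The product \<open>eps j * eps (Suc j)\<close> is -1 only where the signature changes,
  at j = n. This produces the exceptional sign in the action of E_n on the adjoint of t_n.\<close>

lemma alpha_eps': "- (alpha j * eps j * (1 - q powi (-2)) * inverse q) = (if j = n then 1 else -1) * q powr (-3/2)"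
proof -
  have "q powr (-3/2) = q powr (-1/2) * inverse q"
    using q0 powr_add[of q "-1/2" "-1"] by (simp add: powr_minus)
  moreover have "eps j * eps (Suc j) = (if j = n then -1 else 1)" by (auto simp: eps_def)
  moreover have "alpha j * eps j * (1 - q powi (-2)) * inverse q = (eps j * eps (Suc j)) * (q powr (-1/2) * inverse q)"
    using q2_ne by (simp add: alpha_def)
  ultimately show ?thesis by (simp only: mult.assoc) simp
qed

text \<open>The matrix coefficient of the twisted commutator X_j T(x) - T(K_j x) X_j at the basis
  vector with index i.\<close>

definition twist :: "nat \<Rightarrow> coord \<Rightarrow> (nat \<Rightarrow> int) \<Rightarrow> real" where
  "twist j x i = coef x i * xc j (i + shf x) - K_weight q j x * xc j i * coef x (i + tau j)"

lemma twist_CT: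
  assumes "i \<in> B" "1 \<le> j" "j < N" "1 \<le> l" "l \<le> N"
  shows "twist j (CT l) i = (if l = Suc j then q powr (-1/2) * coef (CT j) i else 0)"
proof -
  consider "l \<noteq> j" "l \<noteq> Suc j" | "l = j" | "l = Suc j" by blast
  then show ?thesis
  proof cases
    case 1
    then show ?thesis
      unfolding twist_def coef_tau[OF assms(2,3,5)] xc_shf[OF assms(2,3,5)] by (simp add: xc_def)
  next
    case 2
    then show ?thesis
      unfolding twist_def coef_tau[OF assms(2,3,5)] xc_shf[OF assms(2,3,5)] by (simp add: xc_def qpow_add qpow_diff power_int_minus divide_inverse)
  next
    case 3
    let ?r = "rho (Suc j) (i (Suc j) - 1)" and ?r' = "rho (Suc j) (i (Suc j))"
    have S: "Spre (Suc j) i = Spre j i + i j" using assms by (simp add: Spre_Suc)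
    \<comment> \<open>One factor 1/q comes from the weight of t_{j+1} under \<open>K_j\<close>, the
      other from the shift of S_{j+1}. With the resulting q^{-2} the part of \<open>rr\<close> that
      depends on i cancels.\<close>
    have "twist j (CT l) i = alpha j * q powi Spre j i * rho j (i j - 1) * (?r * ?r - q powi (-2) * (?r' * ?r'))"
      unfolding twist_def coef_tau[OF assms(2,3,5)] xc_shf[OF assms(2,3,5)] using 3
      by (simp add: xc_def S qpow_add qpow_diff power_int_minus field_simps power2_eq_square)
    also have "?r * ?r - q powi (-2) * (?r' * ?r') = eps (Suc j) * (1 - q powi (-2))"
      using rr_nonneg[OF assms(1), of "Suc j"] rr_diff1[of "Suc j"] assms by (simp add: rho_sq)
    also have "alpha j * q powi Spre j i * rho j (i j - 1) * (eps (Suc j) * (1 - q powi (-2))) =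
      (alpha j * eps (Suc j) * (1 - q powi (-2))) * coef (CT j) i"
      by simp
    finally show ?thesis using 3 by (simp only: alpha_eps if_True refl)
  qed
qed

lemma twist_CTs:
  assumes "i \<in> B" "1 \<le> j" "j < N" "1 \<le> l" "l \<le> N"
  shows "twist j (CTs l) i =
    (if l = j then (if j = n then 1 else -1) * q powr (-3/2) * coef (CTs (Suc j)) i else 0)"
proof -
  consider "l \<noteq> j" "l \<noteq> Suc j" | "l = j" | "l = Suc j" by blast
  then show ?thesis
  proof cases
    case 1
    then show ?thesis
      unfolding twist_def coef_tau[OF assms(2,3,5)] xc_shf[OF assms(2,3,5)] by (simp add: xc_def)
  next
    case 3
    then show ?thesis
      unfolding twist_def coef_tau[OF assms(2,3,5)] xc_shf[OF assms(2,3,5)]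
      by (simp add: xc_def qpow_add qpow_diff)
  next
    case 2
    let ?r = "rho j (i j - 1)" and ?r' = "rho j (i j)"
    have S: "Spre (Suc j) i = Spre j i + i j" using assms by (simp add: Spre_Suc)
    have "twist j (CTs l) i = alpha j * inverse q * q powi (Spre j i - i j) * rho (Suc j) (i (Suc j)) * (?r' * ?r' - ?r * ?r)"
      unfolding twist_def coef_tau[OF assms(2,3,5)] xc_shf[OF assms(2,3,5)] using 2
      by (simp add: xc_def qpow_add qpow_diff power_int_minus field_simps)
    also have "?r' * ?r' - ?r * ?r = - eps j * q powi (2 * i j) * (1 - q powi (-2))"
      using rr_nonneg[OF assms(1), of j] rr_diff2[of j] assms by (simp add: rho_sq)
    also have "alpha j * inverse q * q powi (Spre j i - i j) * rho (Suc j) (i (Suc j)) * (- eps j * q powi (2 * i j) * (1 - q powi (-2)))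
      = - (alpha j * eps j * (1 - q powi (-2)) * inverse q) * coef (CTs (Suc j)) i"
      by (simp add: S qpow_add qpow_diff qpow_double)
    finally show ?thesis using 2 by (simp only: alpha_eps' if_True refl)
  qed
qed

lemma twist_Chi:
  assumes "1 \<le> j" "j < N"
  shows "twist j (Chi k) i = (if j = n then xc n i *
    ((if Spre (Suc n) i = k then 1 else 0) - (if Spre (Suc n) i - 1 = k then 1 else 0)) else 0)"
  using assms nN by (auto simp: twist_def Spre_tau algebra_simps)

lemma lattice_finite_q_diff: "lattice_finite q (q_diff q (pt_ind q k))"
proof -
  have e: "q powi (-2) * q powi (2 * l) = q powi (2 * (l - 1))" for l
    unfolding qpow_add[symmetric] by simp
  have "{l. q_diff q (pt_ind q k) (q powi (2 * l)) \<noteq> 0} \<subseteq> {k, k + 1}"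
    unfolding q_diff_def pt_ind_def e qpow_eq_iff by auto
  then show ?thesis unfolding lattice_finite_def by (rule finite_subset) simp
qed

text \<open>The denominator of \<open>q_diff\<close> supplies the factor \<xi>_{n+1}^{-1} of X_n,
  and its numerator is the change of the indicator when X_n lowers S_{n+1} by 1.\<close>

lemma T_E_gen_Chi:
  "T (E_gen q n n (Chi k)) (bvec i) = cscale (twist n (Chi k) i) (bvec (i + tau n))"
proof -
  let ?S = "Spre (Suc n) i"
  let ?D = "((if ?S - 1 = k then 1 else 0) - (if ?S = k then 1 else 0)) / ((q powi (-2) - 1) * q powi (2 * ?S))"
  have e: "q powi (-2) * q powi (2 * ?S) = q powi (2 * (?S - 1))"
    unfolding qpow_add[symmetric] by simp
  have d: "q powi (2 * (?S - 1)) - q powi (2 * ?S) = (q powi (-2) - 1) * q powi (2 * ?S)"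
    unfolding e[symmetric] by (simp add: algebra_simps)
  have D: "q_diff q (pt_ind q k) (q powi (2 * ?S)) = complex_of_real ?D"
    unfolding q_diff_def pt_ind_def e qpow_eq_iff d by simp
  have c: "coef (CT n) (i + dl (Suc n)) = coef (CT n) i"
    using n1 by (simp add: plus_fun_apply dl_apply)
  have t: "i + dl (Suc n) - dl n = i + tau n" by (simp add: tau_def add_diff_eq)
  have a: "alpha n = q powr (-1/2) / (1 - q powi (-2))" by (simp add: alpha_def eps_def)
  have S: "q powi ?S = q powi Spre n i * q powi i n" using n1 by (simp add: Spre_Suc qpow_add)
  have m: "q powi (2 * ?S) = q powi ?S * q powi ?S" by (rule qpow_double)
  have r: "q powr (-1/2) * (coef (CTs (Suc n)) i * (?D * coef (CT n) i)) = twist n (Chi k) i"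
  proof -
    have "coef (CTs (Suc n)) i * (?D * coef (CT n) i) * (q powi (-2) - 1) =
      q powi (- i n) * rho n (i n - 1) * rho (Suc n) (i (Suc n)) * ((if ?S - 1 = k then 1 else 0) - (if ?S = k then 1 else 0))"
    proof -
      \<comment> \<open>Here P = q^{S_n}, Y = q^{i_n}, a = q^{-2} - 1, and Z is the numerator of the
        difference quotient.\<close>
      have "(P * Y * r') * (Z / (a * ((P * Y) * (P * Y))) * (P * r)) * a = inverse Y * r * r' * Z"
        if "P \<noteq> 0" "Y \<noteq> 0" "a \<noteq> 0" for P Y a Z r r' :: real
        using that by (simp add: field_simps)
      from this[of "q powi Spre n i" "q powi i n" "q powi (-2) - 1"] show ?thesis
        using q2_ne by (simp add: m S power_int_minus)
    qed
    then have "q powr (-1/2) / (q powi (-2) - 1) * (coef (CTs (Suc n)) i * (?D * coef (CT n) i) * (q powi (-2) - 1)) =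
      q powr (-1/2) / (q powi (-2) - 1) * (q powi (- i n) * rho n (i n - 1) * rho (Suc n) (i (Suc n)) * ((if ?S - 1 = k then 1 else 0) - (if ?S = k then 1 else 0)))"
      by (simp only:)
    moreover have "q powr (-1/2) / (q powi (-2) - 1) = - alpha n"
      unfolding a using q2_ne by (simp add: field_simps)
    moreover have "q powr (-1/2) / (q powi (-2) - 1) * (Y * (q powi (-2) - 1)) = q powr (-1/2) * Y" for Y
      using q2_ne by (simp add: field_simps)
    ultimately have "q powr (-1/2) * (coef (CTs (Suc n)) i * (?D * coef (CT n) i)) =
      - alpha n * (q powi (- i n) * rho n (i n - 1) * rho (Suc n) (i (Suc n)) * ((if ?S - 1 = k then 1 else 0) - (if ?S = k then 1 else 0)))"
      by (metis mult.assoc)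
    also have "\<dots> = twist n (Chi k) i"
      using n1 nN by (simp add: twist_Chi xc_def algebra_simps)
    finally show ?thesis .
  qed
  have "T (E_gen q n n (Chi k)) (bvec i) =
    cscale (of_real (q powr (-1/2)) * (of_real (coef (CTs (Suc n)) i) * (complex_of_real ?D * of_real (coef (CT n) i)))) (bvec (i + tau n))"
    using n1 nN
    by (simp add: T_cscale T_mult T_fgen T_cscalev T_fun_xi[OF lattice_finite_q_diff] D c t mult.assoc del: coef.simps)
  also have "of_real (q powr (-1/2)) * (of_real (coef (CTs (Suc n)) i) * (complex_of_real ?D * of_real (coef (CT n) i))) = of_real (twist n (Chi k) i)"
    unfolding r[symmetric] of_real_mult ..
  finally show ?thesis .
qed

lemma T_E_gen:
  assumes "i \<in> B" "x \<in> coords N" "1 \<le> j" "j < N"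
  shows "T (E_gen q n j x) (bvec i) = cscale (twist j x i) (bvec (i + shf x + tau j))"
proof (cases x)
  case (CT l)
  have e: "i - dl (Suc j) + tau j = i - dl j" by (simp add: tau_def)
  show ?thesis using assms CT
    by (cases "l = Suc j") (simp_all add: twist_CT T_cscale T_fgen e del: coef.simps)
next
  case (CTs l)
  have e: "i + dl j + tau j = i + dl (Suc j)" by (simp add: tau_def add.assoc)
  show ?thesis using assms CTs
    by (cases "l = j") (simp_all add: twist_CTs T_cscale T_fgen e del: coef.simps)
next
  case (Chi k)
  then show ?thesis using assms T_E_gen_Chi[of k i] by (cases "j = n") (simp_all add: twist_Chi)
qed

text \<open>The identity is stated on H because the computation of \<open>twist\<close> replaces
  squares of \<open>rho\<close> by \<open>rr\<close>, which rests on nonnegativity on B.\<close>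

lemma inner_gen:
  assumes "v \<in> H" "x \<in> coords N" "1 \<le> j" "j < N"
  shows "T (E_gen q n j x) v = X j (T (fgen x) v) - cscale (K_weight q j x) (T (fgen x) (X j v))"
proof (rule eq_on_H[OF _ _ assms(1)])
  show "clin (\<lambda>v. X j (T (fgen x) v) - cscale (K_weight q j x) (T (fgen x) (X j v)))"
    by (intro clin_sub clin_cscale clin_comp[OF clin_X] clin_comp[OF clin_T] clin_T clin_X)
  fix i assume i: "i \<in> B"
  have e: "i + shf x + tau j = i + tau j + shf x" by (simp add: add.assoc add.commute[of "shf x"])
  show "T (E_gen q n j x) (bvec i) = X j (T (fgen x) (bvec i)) - cscale (K_weight q j x) (T (fgen x) (X j (bvec i)))"
    using i assms
    by (simp add: T_E_gen T_fgen X_bvec clin_scale[OF clin_X] T_cscalev twist_def e pm.scale_left_diff_distrib mult.assoc del: coef.simps)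
qed simp

text \<open>The map f \<mapsto> X_j T(f) - T(K_j f) X_j obeys the same twisted Leibniz rule as E_j,
  so agreement on letters propagates to words.\<close>

lemma inner_word:
  assumes "set xs \<subseteq> coords N" "v \<in> H" "1 \<le> j" "j < N"
  shows "T (E_word q n j xs) v = X j (T (wsingle xs) v) - T (K_word q j xs) (X j v)"
  using assms(1)
proof (induction xs)
  case Nil
  then show ?case by (simp add: wsingle_Nil K_word_def)
next
  case (Cons x xs)
  have xs: "wsingle xs \<in> C" using Cons.prems by (simp add: free_algebra_carrier)
  have K: "K_word q j (x # xs) = K_word q j [x] * K_word q j xs"
    by (simp add: K_word_torus torus_mult[symmetric] wsingle_mult)
  have K1: "K_word q j [x] = cscale (K_weight q j x) (fgen x)"
    by (simp add: K_word_def fgen_def)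
  have "T (E_word q n j (x # xs)) v = T (E_gen q n j x) (T (wsingle xs) v)
    + T (K_word q j [x]) (X j (T (wsingle xs) v) - T (K_word q j xs) (X j v))"
    using Cons by (simp add: T_add T_mult)
  also have "T (E_gen q n j x) (T (wsingle xs) v) =
    X j (T (fgen x) (T (wsingle xs) v)) - T (K_word q j [x]) (X j (T (wsingle xs) v))"
    using inner_gen[OF T_H[OF xs assms(2)], of x j] Cons.prems assms(3,4) by (simp add: K1 T_cscale)
  finally show ?case
    by (simp add: K T_mult T_diffv fgen_mult_wsingle[symmetric])
qed

lemma inner_torus:
  assumes "f \<in> C" "\<And>i. w i \<noteq> 0" "v \<in> H" "1 \<le> j" "j < N"
  shows "T (torus w (act_gen q n (UE j) f)) v =
    cscale (w j / w (Suc j)) (X j (T (torus w f) v) - T (torus w (torus (kwt q j) f)) (X j v))"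
proof (rule clin_eqI[where F = "\<lambda>f. T (torus w (act_gen q n (UE j) f)) v"])
  show "clin (\<lambda>f. T (torus w (act_gen q n (UE j) f)) v)"
    by (intro clin_comp[OF clin_T_left] clin_comp[OF clin_torus] clin_act_gen)
  show "clin (\<lambda>f. cscale (w j / w (Suc j)) (X j (T (torus w f) v) - T (torus w (torus (kwt q j) f)) (X j v)))"
    by (intro clin_sub clin_cscale clin_comp[OF clin_X] clin_comp[OF clin_T_left] clin_comp[OF clin_torus] clin_torus)
  fix u assume "u \<in> Poly_Mapping.keys f"
  then have "set (letters u) \<subseteq> coords N" using assms(1) by (auto simp: free_algebra_carrier wspan_def)
  moreover obtain xs where "u = Word xs" by (cases u)
  ultimately have xs: "set xs \<subseteq> coords N" and u: "u = Word xs" by auto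
  have K: "torus w (torus (kwt q j) (wsingle xs)) = cscale (\<Prod>x\<leftarrow>xs. wt w x) (K_word q j xs)"
    by (simp add: K_word_torus torus_single mult.commute)
  show "T (torus w (act_gen q n (UE j) (Poly_Mapping.single u 1))) v =
    cscale (w j / w (Suc j)) (X j (T (torus w (Poly_Mapping.single u 1)) v) -
      T (torus w (torus (kwt q j) (Poly_Mapping.single u 1))) (X j v))"
    unfolding u K
    unfolding torus_wsingle T_cscale clin_scale[OF clin_X]
    by (simp add: torus_E_word[OF assms(2)] T_cscale inner_word[OF xs assms(3-5)]
        pm.scale_right_diff_distrib)
qed

section \<open>Stability of the ideal under the quantum group\<close>

lemma kwt_nz: "kwt q j i \<noteq> 0"
  by (simp add: kwt_def)

lemma kern_torus: "f \<in> kern \<Longrightarrow> (\<And>j. w j \<noteq> 0) \<Longrightarrow> torus w f \<in> kern"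
  by (auto simp: kern_def torus_torus)

text \<open>Both terms of the twisted commutator vanish: the twisted f kills v, and its further
  twist by \<open>K_j\<close> kills X_j v, which stays in H.\<close>

lemma kern_E:
  assumes "f \<in> kern" "1 \<le> j" "j < N"
  shows "act_gen q n (UE j) f \<in> kern"
proof -
  have "T (torus w (act_gen q n (UE j) f)) (bvec i) = 0" if w: "\<And>i. w i \<noteq> 0" and i: "i \<in> B" for w i
  proof -
    have v: "bvec i \<in> H" using i by (simp add: H_bvec)
    show ?thesis
      using kern_torus_H[OF assms(1) w v]
        kern_torus_H[OF kern_torus[OF assms(1) kwt_nz] w X_H[OF v assms(2,3)]]
      by (simp add: inner_torus[OF kern_C[OF assms(1)] w v assms(2,3)] clin_zero[OF clin_X] del: act_gen.simps)
  qed
  moreover have "act_gen q n (UE j) f \<in> C"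
    using carrier_act_gen[OF q0 kern_C[OF assms(1)]] assms by (auto simp: ugens_def simp del: act_gen.simps)
  ultimately show ?thesis by (auto simp: kern_def simp del: act_gen.simps)
qed

lemma kern_act_gen:
  assumes "f \<in> kern" "u \<in> ugens N"
  shows "act_gen q n u f \<in> kern"
proof (cases u)
  case (UE j)
  then show ?thesis using kern_E assms by (auto simp: ugens_def simp del: act_gen.simps)
next
  case (UF j)
  then have "1 \<le> j" "j < N" using assms by (auto simp: ugens_def)
  then have "fstar (act_gen q n (UE j) (fstar f)) \<in> kern"
    by (intro kern_fstar kern_E assms)
  then show ?thesis unfolding UF act_gen_UF[OF q0] by (rule kern_cscale)
next
  case (UK j)
  show ?thesis unfolding UK act_gen_UK by (intro kern_torus assms kwt_nz)
next
  case (UKinv j)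
  show ?thesis unfolding UKinv act_gen_UKinv by (intro kern_torus assms) (simp add: kwt_nz)
qed

end

section \<open>Convergence of the trace\<close>

text \<open>Summation by parts: i_j occurs in S_l for l = j + 1, ..., M, that is M - j
  times.\<close>

lemma sum_weighted_eq_sum_partial:
  "(\<Sum>j=1..<M. (int M - int j) * i j) = (\<Sum>l=2..M. Spre l i)" if "1 \<le> M"
  using that
proof (induction M rule: dec_induct)
  case base
  then show ?case by simp
next
  case (step M)
  have "(\<Sum>j=1..<Suc M. (int (Suc M) - int j) * i j) = (\<Sum>j=1..<M. (int M - int j) * i j + i j) + i M"
    using step(1) by (simp add: atLeastLessThanSuc algebra_simps)
  also have "\<dots> = (\<Sum>l=2..M. Spre l i) + (\<Sum>j=1..<Suc M. i j)"
    using step by (simp add: sum.distrib atLeastLessThanSuc)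
  also have "\<dots> = (\<Sum>l=2..Suc M. Spre l i)"
    using step(1) by (simp add: Spre_def)
  finally show ?case .
qed

text \<open>F lies in a finite box, over which the sum of products is a product of partial geometric
  sums.\<close>

lemma sum_geometric_PiE_le:
  fixes a :: real
  assumes "0 < a" "a < 1" "finite L" "finite F" "F \<subseteq> PiE L (\<lambda>_. UNIV)"
  shows "(\<Sum>x\<in>F. \<Prod>l\<in>L. a ^ x l) \<le> (1 / (1 - a)) ^ card L"
proof -
  define M where "M = Max ((\<lambda>(x, l). x l) ` (F \<times> L))"
  have M: "x l \<le> M" if "x \<in> F" "l \<in> L" for x l
    unfolding M_def using assms that by (intro Max_ge) force+
  have "F \<subseteq> PiE L (\<lambda>_. {..M})"
  proof
    fix x assume x: "x \<in> F"
    then have "x \<in> PiE L (\<lambda>_. UNIV)" using assms by auto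
    then show "x \<in> PiE L (\<lambda>_. {..M})" using M[OF x] by (auto simp: PiE_def extensional_def)
  qed
  then have "(\<Sum>x\<in>F. \<Prod>l\<in>L. a ^ x l) \<le> (\<Sum>x\<in>PiE L (\<lambda>_. {..M}). \<Prod>l\<in>L. a ^ x l)"
    using assms by (intro sum_mono2 finite_PiE prod_nonneg) auto
  also have "\<dots> = (\<Prod>l\<in>L. \<Sum>y\<le>M. a ^ y)"
    using assms by (subst prod_sum_PiE) auto
  also have "\<dots> \<le> (\<Prod>l\<in>L. 1 / (1 - a))"
  proof (intro prod_mono conjI)
    have "(\<Sum>y\<le>M. a ^ y) \<le> suminf ((^) a)"
      using assms by (intro sum_le_suminf summable_geometric) auto
    also have "\<dots> = 1 / (1 - a)" using assms by (intro suminf_geometric) auto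
    finally show "(\<Sum>y\<le>M. a ^ y) \<le> 1 / (1 - a)" .
  qed (use assms in \<open>auto intro!: sum_nonneg\<close>)
  finally show ?thesis by simp
qed

context quantum_cone
begin

definition Qv :: "(nat \<Rightarrow> int) \<Rightarrow> real" where
  "Qv i = c * q powi (2 * (\<Sum>l=2..N. Spre l i))"

lemma Qv_pos: "0 < Qv i"
  using c0 by (simp add: Qv_def)

lemma Q0_bvec: "Q0 c q N (bvec i) = cscale (Qv i) (bvec i)"
  using sum_weighted_eq_sum_partial[of N i] nN by (simp add: Q0_def Qv_def bvec_def[of i])

text \<open>The coordinates i_2, ..., i_n are nonpositive and the later ones positive, so the
  partial sums descend up to S_{n+1} and ascend afterwards.\<close>

lemma basis_Spre_ge:
  assumes "i \<in> B" "2 \<le> l" "l \<le> N"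
  shows "Spre (Suc n) i \<le> Spre l i"
proof (cases "l \<le> Suc n")
  case True
  have "(\<Sum>k=l..<Suc n. i k) \<le> 0"
    using basisD(1)[OF assms(1)] assms(2) by (intro sum_nonpos) auto
  moreover have "Spre (Suc n) i = Spre l i + (\<Sum>k=l..<Suc n. i k)"
    unfolding Spre_def using True assms by (intro sum.atLeastLessThan_concat[symmetric]) auto
  ultimately show ?thesis by simp
next
  case False
  have "0 \<le> (\<Sum>k=Suc n..<l. i k)"
  proof (rule sum_nonneg)
    show "0 \<le> i k" if "k \<in> {Suc n..<l}" for k
      using basisD(2)[OF assms(1), of k] assms(3) that by simp
  qed
  moreover have "Spre l i = Spre (Suc n) i + (\<Sum>k=Suc n..<l. i k)"
    unfolding Spre_def using False by (intro sum.atLeastLessThan_concat[symmetric]) auto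
  ultimately show ?thesis by simp
qed

lemma basis_eqI:
  assumes "i \<in> B" "i' \<in> B" "\<And>l. 2 \<le> l \<Longrightarrow> l \<le> N \<Longrightarrow> Spre l i = Spre l i'"
  shows "i = i'"
proof
  fix k
  consider "k = 0 \<or> N \<le> k" | "k = 1" | "2 \<le> k" "k < N" by linarith
  then show "i k = i' k"
  proof cases
    case 1
    then show ?thesis using basisD(3)[OF assms(1)] basisD(3)[OF assms(2)] by simp
  next
    case 2
    then show ?thesis using assms(3)[of 2] nN by (simp add: Spre_def numeral_2_eq_2)
  next
    case 3
    then show ?thesis
      using assms(3)[of k] assms(3)[of "Suc k"] by (simp add: Spre_Suc)
  qed
qed

lemma q_sum_prod: "q powi (\<Sum>l\<in>A. f l) = (\<Prod>l\<in>A. q powi f l)"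
  by (induction A rule: infinite_finite_induct) (simp_all add: qpow_add)

text \<open>The diagonal weight of Q_0 on the slice S_{n+1} = k, with one of its two factors q^{S_p}
  removed. This allowance absorbs the growth of X_j when p = j + 1.\<close>

definition majorant :: "nat \<Rightarrow> int \<Rightarrow> (nat \<Rightarrow> int) \<Rightarrow> real" where
  "majorant p k i = (if Spre (Suc n) i = k then q powi (- Spre p i) * Qv i else 0)"

lemma majorant_nonneg: "0 \<le> majorant p k i"
  using less_imp_le[OF Qv_pos] by (simp add: majorant_def)

text \<open>In the coordinates \<open>x\<^sub>l = S\<^sub>l - k \<ge> 0\<close> the weight is at most a constant times \<open>\<Prod>\<^sub>l q ^ x\<^sub>l\<close>.\<close>

lemma majorant_summable:
  assumes p: "p \<in> {2..N}"
  shows "majorant p k summable_on B"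
proof (rule nonneg_bdd_above_summable_on)
  let ?L = "{2..N}"
  define B' where "B' = {i \<in> B. Spre (Suc n) i = k}"
  define K where "K = c * q powi (k * int (card (?L - {p}))) * q powi (k * int (card ?L))"
  define \<phi> where "\<phi> i = restrict (\<lambda>l. nat (Spre l i - k)) ?L" for i
  have K: "0 \<le> K" using c0 by (simp add: K_def)
  have \<phi>: "int (\<phi> i l) = Spre l i - k" if "i \<in> B'" "l \<in> ?L" for i l
    using that basis_Spre_ge[of i l] by (simp add: \<phi>_def B'_def)
  have inj: "inj_on \<phi> B'"
  proof (rule inj_onI)
    fix i i' assume i: "i \<in> B'" "i' \<in> B'" and e: "\<phi> i = \<phi> i'"
    have "Spre l i = Spre l i'" if "l \<in> ?L" for l
      using \<phi>[OF i(1) that] \<phi>[OF i(2) that] e by simp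
    then show "i = i'" using i by (intro basis_eqI) (auto simp: B'_def)
  qed
  have bound: "majorant p k i \<le> K * (\<Prod>l\<in>?L. q ^ \<phi> i l)" if i: "i \<in> B'" for i
  proof -
    \<comment> \<open>The exponent of \<open>Qv\<close> contains every S_l twice. One copy of each
      gives the convergent product; the other copy, deprived of S_p, is only bounded below through
      S_l \<ge> k.\<close>
    have "(\<Sum>l\<in>?L. Spre l i) = Spre p i + (\<Sum>l\<in>?L - {p}. Spre l i)"
      using p by (intro sum.remove) auto
    then have e: "- Spre p i + 2 * (\<Sum>l\<in>?L. Spre l i) = (\<Sum>l\<in>?L - {p}. Spre l i) + (\<Sum>l\<in>?L. Spre l i)"
      by simp
    have "(\<Sum>l\<in>?L - {p}. k) \<le> (\<Sum>l\<in>?L - {p}. Spre l i)"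
      using i basis_Spre_ge[of i] by (intro sum_mono) (auto simp: B'_def)
    then have 1: "q powi (\<Sum>l\<in>?L - {p}. Spre l i) \<le> q powi (k * int (card (?L - {p})))"
      by (intro qpow_antimono) (simp add: mult.commute)
    have "(\<Sum>l\<in>?L. Spre l i) = k * int (card ?L) + (\<Sum>l\<in>?L. int (\<phi> i l))"
      using \<phi>[OF i] by (simp add: sum_subtractf)
    then have 2: "q powi (\<Sum>l\<in>?L. Spre l i) = q powi (k * int (card ?L)) * (\<Prod>l\<in>?L. q ^ \<phi> i l)"
      by (simp only: qpow_add q_sum_prod power_int_of_nat)
    have "majorant p k i = c * (q powi (- Spre p i) * q powi (2 * (\<Sum>l\<in>?L. Spre l i)))"
      using i by (simp add: majorant_def B'_def Qv_def)
    also have "\<dots> = c * q powi (- Spre p i + 2 * (\<Sum>l\<in>?L. Spre l i))"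
      unfolding qpow_add ..
    also have "\<dots> = c * (q powi (\<Sum>l\<in>?L - {p}. Spre l i) * q powi (\<Sum>l\<in>?L. Spre l i))"
      unfolding e qpow_add ..
    also have "\<dots> \<le> c * (q powi (k * int (card (?L - {p}))) * q powi (\<Sum>l\<in>?L. Spre l i))"
      using c0 1 by (intro mult_left_mono mult_right_mono) auto
    also have "\<dots> = K * (\<Prod>l\<in>?L. q ^ \<phi> i l)"
      unfolding 2 K_def by simp
    finally show ?thesis .
  qed
  show "bdd_above (sum (majorant p k) ` {F. F \<subseteq> B \<and> finite F})"
  proof (rule bdd_aboveI2)
    fix F assume "F \<in> {F. F \<subseteq> B \<and> finite F}"
    then have F: "F \<subseteq> B" "finite F" by auto
    let ?F = "F \<inter> B'"
    have "sum (majorant p k) F = sum (majorant p k) ?F"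
      using F by (intro sum.mono_neutral_right) (auto simp: B'_def majorant_def)
    also have "\<dots> \<le> (\<Sum>i\<in>?F. K * (\<Prod>l\<in>?L. q ^ \<phi> i l))"
      by (intro sum_mono bound) auto
    also have "\<dots> = K * (\<Sum>x\<in>\<phi> ` ?F. \<Prod>l\<in>?L. q ^ x l)"
      using inj_on_subset[OF inj, of ?F] by (simp add: sum.reindex sum_distrib_left)
    also have "\<dots> \<le> K * (1 / (1 - q)) ^ card ?L"
      using F q0 q1 K by (intro mult_left_mono sum_geometric_PiE_le) (auto simp: \<phi>_def)
    finally show "sum (majorant p k) F \<le> K * (1 / (1 - q)) ^ card ?L" .
  qed
qed (rule majorant_nonneg)

lemma dominated_summable:
  fixes g :: "(nat \<Rightarrow> int) \<Rightarrow> complex"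
  assumes "p \<in> {2..N}" "\<And>i. i \<in> B \<Longrightarrow> norm (g i) \<le> K * majorant p k i"
  shows "(\<lambda>i. norm (g i)) summable_on B"
proof (rule Infinite_Sum.abs_summable_on_comparison_test)
  show "(\<lambda>i. norm (K * majorant p k i)) summable_on B"
    using summable_on_cmult_right[OF majorant_summable[OF assms(1)], of "\<bar>K\<bar>" k] majorant_nonneg
    by (simp add: abs_mult)
  show "norm (g i) \<le> norm (K * majorant p k i)" if "i \<in> B" for i
    using assms(2)[OF that] by simp
qed

section \<open>Growth of matrix coefficients on a slice\<close>

lemma rho_le:
  assumes "0 \<le> rr j a"
  shows "\<bar>rho j a\<bar> \<le> (if j \<le> n then q powi a else 1)"
proof -
  define y where "y = (if j \<le> n then q powi a else 1)"
  have y: "0 \<le> y" by (simp add: y_def)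
  have "rho j a * rho j a \<le> y * y"
    using assms n1 unfolding rho_sq[OF assms] by (auto simp: rr_def qpow_double y_def)
  then have "\<bar>rho j a\<bar> \<le> \<bar>y\<bar>"
    unfolding abs_le_square_iff power2_eq_square .
  then show ?thesis using y unfolding y_def by simp
qed

text \<open>For j \<le> n the factors q^{S_j} and q^{i_j} combine to q^{S_{j+1}}; in all cases the
  exponent is at least S_{n+1} - 1. The 1 in the maximum covers the indicators.\<close>

lemma coef_le:
  assumes i: "i \<in> B" and x: "x \<in> coords N"
  shows "\<bar>coef x i\<bar> \<le> max 1 (q powi (Spre (Suc n) i - 1))"
proof -
  let ?k = "Spre (Suc n) i"
  have *: "\<bar>q powi Spre j i * rho j (i j - d)\<bar> \<le> q powi (?k - 1)"
    if j: "1 \<le> j" "j \<le> N" and d: "d = 0 \<or> d = 1" for j d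
  proof -
    have r: "0 \<le> rr j (i j - d)" using rr_nonneg[OF i j] d by auto
    have "\<bar>q powi Spre j i * rho j (i j - d)\<bar> \<le> q powi Spre j i * (if j \<le> n then q powi (i j - d) else 1)"
      using rho_le[OF r] by (simp add: abs_mult)
    also have "\<dots> = q powi (if j \<le> n then Spre (Suc j) i - d else Spre j i)"
      using j by (simp add: Spre_Suc qpow_add[symmetric] add_diff_eq)
    also have "\<dots> \<le> q powi (?k - 1)"
      using basis_Spre_ge[OF i, of "Suc j"] basis_Spre_ge[OF i, of j] j d nN n1
      by (intro qpow_antimono) auto
    finally show ?thesis .
  qed
  show ?thesis
  proof (cases x)
    case (CT j)
    then show ?thesis using *[of j 1] x by auto
  next
    case (CTs j)
    then show ?thesis using *[of j 0] x by auto
  qed (simp add: le_max_iff_disj)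
qed

text \<open>Up to the constants, the coefficient is at most q^{i_{j+1} - 1} for j < n, q^{-1} for j
  = n and q^{-i_j} for j > n. Written in partial sums, all growth is in q^{-S_{j+1}}.\<close>

lemma xc_le:
  assumes i: "i \<in> B" and j: "1 \<le> j" "j < N"
  shows "\<bar>xc j i\<bar> \<le> \<bar>alpha j\<bar> * q powi (Spre (Suc n) i - 1) * q powi (- Spre (Suc j) i)"
proof -
  let ?k = "Spre (Suc n) i"
  have 1: "\<bar>rho j (i j - 1)\<bar> \<le> (if j \<le> n then q powi (i j - 1) else 1)"
    using j by (intro rho_le rr_nonneg[OF i]) auto
  have 2: "\<bar>rho (Suc j) (i (Suc j))\<bar> \<le> (if Suc j \<le> n then q powi (i (Suc j)) else 1)"
    using j by (intro rho_le rr_nonneg[OF i]) auto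
  have "\<bar>xc j i\<bar> = \<bar>alpha j\<bar> * (q powi (- i j) * (\<bar>rho j (i j - 1)\<bar> * \<bar>rho (Suc j) (i (Suc j))\<bar>))"
    by (simp add: xc_def abs_mult)
  also have "\<dots> \<le> \<bar>alpha j\<bar> * (q powi (- i j) * ((if j \<le> n then q powi (i j - 1) else 1) * (if Suc j \<le> n then q powi (i (Suc j)) else 1)))"
    using 1 2 by (intro mult_left_mono mult_mono) auto
  also have "q powi (- i j) * ((if j \<le> n then q powi (i j - 1) else 1) * (if Suc j \<le> n then q powi (i (Suc j)) else 1))
    = q powi ((if j \<le> n then - 1 else - i j) + (if Suc j \<le> n then i (Suc j) else 0))"
    by (simp add: qpow_add[symmetric])
  also have "\<dots> \<le> q powi (?k - 1 + - Spre (Suc j) i)"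
  proof (rule qpow_antimono)
    consider "Suc j \<le> n" | "j = n" | "n < j" by linarith
    then show "?k - 1 + - Spre (Suc j) i \<le> (if j \<le> n then - 1 else - i j) + (if Suc j \<le> n then i (Suc j) else 0)"
    proof cases
      case 1
      then show ?thesis using basis_Spre_ge[OF i, of "Suc (Suc j)"] j nN by (simp add: Spre_Suc)
    next
      case 2
      then show ?thesis by simp
    next
      case 3
      then show ?thesis using basis_Spre_ge[OF i, of j] j n1 by (simp add: Spre_Suc)
    qed
  qed
  finally show ?thesis by (simp only: qpow_add[of "?k - 1"] mult.assoc mult_left_mono abs_ge_zero)
qed

lemma wcoef_bound:
  assumes "set xs \<subseteq> coords N"
  shows "\<exists>K\<ge>0. \<forall>i\<in>B. Spre (Suc n) i = k \<longrightarrow> \<bar>wcoef xs i\<bar> \<le> K"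
  using assms
proof (induction xs)
  case (Cons x xs)
  then obtain K where K: "0 \<le> K" "\<And>i. i \<in> B \<Longrightarrow> Spre (Suc n) i = k \<Longrightarrow> \<bar>wcoef xs i\<bar> \<le> K" by auto
  define K' where "K' = max 1 (q powi (k + Spre (Suc n) (wshf xs) - 1))"
  have "\<bar>wcoef (x # xs) i\<bar> \<le> K' * K" if i: "i \<in> B" "Spre (Suc n) i = k" for i
  proof (cases "wcoef xs i = 0")
    case False
    then have "i + wshf xs \<in> B" using wcoef_basis[OF i(1), of xs] Cons.prems by auto
    then have "\<bar>coef x (i + wshf xs)\<bar> \<le> K'"
      using coef_le[of "i + wshf xs" x] Cons.prems i(2) by (simp add: K'_def)
    then show ?thesis using K(2)[OF i] by (simp add: abs_mult mult_mono K'_def)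
  qed (use K in \<open>simp add: K'_def\<close>)
  then show ?case using K by (intro exI[of _ "K' * K"]) (auto simp: K'_def)
qed (intro exI[of _ 1], simp)

text \<open>Every word changes S_{n+1} by a fixed amount, so an indicator anywhere in it tests the
  initial index for a single value of S_{n+1}.\<close>

lemma wcoef_support:
  assumes "has_chi xs"
  shows "\<exists>k. \<forall>i. wcoef xs i \<noteq> 0 \<longrightarrow> Spre (Suc n) i = k"
  using assms
proof (induction xs)
  case (Cons x xs)
  show ?case
  proof (cases "has_chi xs")
    case True
    then show ?thesis using Cons by fastforce
  next
    case False
    then obtain k where x: "x = Chi k" using Cons.prems by (auto simp: has_chi_def)
    show ?thesis by (intro exI[of _ "k - Spre (Suc n) (wshf xs)"]) (auto simp: x)
  qed
qed (simp add: has_chi_def)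

lemma wcoef_chi_bound:
  assumes "set xs \<subseteq> coords N" "has_chi xs"
  shows "\<exists>K k. 0 \<le> K \<and> (\<forall>i\<in>B. \<bar>wcoef xs i\<bar> \<le> (if Spre (Suc n) i = k then K else 0))"
proof -
  obtain k where k: "\<And>i. wcoef xs i \<noteq> 0 \<Longrightarrow> Spre (Suc n) i = k" using wcoef_support[OF assms(2)] by blast
  obtain K where K: "0 \<le> K" "\<forall>i\<in>B. Spre (Suc n) i = k \<longrightarrow> \<bar>wcoef xs i\<bar> \<le> K"
    using wcoef_bound[OF assms(1), of k] by blast
  have "\<bar>wcoef xs i\<bar> \<le> (if Spre (Suc n) i = k then K else 0)" if "i \<in> B" for i
    using K(2) k[of i] that by (cases "wcoef xs i = 0") (use K(1) in simp_all)
  then show ?thesis using K(1) by blast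
qed

lemma lookup_bvec: "Poly_Mapping.lookup (bvec i) k = (if i = k then 1 else 0)"
  by (simp add: bvec_def lookup_single when_def)

section \<open>The trace as a functional on the free algebra\<close>

definition diag :: "coord falg \<Rightarrow> (nat \<Rightarrow> int) \<Rightarrow> complex" where
  "diag f i = Qv i * Poly_Mapping.lookup (T f (bvec i)) i"

definition conv :: "coord falg \<Rightarrow> bool" where
  "conv f \<longleftrightarrow> (\<lambda>i. norm (diag f i)) summable_on B"

definition L :: "coord falg \<Rightarrow> complex" where
  "L f = (\<Sum>\<^sub>\<infinity>i\<in>B. diag f i)"

lemma diag_eq: "Poly_Mapping.lookup ((T f \<circ> Q0 c q N) (bvec i)) i = diag f i"
  by (simp add: diag_def Q0_bvec T_cscalev)

lemma conv_eq: "trace_converges n N (T f \<circ> Q0 c q N) = conv f"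
  by (simp only: trace_converges_def conv_def diag_eq)

lemma L_eq: "Tr n N (T f \<circ> Q0 c q N) = L f"
  by (simp only: Tr_def L_def diag_eq)

lemma conv_summable: "conv f \<Longrightarrow> diag f summable_on B"
  unfolding conv_def by (rule abs_summable_summable)

lemma diag_add: "diag (f + g) i = diag f i + diag g i"
  by (simp add: diag_def T_add lookup_add distrib_left)

lemma diag_cscale: "diag (cscale a f) i = a * diag f i"
  by (simp add: diag_def T_cscale)

lemma conv_add:
  assumes "conv f" "conv g"
  shows "conv (f + g)" "L (f + g) = L f + L g"
proof -
  have "(\<lambda>i. norm (norm (diag f i) + norm (diag g i))) summable_on B"
    using summable_on_add[OF assms[unfolded conv_def]] by simp
  then show "conv (f + g)"
    unfolding conv_def diag_add
    by (rule Infinite_Sum.abs_summable_on_comparison_test) (simp add: norm_triangle_ineq)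
  show "L (f + g) = L f + L g"
    unfolding L_def diag_add using assms[THEN conv_summable] by (rule infsum_add)
qed

lemma conv_cscale: "conv f \<Longrightarrow> conv (cscale a f)"
  unfolding conv_def diag_cscale norm_mult by (rule summable_on_cmult_right)

lemma L_cscale: "L (cscale a f) = a * L f"
  unfolding L_def diag_cscale by (rule infsum_cmult_right')

lemma conv_0: "conv 0" "L 0 = 0"
  by (simp_all add: conv_def L_def diag_def)

lemma conv_linext:
  assumes "\<And>u. u \<in> Poly_Mapping.keys f \<Longrightarrow> conv (\<phi> u)"
  shows "conv (linext \<phi> f)"
    "L (linext \<phi> f) = (\<Sum>u\<in>Poly_Mapping.keys f. Poly_Mapping.lookup f u * L (\<phi> u))"
proof -
  have "conv (\<Sum>u\<in>A. cscale (Poly_Mapping.lookup f u) (\<phi> u)) \<and>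
    L (\<Sum>u\<in>A. cscale (Poly_Mapping.lookup f u) (\<phi> u)) = (\<Sum>u\<in>A. Poly_Mapping.lookup f u * L (\<phi> u))"
    if "A \<subseteq> Poly_Mapping.keys f" for A
    using finite_subset[OF that finite_keys] that
  proof (induction A rule: finite_induct)
    case (insert u A)
    then have "conv (cscale (Poly_Mapping.lookup f u) (\<phi> u))" using assms by (auto intro: conv_cscale)
    then show ?case using insert conv_add by (simp add: L_cscale)
  qed (simp add: conv_0)
  from this[OF order_refl] show "conv (linext \<phi> f)"
    "L (linext \<phi> f) = (\<Sum>u\<in>Poly_Mapping.keys f. Poly_Mapping.lookup f u * L (\<phi> u))"
    by (simp_all add: linext_def)
qed

lemma majorant_ge_Qv: "i \<in> B \<Longrightarrow> Spre (Suc n) i = k \<Longrightarrow> Qv i \<le> q powi k * majorant 2 k i"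
proof -
  assume i: "i \<in> B" "Spre (Suc n) i = k"
  then have "1 \<le> q powi (k - Spre 2 i)"
    using basis_Spre_ge[of i 2] nN by (intro qpow_ge_1) auto
  then have "Qv i * 1 \<le> Qv i * q powi (k - Spre 2 i)"
    using Qv_pos[of i] by (intro mult_left_mono) auto
  also have "\<dots> = q powi k * majorant 2 k i"
    using i by (simp add: majorant_def qpow_diff power_int_minus divide_inverse)
  finally show "Qv i \<le> q powi k * majorant 2 k i" by simp
qed

lemma conv_word:
  assumes "set xs \<subseteq> coords N" "has_chi xs"
  shows "conv (wsingle xs)"
proof -
  obtain K k where K: "0 \<le> K" and K2: "\<forall>i\<in>B. \<bar>wcoef xs i\<bar> \<le> (if Spre (Suc n) i = k then K else 0)"
    using wcoef_chi_bound[OF assms] by blast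
  have "norm (diag (wsingle xs) i) \<le> (K * q powi k) * majorant 2 k i" if i: "i \<in> B" for i
  proof -
    have "norm (diag (wsingle xs) i) \<le> Qv i * \<bar>wcoef xs i\<bar>"
      using Qv_pos[of i] by (simp add: diag_def T_word[OF assms(1)] lookup_bvec norm_mult)
    also have "\<dots> \<le> Qv i * (if Spre (Suc n) i = k then K else 0)"
      using bspec[OF K2 i] Qv_pos[of i] by (intro mult_left_mono) simp_all
    also have "\<dots> \<le> (K * q powi k) * majorant 2 k i"
    proof (cases "Spre (Suc n) i = k")
      case True
      then show ?thesis
        using mult_left_mono[OF majorant_ge_Qv[OF i True] K] by (simp add: mult.commute[of "Qv i"] mult.assoc)
    qed (simp add: majorant_def)
    finally show ?thesis .
  qed
  then show ?thesis
    \<comment> \<open>A word alone has bounded coefficients on its slice, so any p in the range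
      would serve; 2 is the smallest.\<close>
    unfolding conv_def using nN by (intro dominated_summable[of 2]) auto
qed

lemma conv_chi:
  assumes "f \<in> wspan (homog N True d)"
  shows "conv f"
proof -
  have "f = linext (\<lambda>u. Poly_Mapping.single u 1) f"
    by (rule clin_eqI) (auto intro: clinI)
  moreover have "conv (Poly_Mapping.single u 1)" if "u \<in> Poly_Mapping.keys f" for u
    using assms that conv_word[of "letters u"] by (auto simp: wspan_def homog_def)
  ultimately show ?thesis using conv_linext(1) by metis
qed

section \<open>Invariance of the trace\<close>

lemma diag_fstar: "f \<in> C \<Longrightarrow> diag (fstar f) i = cnj (diag f i)"
  by (simp add: diag_def T_adjoint)

lemma L_fstar: "f \<in> C \<Longrightarrow> L (fstar f) = cnj (L f)"
  by (simp add: L_def diag_fstar infsum_cnj)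

fun cnt :: "nat \<Rightarrow> coord \<Rightarrow> int" where
  "cnt k (CT l) = (if l = k then 1 else 0)"
| "cnt k (CTs l) = (if l = k then -1 else 0)"
| "cnt k (Chi r) = 0"

lemma wshf_cnt: "k < N \<Longrightarrow> wshf xs k = - (\<Sum>x\<leftarrow>xs. cnt k x)"
proof (induction xs)
  case (Cons x xs)
  then show ?case by (cases x) (simp_all add: plus_fun_apply zero_fun_apply dl_apply)
qed (simp add: zero_fun_apply)

lemma cdeg_cnt:
  assumes "set xs \<subseteq> coords N"
  shows "(\<Sum>x\<leftarrow>xs. cdeg x) = (\<Sum>k=1..N. \<Sum>x\<leftarrow>xs. cnt k x)"
  using assms
proof (induction xs)
  case (Cons x xs)
  have "cdeg x = (\<Sum>k=1..N. cnt k x)" using Cons.prems by (cases x) simp_all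
  then show ?case using Cons by (simp add: sum.distrib)
qed simp

lemma K_weight_cnt:
  "(\<Prod>x\<leftarrow>xs. K_weight q j x) = q powi ((\<Sum>x\<leftarrow>xs. cnt j x) - (\<Sum>x\<leftarrow>xs. cnt (Suc j) x))"
proof (induction xs)
  case (Cons x xs)
  have "K_weight q j x = q powi (cnt j x - cnt (Suc j) x)"
    by (cases x) (auto simp: power_int_minus divide_inverse)
  then show ?case
    using Cons by (simp add: qpow_add[symmetric] algebra_simps)
qed simp

text \<open>The shift determines the exponents of t_1, ..., t_{N-1} but not that of t_N. Degree zero
  supplies the latter, which matters when j = N - 1.\<close>

lemma K_weight_shift:
  assumes "homog N b 0 xs" "1 \<le> j" "j < N"
  shows "wshf xs = 0 \<Longrightarrow> (\<Prod>x\<leftarrow>xs. K_weight q j x) = 1"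
    "wshf xs = - tau j \<Longrightarrow> (\<Prod>x\<leftarrow>xs. K_weight q j x) = q powi (-2)"
proof -
  let ?c = "\<lambda>k. \<Sum>x\<leftarrow>xs. cnt k x"
  have "{1..N} = insert N {1..<N}" using nN by auto
  then have N: "?c N = - (\<Sum>k=1..<N. ?c k)"
    using assms cdeg_cnt[of xs] nN by (simp add: homog_def)
  have w: "?c k = - wshf xs k" if "k < N" for k using wshf_cnt[OF that] by simp
  {
    assume 0: "wshf xs = 0"
    then have z: "?c k = 0" if "k < N" for k using w[OF that] by (simp add: zero_fun_apply)
    then have "?c N = 0" unfolding N by simp
    then have "?c j = 0" "?c (Suc j) = 0"
      using z[of j] z[of "Suc j"] assms(2,3) by (cases "Suc j = N"; simp)+
    then show "(\<Prod>x\<leftarrow>xs. K_weight q j x) = 1" by (simp add: K_weight_cnt)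
  next
    assume t: "wshf xs = - tau j"
    have c: "?c k = (if k = Suc j then 1 else 0) - (if k = j then 1 else 0)" if "k < N" for k
      using w[OF that] that by (simp add: t tau_def plus_fun_apply dl_apply)
    have "?c (Suc j) = 1"
    proof (cases "Suc j = N")
      case True
      have "(\<Sum>k=1..<N. ?c k) = (\<Sum>k=1..<N. - (if k = j then 1 else 0))"
        using c True by (intro sum.cong) auto
      also have "\<dots> = -1" using assms by (simp add: sum_negf)
      finally show ?thesis using N True by simp
    next
      case False
      then show ?thesis using c[of "Suc j"] assms by simp
    qed
    then show "(\<Prod>x\<leftarrow>xs. K_weight q j x) = q powi (-2)"
      using c[OF assms(3)] by (simp add: K_weight_cnt)
  }
qed

text \<open>The exponent of Q_0 is twice the sum of all S_l, and \<tau>_j lowers exactly one of them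
  by 1. The weights N - j in Q_0 make this factor the same for every j.\<close>

lemma Qv_tau:
  assumes "1 \<le> j" "j < N"
  shows "Qv (i + tau j) = q powi (-2) * Qv i"
proof -
  have "(\<Sum>l=2..N. Spre l (i + tau j)) = (\<Sum>l=2..N. Spre l i + (if l = Suc j then -1 else 0))"
    using assms by (intro sum.cong) (auto simp: Spre_tau)
  also have "\<dots> = (\<Sum>l=2..N. Spre l i) - 1"
    using assms by (simp add: sum.distrib)
  finally have s: "(\<Sum>l=2..N. Spre l (i + tau j)) = (\<Sum>l=2..N. Spre l i) - 1" .
  have "2 * ((\<Sum>l=2..N. Spre l i) - 1) = - 2 + 2 * (\<Sum>l=2..N. Spre l i)" by simp
  then show ?thesis unfolding Qv_def s by (simp only: qpow_add mult_ac)
qed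

text \<open>Only words of weight opposite to \<open>E\<^sub>j\<close> contribute to the trace of \<open>E\<^sub>j w\<close>, and for these the
  diagonal matrix element is \<open>h i - h (i + \<tau>\<^sub>j)\<close>, where \<open>\<tau>\<^sub>j\<close> is the weight of \<open>X\<^sub>j\<close>.\<close>

lemma L_E_word:
  assumes "homog N True 0 xs" "1 \<le> j" "j < N"
  shows "L (E_word q n j xs) = 0"
proof -
  have xs: "set xs \<subseteq> coords N" and chi: "has_chi xs" using assms(1) by (auto simp: homog_def)
  define \<kappa> where "\<kappa> = (\<Prod>x\<leftarrow>xs. K_weight q j x)"
  \<comment> \<open>The diagonal entry of X_j T(w) Q_0 for the word w = xs, once w and X_j have
    opposite shifts.\<close>
  define h where "h i = Qv i * (wcoef xs i * xc j (i + wshf xs))" for i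
  have K: "K_word q j xs = cscale \<kappa> (wsingle xs)"
    by (simp add: K_word_def \<kappa>_def)
  have E: "T (E_word q n j xs) (bvec i) =
      cscale (wcoef xs i * xc j (i + wshf xs)) (bvec (i + wshf xs + tau j)) -
      cscale (\<kappa> * (xc j i * wcoef xs (i + tau j))) (bvec (i + tau j + wshf xs))" if "i \<in> B" for i
    using inner_word[OF xs _ assms(2,3), of "bvec i"] that
    by (simp add: H_bvec K T_cscale T_word[OF xs] clin_scale[OF clin_X] X_bvec T_cscalev mult.left_commute del: cscale_single)
  show ?thesis
  proof (cases "wshf xs = - tau j")
    case False
    have "i + wshf xs + tau j \<noteq> i" "i + tau j + wshf xs \<noteq> i" for i
    proof -
      have "wshf xs + tau j \<noteq> 0" using False by (metis eq_neg_iff_add_eq_0)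
      then show "i + wshf xs + tau j \<noteq> i" "i + tau j + wshf xs \<noteq> i"
        by (simp_all add: add.assoc add.commute[of "tau j"])
    qed
    then have "diag (E_word q n j xs) i = 0" if "i \<in> B" for i
      by (simp add: diag_def E[OF that] lookup_minus lookup_bvec)
    then show ?thesis unfolding L_def by (intro infsum_0)
  next
    case True
    have t: "i + wshf xs + tau j = i" "i + tau j + wshf xs = i" for i by (simp_all add: True add.assoc)
    have k: "\<kappa> = q powi (-2)" unfolding \<kappa>_def by (rule K_weight_shift(2)[OF assms True])
    have d: "diag (E_word q n j xs) i = of_real (h i) - of_real (h (i + tau j))" if "i \<in> B" for i
    proof -
      \<comment> \<open>The K-weight q^{-2} of the word equals the factor by which \<open>Qv\<close>
        changes along \<tau>_j; this match makes the second term a translate of the first.\<close>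
      have h: "h (i + tau j) = Qv i * (\<kappa> * (xc j i * wcoef xs (i + tau j)))"
        by (simp add: h_def t Qv_tau[OF assms(2,3)] k)
      have "diag (E_word q n j xs) i = of_real (Qv i * (wcoef xs i * xc j (i + wshf xs))) -
          of_real (Qv i * (\<kappa> * (xc j i * wcoef xs (i + tau j))))"
        unfolding diag_def E[OF that] t lookup_minus lookup_cscale lookup_bvec
        by (simp add: right_diff_distrib)
      then show ?thesis unfolding h unfolding h_def .
    qed
    \<comment> \<open>Translation by \<tau>_j does not map B onto itself, but h vanishes at the
      points where the translate leaves B.\<close>
    have h0: "h i = 0" if "i \<in> B" "i - tau j \<notin> B" for i
      using wcoef_basis[OF that(1) xs] that(2) by (auto simp: h_def True)
    have h1: "h (i + tau j) = 0" if "i \<in> B" "i + tau j \<notin> B" for i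
      using xc_basis[OF that(1) assms(2,3)] that(2) by (auto simp: h_def t)
    obtain K k where K: "0 \<le> K" and K2: "\<forall>i\<in>B. \<bar>wcoef xs i\<bar> \<le> (if Spre (Suc n) i = k then K else 0)"
      using wcoef_chi_bound[OF xs chi] by blast
    \<comment> \<open>The bound \<open>xc_le\<close> is applied at i - \<tau>_j, where S_{j+1} is
      larger by 1, whence \<open>inverse q\<close>, and S_{n+1} has the value k -
      S_{n+1}(\<tau>_j).\<close>
    define K' where "K' = K * (\<bar>alpha j\<bar> * q powi (k - Spre (Suc n) (tau j) - 1) * inverse q)"
    \<comment> \<open>The difference of the two sums may be split only if h itself is summable, and
      here the removed factor q^{S_{j+1}} of the majorant pays for X_j.\<close>
    have hb: "norm (complex_of_real (h i)) \<le> K' * majorant (Suc j) k i" if i: "i \<in> B" for i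
    proof (cases "i - tau j \<in> B \<and> Spre (Suc n) i = k")
      case True
      have "Spre (Suc j) (i - tau j) = Spre (Suc j) i + 1" using assms by (simp add: Spre_tau)
      then have "\<bar>xc j (i - tau j)\<bar> \<le> \<bar>alpha j\<bar> * q powi (k - Spre (Suc n) (tau j) - 1) * (inverse q * q powi (- Spre (Suc j) i))"
        using xc_le[of "i - tau j" j] True assms(2,3)
        by (simp add: qpow_diff power_int_minus divide_inverse mult.commute[of "inverse q"])
      then have "\<bar>wcoef xs i\<bar> * \<bar>xc j (i - tau j)\<bar> \<le>
        K * (\<bar>alpha j\<bar> * q powi (k - Spre (Suc n) (tau j) - 1) * (inverse q * q powi (- Spre (Suc j) i)))"
        using bspec[OF K2 i] True K by (intro mult_mono) auto
      then have "Qv i * (\<bar>wcoef xs i\<bar> * \<bar>xc j (i - tau j)\<bar>) \<le>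
        Qv i * (K * (\<bar>alpha j\<bar> * q powi (k - Spre (Suc n) (tau j) - 1) * (inverse q * q powi (- Spre (Suc j) i))))"
        using Qv_pos[of i] by (intro mult_left_mono) auto
      also have "\<dots> = K' * majorant (Suc j) k i" using True by (simp add: majorant_def K'_def)
      finally show ?thesis using Qv_pos[of i] \<open>wshf xs = - tau j\<close> by (simp add: h_def abs_mult norm_mult)
    next
      case False
      have "0 \<le> K'" using K q0 by (simp add: K'_def)
      then have "0 \<le> K' * majorant (Suc j) k i" using majorant_nonneg by simp
      moreover have "h i = 0" using False h0[OF i] bspec[OF K2 i] by (auto simp: h_def)
      ultimately show ?thesis by simp
    qed
    have hs: "(\<lambda>i. complex_of_real (h i)) summable_on B"
      by (rule abs_summable_summable, rule dominated_summable[OF _ hb]) (use assms in auto)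
    let ?g = "\<lambda>i. i + tau j"
    let ?B1 = "{i \<in> B. i + tau j \<in> B}"
    have inj: "inj_on ?g ?B1" by (intro inj_onI) simp
    have img: "?g ` ?B1 = {i \<in> B. i - tau j \<in> B}"
    proof (rule equalityI; rule subsetI)
      fix i assume "i \<in> {i \<in> B. i - tau j \<in> B}"
      then show "i \<in> ?g ` ?B1" by (intro image_eqI[of _ _ "i - tau j"]) simp_all
    qed auto
    have s1: "((\<lambda>i. complex_of_real (h i)) \<circ> ?g) summable_on ?B1"
      unfolding summable_on_reindex[OF inj, symmetric] img
      by (rule iffD1[OF summable_on_cong_neutral hs]) (use h0 in auto)
    have i1: "infsum ((\<lambda>i. complex_of_real (h i)) \<circ> ?g) ?B1 = infsum (\<lambda>i. complex_of_real (h i)) B"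
      unfolding infsum_reindex[OF inj, symmetric] img
      by (rule infsum_cong_neutral) (use h0 in auto)
    have s2: "(\<lambda>i. complex_of_real (h (i + tau j))) summable_on B"
      by (rule iffD1[OF summable_on_cong_neutral s1]) (use h1 in auto)
    have i2: "infsum (\<lambda>i. complex_of_real (h (i + tau j))) B = infsum (\<lambda>i. complex_of_real (h i)) B"
      unfolding i1[symmetric] by (rule infsum_cong_neutral) (use h1 in auto)
    have "L (E_word q n j xs) = infsum (\<lambda>i. complex_of_real (h i) - of_real (h (i + tau j))) B"
      unfolding L_def by (intro infsum_cong d)
    also have "\<dots> = infsum (\<lambda>i. complex_of_real (h i)) B - infsum (\<lambda>i. complex_of_real (h (i + tau j))) B"
      using infsum_add[OF hs summable_on_cmult_right[OF s2, of "-1"]]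
        infsum_cmult_right'[of "-1" "\<lambda>i. complex_of_real (h (i + tau j))" B] by simp
    finally show ?thesis unfolding i2 by simp
  qed
qed

lemma L_wsingle_zero:
  assumes "set xs \<subseteq> coords N" "wshf xs \<noteq> 0"
  shows "L (wsingle xs) = 0"
  unfolding L_def
proof (rule infsum_0)
  show "diag (wsingle xs) i = 0" for i
    using assms by (simp add: diag_def T_word lookup_bvec)
qed

lemma L_E:
  assumes "f \<in> wspan (homog N True 0)" "1 \<le> j" "j < N"
  shows "L (act_gen q n (UE j) f) = 0"
proof -
  have u: "homog N True 0 (letters u)" if "u \<in> Poly_Mapping.keys f" for u
    using assms(1) that by (simp add: wspan_def)
  have "conv (E_word q n j (letters u))" if "u \<in> Poly_Mapping.keys f" for u
    using homog_E_word[of "letters u" N j q n] u[OF that] assms(2,3)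
    by (intro conv_chi) (auto simp: homog_def)
  then show ?thesis
    using L_E_word[OF u assms(2,3)] by (simp add: conv_linext(2))
qed

text \<open>A word with nonzero shift has no diagonal entries, and one with zero shift and degree
  zero has K-weight 1.\<close>

lemma L_K:
  assumes "f \<in> wspan (homog N True 0)" "1 \<le> j" "j < N"
  shows "L (act_gen q n (UK j) f) = L f" "L (act_gen q n (UKinv j) f) = L f"
proof -
  have u: "homog N True 0 (letters u)" if "u \<in> Poly_Mapping.keys f" for u
    using assms(1) that by (simp add: wspan_def)
  then have cv: "conv (Poly_Mapping.single u 1)" if "u \<in> Poly_Mapping.keys f" for u
    using conv_word[of "letters u"] that by (auto simp: homog_def)
  have f: "f = linext (\<lambda>u. Poly_Mapping.single u 1) f"
    by (rule clin_eqI) (auto intro: clinI)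
  have w: "K_weight q j x \<noteq> 0" for x by (cases x) auto
  have K: "L (K_word q j (letters u)) = L (Poly_Mapping.single u 1) \<and> L (Kinv_word q j (letters u)) = L (Poly_Mapping.single u 1)"
    if "u \<in> Poly_Mapping.keys f" for u
  proof (cases "wshf (letters u) = 0")
    case True
    then have p: "(\<Prod>x\<leftarrow>letters u. K_weight q j x) = 1" by (rule K_weight_shift(1)[OF u[OF that] assms(2,3)])
    have "(\<Prod>x\<leftarrow>xs. 1 / K_weight q j x) = 1 / (\<Prod>x\<leftarrow>xs. K_weight q j x)" for xs
      by (induction xs) simp_all
    then show ?thesis using p by (simp add: K_word_def Kinv_word_def)
  next
    case False
    then have "L (wsingle (letters u)) = 0"
      using u[OF that] by (intro L_wsingle_zero) (auto simp: homog_def)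
    then show ?thesis
      by (simp add: K_word_def Kinv_word_def L_cscale del: cscale_single)
  qed
  have cvK: "conv (K_word q j (letters u))" "conv (Kinv_word q j (letters u))" if "u \<in> Poly_Mapping.keys f" for u
    using conv_cscale[OF cv[OF that]] by (simp_all add: K_word_def Kinv_word_def del: cscale_single)
  have "L f = (\<Sum>u\<in>Poly_Mapping.keys f. Poly_Mapping.lookup f u * L (Poly_Mapping.single u 1))"
    using conv_linext(2)[of f "\<lambda>u. Poly_Mapping.single u 1"] cv f by simp
  then show "L (act_gen q n (UK j) f) = L f" "L (act_gen q n (UKinv j) f) = L f"
    using K cvK by (simp_all add: conv_linext(2))
qed

lemma L_act_gen:
  assumes "f \<in> wspan (homog N True 0)" "u \<in> ugens N"
  shows "L (act_gen q n u f) = counit_gen u * L f"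
proof (cases u)
  case (UE j)
  then show ?thesis using L_E[OF assms(1)] assms(2) by (auto simp: ugens_def simp del: act_gen.simps)
next
  case (UF j)
  then have j: "1 \<le> j" "j < N" using assms(2) by (auto simp: ugens_def)
  have "fstar f \<in> wspan (homog N True 0)" using homog_fstar[OF assms(1)] by simp
  moreover have "act_gen q n (UE j) (fstar f) \<in> C"
    using carrier_act_gen[OF q0, of "fstar f" N "UE j" n] homog_carrier[OF assms(1)] j
    by (auto simp: ugens_def simp del: act_gen.simps)
  ultimately show ?thesis
    using L_E[OF _ j] unfolding UF act_gen_UF[OF q0] L_cscale by (simp add: L_fstar del: act_gen.simps)
next
  case (UK j)
  then show ?thesis using L_K[OF assms(1)] assms(2) by (auto simp: ugens_def simp del: act_gen.simps)
next
  case (UKinv j)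
  then show ?thesis using L_K(2)[OF assms(1)] assms(2) by (auto simp: ugens_def simp del: act_gen.simps)
qed

lemma act_free_frep: "act_free q n a f = frep (act_gen q n) a f"
  by (simp add: act_free_def frep_def)

lemma act_word_homog:
  "set us \<subseteq> ugens N \<Longrightarrow> f \<in> wspan (homog N True 0) \<Longrightarrow>
    foldr (act_gen q n) us f \<in> wspan (homog N True 0) \<and>
    L (foldr (act_gen q n) us f) = (\<Prod>u\<leftarrow>us. counit_gen u) * L f"
proof (induction us)
  case (Cons u us)
  then show ?case
    using homog_act_gen[OF q0, of "foldr (act_gen q n) us f"] L_act_gen[of "foldr (act_gen q n) us f" u]
    by (simp del: act_gen.simps)
qed simp

lemma L_act_free:
  assumes "a \<in> carrier (free_algebra (ugens N))" "f \<in> wspan (homog N True 0)"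
  shows "L (act_free q n a f) = counit_free a * L f" "conv (act_free q n a f)"
proof -
  have u: "set (letters u) \<subseteq> ugens N" if "u \<in> Poly_Mapping.keys a" for u
    using assms(1) that by (simp add: free_algebra_carrier wspan_def)
  have cv: "conv (foldr (act_gen q n) (letters u) f)" if "u \<in> Poly_Mapping.keys a" for u
    using act_word_homog[OF u[OF that] assms(2)] conv_chi by blast
  show "L (act_free q n a f) = counit_free a * L f"
    using act_word_homog[OF u assms(2)] cv
    by (simp add: act_free_def counit_free_def conv_linext(2) sum_distrib_right mult.assoc)
  show "conv (act_free q n a f)"
    unfolding act_free_def using cv by (rule conv_linext(1))
qed

lemma act_free_kern:
  assumes "a \<in> carrier (free_algebra (ugens N))" "f \<in> kern"
  shows "act_free q n a f \<in> kern"
proof -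
  have w: "foldr (act_gen q n) us f \<in> kern" if "set us \<subseteq> ugens N" for us
    using that by (induction us) (auto simp: assms(2) kern_act_gen simp del: act_gen.simps)
  have "(\<Sum>u\<in>A. cscale (Poly_Mapping.lookup a u) (foldr (act_gen q n) (letters u) f)) \<in> kern"
    if "A \<subseteq> Poly_Mapping.keys a" for A
    using finite_subset[OF that finite_keys] that
  proof (induction A rule: finite_induct)
    case (insert u A)
    then have "set (letters u) \<subseteq> ugens N" using assms(1) by (auto simp: free_algebra_carrier wspan_def)
    then show ?case using insert by (auto intro!: kern_add kern_cscale w)
  qed (simp add: kern_0)
  then show ?thesis unfolding act_free_def linext_def by simp
qed

lemma L_cong:
  assumes "f - g \<in> kern"
  shows "L f = L g" "conv f \<longleftrightarrow> conv g"
proof -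
  have "diag f i = diag g i" if "i \<in> B" for i
    using kern_H[OF assms, of "bvec i"] that by (simp add: diag_def H_bvec T_diff)
  then show "L f = L g" "conv f \<longleftrightarrow> conv g"
    unfolding L_def conv_def by (auto intro!: infsum_cong summable_on_cong)
qed

end

section \<open>Faithfulness of the representation on normally ordered elements\<close>

text \<open>Dedekind's argument for the linear independence of characters.\<close>

lemma eigenfunctions_independent:
  fixes \<phi> :: "'k \<Rightarrow> 'i \<Rightarrow> complex"
  assumes "finite A" "i0 \<in> \<Omega>" "\<And>K. \<phi> K i0 \<noteq> 0"
    and move: "\<And>r i. r \<in> R \<Longrightarrow> i \<in> \<Omega> \<Longrightarrow> m r i \<in> \<Omega>"
    and eig: "\<And>r i K. r \<in> R \<Longrightarrow> i \<in> \<Omega> \<Longrightarrow> \<phi> K (m r i) = lam r K * \<phi> K i"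
    and sep: "\<And>K K'. K \<in> A \<Longrightarrow> K' \<in> A \<Longrightarrow> K \<noteq> K' \<Longrightarrow> \<exists>r\<in>R. lam r K \<noteq> lam r K'"
    and zero: "\<And>i. i \<in> \<Omega> \<Longrightarrow> (\<Sum>K\<in>A. a K * \<phi> K i) = 0"
    and K: "K \<in> A"
  shows "a K = 0"
  using assms(1) sep zero K
proof (induction A arbitrary: a K rule: finite_psubset_induct)
  case (psubset A)
  show ?case
  proof (cases "A = {K}")
    case True
    then show ?thesis using psubset.prems(2)[OF assms(2)] assms(3) by simp
  next
    case False
    then obtain K' where K': "K' \<in> A" "K' \<noteq> K" using psubset.prems(3) by blast
    then obtain r where r: "r \<in> R" "lam r K \<noteq> lam r K'"
      using psubset.prems(1)[OF psubset.prems(3) K'(1)] by auto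
    \<comment> \<open>Subtract \<open>lam r K'\<close> times the relation from its transport along
      \<open>m r\<close>: the term of K' disappears, and a K only acquires a nonzero factor.\<close>
    define b where "b M = a M * (lam r M - lam r K')" for M
    have bz: "(\<Sum>M\<in>A - {K'}. b M * \<phi> M i) = 0" if i: "i \<in> \<Omega>" for i
    proof -
      have "(\<Sum>M\<in>A - {K'}. b M * \<phi> M i) = (\<Sum>M\<in>A. b M * \<phi> M i)"
        using psubset.hyps by (intro sum.mono_neutral_left) (auto simp: b_def)
      also have "\<dots> = (\<Sum>M\<in>A. a M * \<phi> M (m r i) - lam r K' * (a M * \<phi> M i))"
        by (intro sum.cong) (simp_all add: b_def eig[OF r(1) i] algebra_simps)
      also have "\<dots> = 0"
        using psubset.prems(2)[OF i] psubset.prems(2)[OF move[OF r(1) i]]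
        by (simp add: sum_subtractf sum_distrib_left[symmetric])
      finally show ?thesis .
    qed
    have "b K = 0"
    proof (rule psubset.IH[of "A - {K'}" b K])
      show "\<exists>r\<in>R. lam r M \<noteq> lam r M'" if "M \<in> A - {K'}" "M' \<in> A - {K'}" "M \<noteq> M'" for M M'
        using psubset.prems(1)[of M M'] that by blast
      show "K \<in> A - {K'}" using psubset.prems(3) K'(2) by blast
    qed (use K'(1) bz in blast)+
    then show ?thesis using r(2) by (simp add: b_def)
  qed
qed

context quantum_cone
begin

text \<open>Exponents outside the ranges that occur are set to 0; otherwise several indices would
  name the same element and a nonzero coefficient function could represent 0.\<close>

definition nf :: "((nat \<Rightarrow> nat) \<times> (nat \<Rightarrow> nat) \<times> (nat \<Rightarrow> nat) \<times> int) set" where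
  "nf = {(I, J, K, k). (\<forall>k. I k * J k = 0) \<and> (\<forall>k. k \<notin> {1..N} \<longrightarrow> I k = 0 \<and> J k = 0) \<and>
     (\<forall>k. k \<notin> {2..n} \<union> {n + 2..N} \<longrightarrow> K k = 0) \<and>
     (\<Sum>k=1..n. I k) + (\<Sum>k=Suc n..N. J k) = (\<Sum>k=1..n. J k) + (\<Sum>k=Suc n..N. I k)}"

fun Dn :: "(nat \<Rightarrow> nat) \<times> (nat \<Rightarrow> nat) \<times> (nat \<Rightarrow> nat) \<times> int \<Rightarrow> coord falg" where
  "Dn (I, J, K, k) = D_term q n N I J K (pt_ind q k)"

declare Dn.simps [simp del]

lemma fun_xi_pt_ind: "fun_xi q (pt_ind q k) = fgen (Chi k)"
proof -
  have "{l. pt_ind q k (q powi (2 * l)) \<noteq> 0} = {k}" by (auto simp: pt_ind_def qpow_eq_iff)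
  then show ?thesis by (simp add: fun_xi_def pt_ind_def)
qed

lemma D_term_cong:
  assumes "\<And>k. k \<in> {1..N} \<Longrightarrow> I k = I' k \<and> J k = J' k" "\<And>k. k \<in> {2..n} \<union> {n + 2..N} \<Longrightarrow> K k = K' k"
  shows "D_term q n N I J K g = D_term q n N I' J' K' g"
proof -
  have *: "map (\<lambda>k. gt k ^ I k) [1..<Suc n] = map (\<lambda>k. gt k ^ I' k) [1..<Suc n]"
    "map (\<lambda>k. gts k ^ I k) [Suc n..<Suc N] = map (\<lambda>k. gts k ^ I' k) [Suc n..<Suc N]"
    "map (\<lambda>k. xi n N k ^ K k) [2..<Suc n] = map (\<lambda>k. xi n N k ^ K' k) [2..<Suc n]"
    "map (\<lambda>k. xi n N k ^ K k) [n + 2..<Suc N] = map (\<lambda>k. xi n N k ^ K' k) [n + 2..<Suc N]"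
    "map (\<lambda>k. gt k ^ J k) (rev [Suc n..<Suc N]) = map (\<lambda>k. gt k ^ J' k) (rev [Suc n..<Suc N])"
    "map (\<lambda>k. gts k ^ J k) (rev [1..<Suc n]) = map (\<lambda>k. gts k ^ J' k) (rev [1..<Suc n])"
    using assms nN by (auto intro!: map_cong simp del: upt_Suc)
  show ?thesis unfolding D_term_def * ..
qed

lemma D_term_expand:
  "D_term q n N I J K g = (\<Sum>k | g (q powi (2 * k)) \<noteq> 0. cscale (g (q powi (2 * k))) (D_term q n N I J K (pt_ind q k)))"
  unfolding D_term_def fun_xi_pt_ind unfolding fun_xi_def
  by (simp only: sum_distrib_left sum_distrib_right cscale_mult_left cscale_mult_right)

abbreviation D_span :: "coord falg set" where
  "D_span \<equiv> pm.span {D_term q n N I J K g | I J K g.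
        (\<forall>k\<in>{1..N}. I k * J k = 0) \<and>
        (\<Sum>k=1..n. I k) + (\<Sum>k=Suc n..N. J k) = (\<Sum>k=1..n. J k) + (\<Sum>k=Suc n..N. I k) \<and>
        lattice_finite q g}"

lemma D_term_normal_form:
  assumes "\<forall>k\<in>{1..N}. I k * J k = 0"
    "(\<Sum>k=1..n. I k) + (\<Sum>k=Suc n..N. J k) = (\<Sum>k=1..n. J k) + (\<Sum>k=Suc n..N. I k)"
  shows "\<exists>a. Poly_Mapping.keys a \<subseteq> nf \<and> D_term q n N I J K g = linext Dn a"
proof -
  let ?r = "\<lambda>A (f :: nat \<Rightarrow> nat) k. if k \<in> A then f k else 0"
  let ?p = "\<lambda>k. (?r {1..N} I, ?r {1..N} J, ?r ({2..n} \<union> {n + 2..N}) K, k)"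
  have "(\<Sum>k=1..n. ?r {1..N} f k) = (\<Sum>k=1..n. f k)" "(\<Sum>k=Suc n..N. ?r {1..N} f k) = (\<Sum>k=Suc n..N. f k)" for f
    using nN by (intro sum.cong; simp)+
  then have nf: "?p k \<in> nf" for k using assms by (simp add: nf_def)
  have D: "D_term q n N I J K (pt_ind q k) = Dn (?p k)" for k
    unfolding Dn.simps by (intro D_term_cong) auto
  let ?a = "\<Sum>k | g (q powi (2 * k)) \<noteq> 0. Poly_Mapping.single (?p k) (g (q powi (2 * k)))"
  have "D_term q n N I J K g = linext Dn ?a"
    by (subst D_term_expand) (simp only: D clin_sum[OF clin_linext] linext_single)
  moreover have "Poly_Mapping.keys ?a \<subseteq> nf"
    using keys_sum[of "\<lambda>k. Poly_Mapping.single (?p k) (g (q powi (2 * k)))"] nf by force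
  ultimately show ?thesis by blast
qed

lemma D_span_normal_form:
  assumes "d \<in> D_span"
  shows "\<exists>a. Poly_Mapping.keys a \<subseteq> nf \<and> d = linext Dn a"
proof -
  have "pm.subspace {d. \<exists>a. Poly_Mapping.keys a \<subseteq> nf \<and> d = linext Dn a}"
  proof (rule pm.subspaceI)
    show "0 \<in> {d. \<exists>a. Poly_Mapping.keys a \<subseteq> nf \<and> d = linext Dn a}"
      by (auto intro: exI[of _ 0] simp: clin_zero[OF clin_linext])
  next
    fix x y assume "x \<in> {d. \<exists>a. Poly_Mapping.keys a \<subseteq> nf \<and> d = linext Dn a}"
      "y \<in> {d. \<exists>a. Poly_Mapping.keys a \<subseteq> nf \<and> d = linext Dn a}"
    then obtain a b where "Poly_Mapping.keys a \<subseteq> nf" "x = linext Dn a" "Poly_Mapping.keys b \<subseteq> nf" "y = linext Dn b"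
      by blast
    then show "x + y \<in> {d. \<exists>a. Poly_Mapping.keys a \<subseteq> nf \<and> d = linext Dn a}"
      using keys_add[of a b] by (auto intro!: exI[of _ "a + b"] simp: clin_add[OF clin_linext])
  next
    fix s x assume "x \<in> {d. \<exists>a. Poly_Mapping.keys a \<subseteq> nf \<and> d = linext Dn a}"
    then obtain a where "Poly_Mapping.keys a \<subseteq> nf" "x = linext Dn a" by blast
    then show "cscale s x \<in> {d. \<exists>a. Poly_Mapping.keys a \<subseteq> nf \<and> d = linext Dn a}"
      by (auto intro!: exI[of _ "cscale s a"] simp: clin_scale[OF clin_linext] in_keys_iff)
  qed
  moreover have "{D_term q n N I J K g | I J K g.
        (\<forall>k\<in>{1..N}. I k * J k = 0) \<and>
        (\<Sum>k=1..n. I k) + (\<Sum>k=Suc n..N. J k) = (\<Sum>k=1..n. J k) + (\<Sum>k=Suc n..N. I k) \<and>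
        lattice_finite q g} \<subseteq> {d. \<exists>a. Poly_Mapping.keys a \<subseteq> nf \<and> d = linext Dn a}"
    using D_term_normal_form by auto
  ultimately show ?thesis using pm.span_minimal assms by blast
qed

section \<open>Matrix coefficients of normally ordered elements\<close>

definition uw :: "(nat \<Rightarrow> nat) \<Rightarrow> coord list" where
  "uw I = concat (map (\<lambda>k. replicate (I k) (CT k)) [1..<Suc n]) @
     concat (map (\<lambda>k. replicate (I k) (CTs k)) [Suc n..<Suc N])"

lemma fgen_power: "fgen x ^ p = wsingle (replicate p x)"
  by (induction p) (simp_all add: wsingle_Nil fgen_mult_wsingle)

lemma prod_list_wsingle: "prod_list (map (\<lambda>k. wsingle (f k)) ks) = wsingle (concat (map f ks))"
  by (induction ks) (simp_all add: wsingle_Nil wsingle_mult)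

lemma wsingle_uw:
  "wsingle (uw I) = prod_list (map (\<lambda>k. gt k ^ I k) [1..<Suc n]) * prod_list (map (\<lambda>k. gts k ^ I k) [Suc n..<Suc N])"
  unfolding uw_def fgen_power prod_list_wsingle wsingle_mult ..

lemma fstar_prod_list: "fstar (prod_list fs) = prod_list (rev (map fstar fs))"
proof (induction fs)
  case Nil
  show ?case using fstar_single[of "[]" 1] by (simp add: wsingle_Nil)
qed (simp add: fstar_mult)

lemma fstar_power: "fstar (f ^ p) = fstar f ^ p"
proof (induction p)
  case 0
  show ?case using fstar_single[of "[]" 1] by (simp add: wsingle_Nil)
next
  case (Suc p)
  then show ?case by (simp add: fstar_mult power_commutes)
qed

definition mid :: "(nat \<Rightarrow> nat) \<Rightarrow> int \<Rightarrow> coord falg" where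
  "mid K k = prod_list (map (\<lambda>k. xi n N k ^ K k) [2..<Suc n]) * fgen (Chi k) *
     prod_list (map (\<lambda>k. xi n N k ^ K k) [n + 2..<Suc N])"

lemma Dn_factor: "Dn (I, J, K, k) = wsingle (uw I) * (mid K k * fstar (wsingle (uw J)))"
  unfolding Dn.simps D_term_def fun_xi_pt_ind mid_def wsingle_uw fstar_mult fstar_prod_list
  by (simp add: rev_map o_def fstar_power fstar_fgen mult.assoc del: upt_Suc)

lemma uw_coords: "set (uw I) \<subseteq> coords N"
  using nN n1 by (auto simp: uw_def simp del: upt_Suc)

lemma uw_cnt:
  assumes "1 \<le> k" "k \<le> N"
  shows "(\<Sum>x\<leftarrow>uw I. cnt k x) = (if k \<le> n then int (I k) else - int (I k))"
proof -
  have r: "sum_list (replicate p s) = int p * s" for p s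
    by (induction p) (simp_all add: algebra_simps)
  have c: "(\<Sum>x\<leftarrow>concat (map (\<lambda>l. replicate (I l) (t l)) ks). cnt k x) = (\<Sum>l\<leftarrow>ks. int (I l) * cnt k (t l))" for t ks
    by (induction ks) (simp_all add: r)
  have d: "(\<Sum>l\<leftarrow>ks. int (I l) * (if l = k then s else 0)) = (if k \<in> set ks then int (I k) * s else 0)"
    if "distinct ks" for ks s
    using that by (induction ks) auto
  show ?thesis
    using assms by (simp add: uw_def c d del: upt_Suc)
qed

lemma uw_shift:
  assumes "1 \<le> k" "k < N"
  shows "wshf (uw I) k = (if k \<le> n then - int (I k) else int (I k))"
  using wshf_cnt[OF assms(2)] uw_cnt[of k I] assms by simp

lemma qpow_less_1: "0 < a \<Longrightarrow> q powi a < 1"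
  using qpow_le_1[of a] qpow_eq_iff[of a 0] by simp

lemma qpow_gr_1: "a < 0 \<Longrightarrow> 1 < q powi a"
  using qpow_ge_1[of a] qpow_eq_iff[of a 0] by simp

text \<open>These letters move away from the walls of B, so they never meet a vanishing coefficient.
  They are exactly the letters of the left factor \<open>uw I\<close> of a normal form, whose right
  factor is the adjoint of \<open>uw J\<close>.\<close>

lemma inward_coef:
  assumes i: "i \<in> B" and x: "(\<exists>k. x = CT k \<and> 1 \<le> k \<and> k \<le> n) \<or> (\<exists>k. x = CTs k \<and> n < k \<and> k \<le> N)"
  shows "coef x i \<noteq> 0 \<and> i + shf x \<in> B"
proof -
  have "coef x i \<noteq> 0"
    using x
  proof (elim disjE exE conjE)
    fix k assume k: "x = CT k" "1 \<le> k" "k \<le> n"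
    have "1 < q powi (2 * (i k - 1))" if "k \<noteq> 1"
      using basisD(1)[OF i, of k] k that by (intro qpow_gr_1) auto
    then show ?thesis using k by (auto simp: rho_def)
  next
    fix k assume k: "x = CTs k" "n < k" "k \<le> N"
    have "q powi (2 * i k) < 1" if "k < N"
      using basisD(2)[OF i, of k] k that by (intro qpow_less_1) auto
    then show ?thesis using k n1 by (auto simp: rho_def)
  qed
  moreover have "x \<in> coords N" using x nN n1 by auto
  ultimately show ?thesis using basis_shift[OF i] by blast
qed

lemma uw_coef:
  assumes "i \<in> B"
  shows "wcoef (uw I) i \<noteq> 0" "i + wshf (uw I) \<in> B"
proof -
  have "\<forall>x\<in>set xs. (\<exists>k. x = CT k \<and> 1 \<le> k \<and> k \<le> n) \<or> (\<exists>k. x = CTs k \<and> n < k \<and> k \<le> N) \<Longrightarrow>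
    wcoef xs i \<noteq> 0 \<and> i + wshf xs \<in> B" for xs
  proof (induction xs)
    case Nil
    then show ?case using assms by simp
  next
    case (Cons x xs)
    then have IH: "wcoef xs i \<noteq> 0" "i + wshf xs \<in> B" by auto
    show ?case using inward_coef[OF IH(2), of x] Cons.prems IH by (simp add: add.assoc[symmetric])
  qed
  moreover have "\<forall>x\<in>set (uw I). (\<exists>k. x = CT k \<and> 1 \<le> k \<and> k \<le> n) \<or> (\<exists>k. x = CTs k \<and> n < k \<and> k \<le> N)"
    by (auto simp: uw_def simp del: upt_Suc)
  ultimately show "wcoef (uw I) i \<noteq> 0" "i + wshf (uw I) \<in> B" by blast+
qed

text \<open>The joint eigenvalue of the powers of \<xi>_l. It is multiplicative under translation of
  i, as Dedekind's argument requires; l = n + 1 is absent since the indicator already fixes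
  S_{n+1}.\<close>

definition chr :: "(nat \<Rightarrow> nat) \<Rightarrow> (nat \<Rightarrow> int) \<Rightarrow> real" where
  "chr K i = q powi (2 * (\<Sum>l\<in>{2..n} \<union> {n + 2..N}. Spre l i * int (K l)))"

lemma T_diag_power: "T f (bvec i) = cscale a (bvec i) \<Longrightarrow> T (f ^ p) (bvec i) = cscale (a ^ p) (bvec i)"
  by (induction p) (simp_all add: T_mult T_cscalev mult.commute)

lemma T_xi_prod:
  assumes "i \<in> B" "set ks \<subseteq> {2..N}"
  shows "T (prod_list (map (\<lambda>k. xi n N k ^ K k) ks)) (bvec i) =
    cscale (q powi (2 * (\<Sum>l\<leftarrow>ks. Spre l i * int (K l)))) (bvec i)"
  using assms(2)
proof (induction ks)
  case (Cons k ks)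
  have "T (xi n N k) (bvec i) = cscale (of_real (q powi (2 * Spre k i))) (bvec i)"
    using T_xi[OF assms(1), of k] Cons.prems by (auto simp: xiv_def)
  from T_diag_power[OF this, of "K k"]
  have "T (xi n N k ^ K k) (bvec i) = cscale (of_real ((q powi (2 * Spre k i)) ^ K k)) (bvec i)"
    unfolding of_real_power .
  also have "(q powi (2 * Spre k i)) ^ K k = q powi (2 * (Spre k i * int (K k)))"
    by (simp only: mult.assoc[symmetric] power_int_mult power_int_of_nat)
  finally have "T (xi n N k ^ K k) (bvec i) = cscale (of_real (q powi (2 * (Spre k i * int (K k))))) (bvec i)" .
  then show ?case
    using Cons by (simp add: T_mult T_cscalev qpow_add distrib_left mult.commute)
qed simp

lemma T_mid:
  assumes "i \<in> B"
  shows "T (mid K k) (bvec i) = cscale (if Spre (Suc n) i = k then chr K i else 0) (bvec i)"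
proof -
  have "(\<Sum>l\<in>{2..n} \<union> {n + 2..N}. Spre l i * int (K l)) =
      (\<Sum>l\<in>{2..n}. Spre l i * int (K l)) + (\<Sum>l\<in>{n + 2..N}. Spre l i * int (K l))"
    by (intro sum.union_disjoint) auto
  then have e: "(\<Sum>l\<in>{2..n} \<union> {n + 2..N}. Spre l i * int (K l)) =
      (\<Sum>l\<leftarrow>[2..<Suc n]. Spre l i * int (K l)) + (\<Sum>l\<leftarrow>[n + 2..<Suc N]. Spre l i * int (K l))"
    by (simp add: interv_sum_list_conv_sum_set_nat atLeastLessThanSuc_atLeastAtMost del: upt_Suc)
  have s: "set [2..<Suc n] \<subseteq> {2..N}" "set [n + 2..<Suc N] \<subseteq> {2..N}" using nN by auto
  show ?thesis
    unfolding mid_def T_mult T_xi_prod[OF assms s(2)] T_cscalev T_fgen[OF coords_iff(3)] chr_def e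
    by (auto simp: T_cscalev T_xi_prod[OF assms s(1)] qpow_add distrib_left mult.commute simp del: upt_Suc)
qed

text \<open>Starting from i + \<open>wshf (uw J)\<close>, the right factor returns to i with the
  nonzero coefficient of \<open>uw J\<close>, so the coefficient is a nonzero number times the
  character and the indicator at i.\<close>

lemma T_Dn:
  assumes "i \<in> B"
  shows "T (Dn (I, J, K, k)) (bvec (i + wshf (uw J))) =
    cscale (wcoef (uw J) i * (if Spre (Suc n) i = k then chr K i else 0) * wcoef (uw I) i) (bvec (i + wshf (uw I)))"
proof -
  let ?ys = "rev (map coord_star (uw J))"
  have "coord_star x \<in> coords N \<longleftrightarrow> x \<in> coords N" for x by (cases x) simp_all
  then have ys: "set ?ys \<subseteq> coords N" using uw_coords[of J] by auto
  have s: "fstar (wsingle (uw J)) = wsingle ?ys" by (simp add: fstar_single)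
  have w: "i + wshf (uw J) + wshf ?ys = i" by (simp add: wshf_star add.assoc)
  show ?thesis
    unfolding Dn_factor T_mult s T_word[OF ys] w T_cscalev T_mid[OF assms] T_word[OF uw_coords] wcoef_star[OF uw_coords]
    by (simp add: mult.assoc)
qed

lemma T_Dn_shift:
  assumes "i \<in> B"
  shows "\<exists>A. T (Dn (I, J, K, k)) (bvec i) = cscale A (bvec (i - wshf (uw J) + wshf (uw I)))"
proof -
  let ?ys = "rev (map coord_star (uw J))"
  have "coord_star x \<in> coords N \<longleftrightarrow> x \<in> coords N" for x by (cases x) simp_all
  then have ys: "set ?ys \<subseteq> coords N" using uw_coords[of J] by auto
  have s: "fstar (wsingle (uw J)) = wsingle ?ys" by (simp add: fstar_single)
  have w: "i + wshf ?ys = i - wshf (uw J)" by (simp add: wshf_star)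
  show ?thesis
  proof (cases "wcoef ?ys i = 0")
    case True
    then show ?thesis
      unfolding Dn_factor T_mult s T_word[OF ys] by (intro exI[of _ 0]) simp
  next
    case False
    then have "i - wshf (uw J) \<in> B" using wcoef_basis[OF assms ys] w by auto
    then obtain A where "T (mid K k) (bvec (i - wshf (uw J))) = cscale A (bvec (i - wshf (uw J)))"
      using T_mid by blast
    then show ?thesis
      unfolding Dn_factor T_mult s T_word[OF ys] w T_cscalev by (simp add: T_cscalev T_word[OF uw_coords]) blast
  qed
qed

text \<open>The shift gives I_k - J_k for k < N and the balance condition gives it for k = N; since
  I_k J_k = 0, the difference determines both exponents.\<close>

lemma nf_shift_inj:
  assumes "(I, J, K, k) \<in> nf" "(I', J', K', k') \<in> nf"
    and e: "wshf (uw I) - wshf (uw J) = wshf (uw I') - wshf (uw J')"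
  shows "I = I' \<and> J = J'"
proof -
  have pt: "a = a' \<and> b = b'" if "a * b = 0" "a' * b' = 0" "int a - int b = int a' - int b'" for a b a' b' :: nat
    using that by auto
  have z: "I k * J k = 0" "I' k * J' k = 0" for k using assms(1,2) by (auto simp: nf_def)
  have o: "I k = 0 \<and> J k = 0 \<and> I' k = 0 \<and> J' k = 0" if "k \<notin> {1..N}" for k
    using assms(1,2) that by (auto simp: nf_def)
  have l: "I k = I' k \<and> J k = J' k" if "1 \<le> k" "k < N" for k
  proof (rule pt[OF z])
    have "wshf (uw I) k - wshf (uw J) k = wshf (uw I') k - wshf (uw J') k"
      using fun_cong[OF e, of k] by simp
    then show "int (I k) - int (J k) = int (I' k) - int (J' k)"
      using that by (auto simp: uw_shift split: if_splits)
  qed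
  have "{Suc n..N} = insert N {Suc n..<N}" using nN by auto
  then have s: "(\<Sum>k=Suc n..N. f k) = f N + (\<Sum>k=Suc n..<N. f k)" for f :: "nat \<Rightarrow> nat" by simp
  have l1: "(\<Sum>k=1..n. I k) = (\<Sum>k=1..n. I' k)" "(\<Sum>k=1..n. J k) = (\<Sum>k=1..n. J' k)"
    "(\<Sum>k=Suc n..<N. I k) = (\<Sum>k=Suc n..<N. I' k)" "(\<Sum>k=Suc n..<N. J k) = (\<Sum>k=Suc n..<N. J' k)"
    using l nN by (intro sum.cong; simp)+
  have "(\<Sum>k=1..n. I k) + (J N + (\<Sum>k=Suc n..<N. J k)) = (\<Sum>k=1..n. J k) + (I N + (\<Sum>k=Suc n..<N. I k))"
    "(\<Sum>k=1..n. I' k) + (J' N + (\<Sum>k=Suc n..<N. J' k)) = (\<Sum>k=1..n. J' k) + (I' N + (\<Sum>k=Suc n..<N. I' k))"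
    using assms(1,2) unfolding nf_def s by auto
  then have "int (I N) - int (J N) = int (I' N) - int (J' N)" unfolding l1 by linarith
  then have N: "I N = I' N \<and> J N = J' N" by (rule pt[OF z])
  have "I k = I' k \<and> J k = J' k" for k
    using l[of k] N o[of k] by (cases "k < N"; cases "k = N"; cases "k = 0") auto
  then show ?thesis by blast
qed

lemma chr_independent:
  assumes "finite A" "\<And>K l. K \<in> A \<Longrightarrow> l \<notin> {2..n} \<union> {n + 2..N} \<Longrightarrow> K l = 0"
    and "\<And>i. i \<in> B \<Longrightarrow> Spre (Suc n) i = k \<Longrightarrow> (\<Sum>K\<in>A. a K * complex_of_real (chr K i)) = 0"
    and "K \<in> A"
  shows "a K = 0"
proof -
  define \<Omega> where "\<Omega> = {i \<in> B. Spre (Suc n) i = k}"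
  define R where "R = {2..n} \<union> {Suc n..<N}"
  \<comment> \<open>Translations inside the slice: for r \<le> n, moving a unit from i_r to i_1
    raises S_2, ..., S_r; for r > n, raising i_r raises S_{r+1}, ..., S_N. Neither changes
    S_{n+1}.\<close>
  define v where "v r = (if r \<le> n then dl 1 - dl r else dl r)" for r
  let ?L = "{2..n} \<union> {n + 2..N}"
  define ex where "ex r K = (\<Sum>l\<in>?L. Spre l (v r) * int (K l))" for r K
  \<comment> \<open>A base point of the slice: i_1 carries the whole of S_{n+1} = k, and the other
    coordinates are at the walls.\<close>
  define i0 where "i0 l = (if l = 1 then k else if n < l \<and> l < N then 1 else 0)" for l :: nat
  have i0: "i0 \<in> \<Omega>"
  proof -
    have "Spre (Suc n) i0 = (\<Sum>l\<in>{1..<Suc n}. if l = 1 then k else 0)"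
      unfolding Spre_def by (intro sum.cong) (auto simp: i0_def)
    then have "Spre (Suc n) i0 = k" using n1 by simp
    moreover have "i0 \<in> B" using nN n1 by (intro basisI) (auto simp: i0_def)
    ultimately show ?thesis by (simp add: \<Omega>_def)
  qed
  have Sv: "Spre l (v r) = (if r \<le> n then if l \<le> r then 1 else 0 else if r < l then 1 else 0)"
    if "r \<in> R" "l \<in> {2..N}" for r l
    using that nN n1 by (auto simp: v_def R_def)
  have ex_lo: "ex r K = (\<Sum>l=2..r. int (K l))" if "r \<in> {2..n}" for r K
  proof -
    have "ex r K = (\<Sum>l\<in>?L. if l \<in> {2..r} then int (K l) else 0)"
      unfolding ex_def using that nN by (intro sum.cong refl) (auto simp: Sv R_def)
    also have "\<dots> = (\<Sum>l\<in>{2..r}. int (K l))"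
      using that by (subst sum.inter_restrict[symmetric]) (auto intro!: sum.cong)
    finally show ?thesis .
  qed
  have ex_hi: "ex r K = (\<Sum>l=Suc r..N. int (K l))" if "r \<in> {Suc n..<N}" for r K
  proof -
    have "ex r K = (\<Sum>l\<in>?L. if l \<in> {Suc r..N} then int (K l) else 0)"
      unfolding ex_def using that nN by (intro sum.cong refl) (auto simp: Sv R_def)
    also have "\<dots> = (\<Sum>l\<in>{Suc r..N}. int (K l))"
      using that by (subst sum.inter_restrict[symmetric]) (auto intro!: sum.cong)
    finally show ?thesis .
  qed
  show ?thesis
  proof (rule eigenfunctions_independent[where a = a and K = K and \<Omega> = \<Omega> and \<phi> = "\<lambda>K i. complex_of_real (chr K i)"
        and R = R and m = "\<lambda>r i. i + v r" and lam = "\<lambda>r K. complex_of_real (q powi (2 * ex r K))", OF assms(1) i0])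
    show "complex_of_real (chr K i0) \<noteq> 0" for K by (simp add: chr_def)
    fix r i assume r: "r \<in> R" and i: "i \<in> \<Omega>"
    have "i + v r \<in> B"
    proof (rule basisI)
      have iB: "i \<in> B" using i by (simp add: \<Omega>_def)
      have v: "(i + v r) l = i l + (if l = 1 \<and> r \<le> n then 1 else 0) + (if l = r then if r \<le> n then -1 else 1 else 0)" for l
        using r nN by (auto simp: v_def R_def plus_fun_apply dl_apply)
      show "(i + v r) l \<le> 0" if "2 \<le> l" "l \<le> n" for l
        using basisD(1)[OF iB that] that r by (auto simp: v R_def)
      show "1 \<le> (i + v r) l" if "n < l" "l < N" for l
        using basisD(2)[OF iB that] that r n1 by (auto simp: v R_def)
      show "(i + v r) l = 0" if "l = 0 \<or> N \<le> l" for l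
        using basisD(3)[OF iB that] that r nN by (auto simp: v R_def)
    qed
    moreover have "Spre (Suc n) (v r) = 0"
      using Sv[OF r, of "Suc n"] r n1 nN by (auto simp: R_def)
    ultimately show "i + v r \<in> \<Omega>" using i by (simp add: \<Omega>_def)
    show "complex_of_real (chr K (i + v r)) = complex_of_real (q powi (2 * ex r K)) * complex_of_real (chr K i)" for K
    proof -
      have "2 * (\<Sum>l\<in>?L. Spre l (i + v r) * int (K l)) = 2 * ex r K + 2 * (\<Sum>l\<in>?L. Spre l i * int (K l))"
        by (simp add: ex_def sum.distrib distrib_right)
      then have "chr K (i + v r) = q powi (2 * ex r K) * chr K i"
        unfolding chr_def by (simp only: qpow_add)
      then show ?thesis by simp
    qed
  next
    fix K K' assume K: "K \<in> A" "K' \<in> A" "K \<noteq> K'"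
    show "\<exists>r\<in>R. complex_of_real (q powi (2 * ex r K)) \<noteq> complex_of_real (q powi (2 * ex r K'))"
    proof (rule ccontr)
      assume "\<not> ?thesis"
      then have "\<forall>r\<in>R. complex_of_real (q powi (2 * ex r K)) = complex_of_real (q powi (2 * ex r K'))"
        by blast
      then have e: "ex r K = ex r K'" if "r \<in> R" for r
        using that unfolding of_real_eq_iff qpow_eq_iff by simp
      \<comment> \<open>The eigenvalues give the sums of K over {2..r} and over {r+1..N}; their
        consecutive differences recover each K_l.\<close>
      have "K l = K' l" for l
      proof -
        consider "l \<in> {2..n}" | "l \<in> {n + 2..N}" | "l \<notin> ?L" by blast
        then show ?thesis
        proof cases
          case 1
          have p: "(\<Sum>l=2..r. int (K l)) = (\<Sum>l=2..r. int (K' l))" if "r \<le> n" for r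
            using e[of r] ex_lo[of r] that by (cases "2 \<le> r") (auto simp: R_def)
          have "(\<Sum>l=2..l. f l) = (\<Sum>l=2..l - 1. f l) + f l" for f :: "nat \<Rightarrow> int"
            using 1 by (cases l) auto
          then show ?thesis using p[of l] p[of "l - 1"] 1 by auto
        next
          case 2
          have p: "(\<Sum>l=Suc r..N. int (K l)) = (\<Sum>l=Suc r..N. int (K' l))" if "n < r" for r
            using e[of r] ex_hi[of r] that by (cases "r < N") (auto simp: R_def)
          have "(\<Sum>l=l..N. f l) = f l + (\<Sum>l=Suc l..N. f l)" for f :: "nat \<Rightarrow> int"
            using 2 by (intro sum.atLeast_Suc_atMost) auto
          then show ?thesis using p[of l] p[of "l - 1"] 2 by auto
        next
          case 3
          then show ?thesis using assms(2)[OF K(1)] assms(2)[OF K(2)] by simp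
        qed
      qed
      then show False using K(3) by blast
    qed
  next
    show "(\<Sum>K\<in>A. a K * complex_of_real (chr K i)) = 0" if "i \<in> \<Omega>" for i
      using assms(3) that by (simp add: \<Omega>_def)
  qed (rule assms(4))
qed

lemma T_faithful:
  assumes a: "Poly_Mapping.keys a \<subseteq> nf" and z: "\<And>i. i \<in> B \<Longrightarrow> T (linext Dn a) (bvec i) = 0"
  shows "a = 0"
proof (rule poly_mapping_eqI)
  fix p :: "(nat \<Rightarrow> nat) \<times> (nat \<Rightarrow> nat) \<times> (nat \<Rightarrow> nat) \<times> int"
  obtain I J K k where p: "p = (I, J, K, k)" by (cases p)
  show "Poly_Mapping.lookup a p = Poly_Mapping.lookup 0 p"
  proof (cases "p \<in> Poly_Mapping.keys a")
    case True
    let ?A = "{M. (I, J, M, k) \<in> Poly_Mapping.keys a}"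
    have inj: "inj_on (\<lambda>M. (I, J, M, k)) ?A" by (intro inj_onI) simp
    have "finite ((\<lambda>M. (I, J, M, k)) ` ?A)" by (rule finite_subset[of _ "Poly_Mapping.keys a"]) auto
    then have fin: "finite ?A" using inj by (rule finite_imageD)
    have "Poly_Mapping.lookup a (I, J, K, k) = 0"
    proof (rule chr_independent[OF fin, where a = "\<lambda>M. Poly_Mapping.lookup a (I, J, M, k)" and k = k])
      show "M l = 0" if "M \<in> ?A" "l \<notin> {2..n} \<union> {n + 2..N}" for M l
        using a that by (auto simp: nf_def)
      show "K \<in> ?A" using True p by simp
      fix i assume i: "i \<in> B" "Spre (Suc n) i = k"
      \<comment> \<open>Between these two indices only terms with the given I and J contribute, and
        S_{n+1} = k selects the indicator, leaving a combination of characters in K.\<close>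
      let ?s = "i + wshf (uw J)" and ?t = "i + wshf (uw I)"
      let ?w = "complex_of_real (wcoef (uw J) i * wcoef (uw I) i)"
      let ?g = "\<lambda>u. Poly_Mapping.lookup a u * Poly_Mapping.lookup (T (Dn u) (bvec ?s)) ?t"
      have s: "?s \<in> B" by (rule uw_coef(2)[OF i(1)])
      have "T (linext Dn a) (bvec ?s) = (\<Sum>u\<in>Poly_Mapping.keys a. cscale (Poly_Mapping.lookup a u) (T (Dn u) (bvec ?s)))"
        by (simp add: linext_def T_sum T_cscale)
      then have "0 = (\<Sum>u\<in>Poly_Mapping.keys a. ?g u)"
        using z[OF s] by (simp add: lookup_sum[symmetric] flip: lookup_cscale)
      also have "\<dots> = (\<Sum>u\<in>(\<lambda>M. (I, J, M, k)) ` ?A. ?g u)"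
      proof (intro sum.mono_neutral_right ballI)
        fix u assume u: "u \<in> Poly_Mapping.keys a - (\<lambda>M. (I, J, M, k)) ` ?A"
        obtain I' J' K' k' where u': "u = (I', J', K', k')" by (cases u)
        show "?g u = 0"
        proof (cases "I' = I \<and> J' = J")
          case True
          then have "k' \<noteq> k" using u u' by auto
          then show ?thesis using True i by (simp add: u' T_Dn)
        next
          case False
          obtain A where A: "T (Dn u) (bvec ?s) = cscale A (bvec (?s - wshf (uw J') + wshf (uw I')))"
            using T_Dn_shift[OF s] u' by blast
          have "?s - wshf (uw J') + wshf (uw I') \<noteq> ?t"
          proof
            assume "?s - wshf (uw J') + wshf (uw I') = ?t"
            then have "wshf (uw I') - wshf (uw J') = wshf (uw I) - wshf (uw J)"
              by (simp add: algebra_simps)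
            moreover have "(I', J', K', k') \<in> nf" using a u u' by blast
            moreover have "(I, J, K, k) \<in> nf" using a \<open>p \<in> Poly_Mapping.keys a\<close> p by blast
            ultimately have "I' = I \<and> J' = J" by (intro nf_shift_inj)
            then show False using False by blast
          qed
          then show ?thesis by (simp add: A lookup_bvec)
        qed
      qed auto
      also have "\<dots> = (\<Sum>M\<in>?A. Poly_Mapping.lookup a (I, J, M, k) * complex_of_real (chr M i)) * ?w"
        unfolding sum.reindex[OF inj] sum_distrib_right using i
        by (intro sum.cong) (simp_all add: T_Dn lookup_bvec)
      finally show "(\<Sum>M\<in>?A. Poly_Mapping.lookup a (I, J, M, k) * complex_of_real (chr M i)) = 0"
        using uw_coef(1)[OF i(1)] by simp
    qed
    then show ?thesis by (simp add: p)
  qed (simp add: in_keys_iff)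
qed

lemma D_span_faithful:
  assumes "d \<in> D_span" "\<And>i. i \<in> B \<Longrightarrow> T d (bvec i) = 0"
  shows "d = 0"
  using D_span_normal_form[OF assms(1)] T_faithful assms(2) by (metis clin_linext clin_zero)

section \<open>The invariant integral\<close>

text \<open>The condition on the sums of I and J says precisely that the degree is zero.\<close>

lemma homog_balanced:
  assumes "(I, J, K, k) \<in> nf"
  shows "Dn (I, J, K, k) \<in> wspan (homog N True 0)"
proof -
  let ?dl = "\<Sum>k\<leftarrow>[1..<Suc n]. int (I k)" and ?dh = "\<Sum>k\<leftarrow>[Suc n..<Suc N]. - int (I k)"
  let ?el = "\<Sum>k\<leftarrow>rev [Suc n..<Suc N]. int (J k)" and ?eh = "\<Sum>k\<leftarrow>rev [1..<Suc n]. - int (J k)"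
  have s: "(\<Sum>k\<leftarrow>[a..<Suc b]. f k) = (\<Sum>k=a..b. f k)" for f :: "nat \<Rightarrow> int" and a b
    by (simp add: interv_sum_list_conv_sum_set_nat atLeastLessThanSuc_atLeastAtMost del: upt_Suc)
  have r: "(\<Sum>k\<leftarrow>rev ks. f k) = (\<Sum>k\<leftarrow>ks. f k)" for f :: "nat \<Rightarrow> int" and ks
    by (induction ks) simp_all
  have "int ((\<Sum>k=1..n. I k) + (\<Sum>k=Suc n..N. J k)) = int ((\<Sum>k=1..n. J k) + (\<Sum>k=Suc n..N. I k))"
    using assms by (simp add: nf_def)
  then have deg: "?dl + ?dh + 0 + ?el + ?eh = 0"
    unfolding r s by (simp add: sum_negf)
  have xi: "prod_list (map (\<lambda>k. xi n N k ^ K k) ks) \<in> wspan (homog N False 0)" if "set ks \<subseteq> {1..N}" for ks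
    using homog_prod_list[of ks "\<lambda>k. xi n N k ^ K k" N "\<lambda>_. 0"] homog_power[OF homog_xi[of _ n N], of _ "K _"] that nN
    by (simp add: subset_iff)
  have gp: "gt k ^ p \<in> wspan (homog N False (int p))" "gts k ^ p \<in> wspan (homog N False (- int p))" if "k \<in> {1..N}" for k p
    using homog_power[OF homog_gt[OF that]] homog_power[OF homog_gts[OF that]] by simp_all
  have A: "prod_list (map (\<lambda>k. gt k ^ I k) [1..<Suc n]) \<in> wspan (homog N False ?dl)"
    "prod_list (map (\<lambda>k. gts k ^ I k) [Suc n..<Suc N]) \<in> wspan (homog N False ?dh)"
    "prod_list (map (\<lambda>k. gt k ^ J k) (rev [Suc n..<Suc N])) \<in> wspan (homog N False ?el)"
    "prod_list (map (\<lambda>k. gts k ^ J k) (rev [1..<Suc n])) \<in> wspan (homog N False ?eh)"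
    using nN by (intro homog_prod_list gp; auto simp del: upt_Suc)+
  have M: "prod_list (map (\<lambda>k. xi n N k ^ K k) [2..<Suc n]) * fun_xi q (pt_ind q k) *
      prod_list (map (\<lambda>k. xi n N k ^ K k) [n + 2..<Suc N]) \<in> wspan (homog N True 0)"
    using nN by (intro homog_mult[OF homog_mult[OF xi homog_fun_xi] xi]) (auto simp del: upt_Suc)
  show ?thesis
    unfolding Dn.simps D_term_def
    by (rule homog_mult[OF homog_mult[OF homog_mult[OF homog_mult[OF A(1) A(2)] M] A(3)] A(4)]) (use deg in auto)
qed

lemma D_span_homog:
  assumes "d \<in> D_span" shows "d \<in> wspan (homog N True 0)"
proof -
  obtain a where a: "Poly_Mapping.keys a \<subseteq> nf" "d = linext Dn a" using D_span_normal_form[OF assms] by blast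
  show ?thesis
    unfolding a(2)
  proof (rule wspan_linext)
    fix p assume "p \<in> Poly_Mapping.keys a"
    then show "Dn p \<in> wspan (homog N True 0)"
      using a(1) homog_balanced by (cases p) auto
  qed
qed

section \<open>Passage to cosets\<close>

lemma D_algE:
  assumes "f \<in> D_alg q n N"
  obtains d where "f = cls (coords N) (coord_rel q n N) d" "d \<in> D_span" "d \<in> wspan (homog N True 0)" "d \<in> C" "conv d"
    "\<And>f'. f' \<in> f \<Longrightarrow> f' - d \<in> kern"
proof -
  obtain d where d: "f = cls (coords N) (coord_rel q n N) d" "d \<in> D_span"
    using assms unfolding D_alg_def A_cls_def by blast
  have h: "d \<in> wspan (homog N True 0)" by (rule D_span_homog[OF d(2)])
  show ?thesis
  proof (rule that[OF d h])
    show "d \<in> C" by (rule homog_carrier[OF h])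
    show "conv d" by (rule conv_chi[OF h])
    show "f' - d \<in> kern" if "f' \<in> f" for f'
      using that rel_ideal_kern by (auto simp: d(1) cls_iff)
  qed
qed

lemma nu_crep: "nu c q n N Y = L (crep Y)"
proof -
  have "T0 q n N Y = T (crep Y)" by (simp add: fun_eq_iff T0_def)
  then show ?thesis by (simp only: nu_def L_eq)
qed

lemma kern_sum_C: "f - g \<in> kern \<Longrightarrow> g \<in> C \<Longrightarrow> f \<in> C"
  using C_closed(3)[OF kern_C[of "f - g"], of g] by simp

lemma D_alg_L:
  assumes "f \<in> D_alg q n N" "f' \<in> f"
  shows "conv f'" "L f' = nu c q n N f"
proof -
  obtain d where d: "conv d" "\<And>f'. f' \<in> f \<Longrightarrow> f' - d \<in> kern" using D_algE[OF assms(1)] by metis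
  show "conv f'" using L_cong(2)[OF d(2)[OF assms(2)]] d(1) by simp
  show "L f' = nu c q n N f"
    unfolding nu_crep using L_cong(1)[OF d(2)[OF assms(2)]] L_cong(1)[OF d(2)[OF crep_in[OF assms(2)]]] by simp
qed

lemma D_alg_nonempty: "f \<in> D_alg q n N \<Longrightarrow> crep f \<in> f"
  using crep_in self_in_cls D_algE by metis

lemma nu_add:
  assumes "f \<in> D_alg q n N" "g \<in> D_alg q n N"
  shows "nu c q n N (f \<oplus>\<^bsub>A_alg q n N\<^esub> g) = nu c q n N f + nu c q n N g"
proof -
  have "crep f + crep g \<in> f \<oplus>\<^bsub>A_alg q n N\<^esub> g"
    unfolding A_alg_def presented_algebra_add_iff using assms D_alg_nonempty by blast
  from crep_in[OF this] obtain a b where ab: "a \<in> f" "b \<in> g" "crep (f \<oplus>\<^bsub>A_alg q n N\<^esub> g) = a + b"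
    unfolding A_alg_def presented_algebra_add_iff by blast
  show ?thesis
    unfolding nu_crep[of "f \<oplus>\<^bsub>A_alg q n N\<^esub> g"] ab(3)
    using conv_add(2) D_alg_L[OF assms(1) ab(1)] D_alg_L[OF assms(2) ab(2)] by simp
qed

lemma nu_scale:
  assumes "f \<in> D_alg q n N"
  shows "nu c q n N (A_scale q n N a f) = a * nu c q n N f"
proof -
  obtain d where d: "d \<in> C" "\<And>f'. f' \<in> f \<Longrightarrow> f' - d \<in> kern" using D_algE[OF assms] by metis
  let ?X = "A_scale q n N a f"
  have X: "y \<in> ?X \<longleftrightarrow> (\<exists>s\<in>cls (coords N) (coord_rel q n N) (cscale a 1). \<exists>b\<in>f. y - s * b \<in> rel_ideal (coords N) (coord_rel q n N))" for y
    unfolding A_scale_def A_alg_def A_cls_def presented_algebra_mult_iff ..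
  have "cscale a 1 * crep f \<in> ?X"
    unfolding X using D_alg_nonempty[OF assms]
    by (intro bexI[of _ "cscale a 1"] bexI[of _ "crep f"]) (simp_all add: zero_in_rel_ideal self_in_cls)
  from crep_in[OF this] obtain s b where sb: "s \<in> cls (coords N) (coord_rel q n N) (cscale a 1)"
    "crep ?X - s * b \<in> rel_ideal (coords N) (coord_rel q n N)" and b: "b \<in> f"
    unfolding X by blast
  have s: "s - cscale a 1 \<in> kern" and y: "crep ?X - s * b \<in> kern"
    using sb rel_ideal_kern by (auto simp: cls_iff)
  have bC: "b \<in> C" using kern_sum_C[OF d(2)[OF b] d(1)] .
  \<comment> \<open>The representative chosen in the product coset is s b only up to relations, and
    s is itself arbitrary in the coset of the scalar.\<close>
  have e: "crep ?X - cscale a b = (crep ?X - s * b) + (s - cscale a 1) * b"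
    by (simp add: left_diff_distrib cscale_mult_left)
  have "crep ?X - cscale a b \<in> kern"
    unfolding e by (rule kern_add[OF y kern_mult_right[OF s bC]])
  then show ?thesis
    unfolding nu_crep[of ?X] using D_alg_L(2)[OF assms b] by (simp add: L_cong(1) L_cscale)
qed

lemma nu_star_mult:
  assumes "f \<in> D_alg q n N" and d: "d \<in> C" "\<And>f'. f' \<in> f \<Longrightarrow> f' - d \<in> kern"
  shows "nu c q n N (A_star f \<otimes>\<^bsub>A_alg q n N\<^esub> f) = L (fstar d * d)"
proof -
  let ?X = "A_star f \<otimes>\<^bsub>A_alg q n N\<^esub> f"
  have X: "y \<in> ?X \<longleftrightarrow> (\<exists>s\<in>f. \<exists>b\<in>f. y - fstar s * b \<in> rel_ideal (coords N) (coord_rel q n N))" for y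
    unfolding A_star_def A_alg_def presented_algebra_mult_iff by blast
  have "fstar (crep f) * crep f \<in> ?X"
    unfolding X using D_alg_nonempty[OF assms(1)]
    by (intro bexI[of _ "crep f"]) (simp_all add: zero_in_rel_ideal)
  from crep_in[OF this] obtain s b where s: "s \<in> f" and b: "b \<in> f"
    and "crep ?X - fstar s * b \<in> rel_ideal (coords N) (coord_rel q n N)"
    unfolding X by blast
  then have y: "crep ?X - fstar s * b \<in> kern" using rel_ideal_kern by blast
  have bC: "b \<in> C" using kern_sum_C[OF d(2)[OF b] d(1)] .
  \<comment> \<open>The factors s and b may be different representatives of f; each is replaced by d
    at the cost of an element of \<open>kern\<close>.\<close>
  have e: "crep ?X - fstar d * d = (crep ?X - fstar s * b) + fstar (s - d) * b + fstar d * (b - d)"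
    by (simp add: fstar_diff left_diff_distrib right_diff_distrib)
  have "crep ?X - fstar d * d \<in> kern"
    unfolding e by (rule kern_add[OF kern_add[OF y kern_mult_right[OF kern_fstar[OF d(2)[OF s]] bC]]
        kern_mult_left[OF d(2)[OF b] C_fstar[OF d(1)]]])
  then show ?thesis unfolding nu_crep by (rule L_cong(1))
qed

text \<open>By the adjoint relation the diagonal entry of d^* d is the squared norm of T(d) applied
  to the basis vector.\<close>

lemma diag_star_mult:
  assumes "d \<in> C"
  shows "diag (fstar d * d) i = of_real (Qv i * (\<Sum>k\<in>Poly_Mapping.keys (T d (bvec i)). (cmod (Poly_Mapping.lookup (T d (bvec i)) k))\<^sup>2))"
proof -
  let ?v = "T d (bvec i)"
  have "T (fstar d) ?v = linext (\<lambda>k. T (fstar d) (bvec k)) ?v"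
    by (rule clin_eqI) (simp_all add: bvec_def)
  then have "Poly_Mapping.lookup (T (fstar d * d) (bvec i)) i =
      (\<Sum>k\<in>Poly_Mapping.keys ?v. Poly_Mapping.lookup ?v k * cnj (Poly_Mapping.lookup ?v k))"
    by (simp add: T_mult lookup_linext T_adjoint[OF assms])
  then show ?thesis
    by (simp only: diag_def complex_norm_square[symmetric] of_real_mult of_real_sum)
qed

lemma L_star_mult_pos:
  assumes "d \<in> D_span" "d \<noteq> 0" "d \<in> C" "d \<in> wspan (homog N True 0)"
  shows "L (fstar d * d) \<in> \<real> \<and> 0 < Re (L (fstar d * d))"
proof -
  define g where "g i = Qv i * (\<Sum>k\<in>Poly_Mapping.keys (T d (bvec i)). (cmod (Poly_Mapping.lookup (T d (bvec i)) k))\<^sup>2)" for i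
  have g0: "0 \<le> g i" for i
    unfolding g_def using Qv_pos[of i] by (intro mult_nonneg_nonneg sum_nonneg) auto
  have dg: "diag (fstar d * d) i = of_real (g i)" for i
    unfolding g_def by (rule diag_star_mult[OF assms(3)])
  have "fstar d * d \<in> wspan (homog N True 0)"
    using homog_mult[OF homog_fstar[OF assms(4)] assms(4)] by simp
  then have "conv (fstar d * d)" by (rule conv_chi)
  then have gs: "g summable_on B"
    unfolding conv_def dg using g0 by simp
  have L: "L (fstar d * d) = of_real (infsum g B)"
    unfolding L_def dg using has_sum_infsum[OF gs]
    by (intro infsumI) (simp only: has_sum_of_real_iff)
  obtain i where i: "i \<in> B" "T d (bvec i) \<noteq> 0" using D_span_faithful[OF assms(1)] assms(2) by blast
  then obtain k where k: "k \<in> Poly_Mapping.keys (T d (bvec i))" by (metis keys_eq_empty ex_in_conv)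
  have "0 < (\<Sum>k\<in>Poly_Mapping.keys (T d (bvec i)). (cmod (Poly_Mapping.lookup (T d (bvec i)) k))\<^sup>2)"
    using k by (intro sum_pos2[OF _ k]) (auto simp: in_keys_iff)
  then have "0 < sum g {i}" using Qv_pos[of i] by (simp add: g_def)
  also have "\<dots> \<le> infsum g B"
    using gs i(1) g0 by (intro finite_sum_le_infsum) auto
  finally show ?thesis unfolding L by simp
qed

text \<open>This confines an arbitrary representative of an element of the quantum group to words in
  the actual generators, for which stability of \<open>kern\<close> is proved.\<close>

lemma uq_rel_carrier:
  assumes "uq_rel q N l r"
  shows "l - r \<in> carrier (free_algebra (ugens N))"
proof -
  let ?U = "wspan (\<lambda>xs. set xs \<subseteq> ugens N)"
  have m: "f \<in> ?U \<Longrightarrow> g \<in> ?U \<Longrightarrow> f * g \<in> ?U" for f g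
    by (rule wspan_mult[of f "\<lambda>xs. set xs \<subseteq> ugens N" g "\<lambda>xs. set xs \<subseteq> ugens N"]) auto
  have o: "1 \<in> ?U" by simp
  have e: "uE i \<in> ?U" "uF i \<in> ?U" "uK i \<in> ?U" "uKinv i \<in> ?U" if "i \<in> {1..<N}" for i
    using that by (auto simp: ugens_def)
  show ?thesis
    using assms unfolding free_algebra_carrier
    by cases (auto intro!: wspan_diff wspan_add wspan_cscale m e simp del: One_nat_def)
qed

text \<open>\<open>act\<close> and \<open>counit\<close> are evaluated at the same representative
  \<open>crep a\<close>, so the identity is proved for that element of the free algebra. The
  representatives of f and of the result vary, and \<open>kern\<close> absorbs the
  difference.\<close>

lemma nu_act:
  assumes a: "a \<in> carrier (Uq q N)" and f: "f \<in> D_alg q n N"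
  shows "nu c q n N (act q n N a f) = counit a * nu c q n N f"
proof -
  obtain d where d: "d \<in> wspan (homog N True 0)" "\<And>f'. f' \<in> f \<Longrightarrow> f' - d \<in> kern" using D_algE[OF f] by metis
  let ?U = "carrier (free_algebra (ugens N))"
  obtain b where b: "b \<in> ?U" "a = cls (ugens N) (uq_rel q N) b"
    using a unfolding Uq_def presented_algebra_carrier by blast
  have "crep a - b \<in> rel_ideal (ugens N) (uq_rel q N)"
    using crep_in[OF self_in_cls[of b "ugens N" "uq_rel q N"]] unfolding b(2)[symmetric]
    by (simp add: b(2) cls_iff)
  then have "crep a - b \<in> ?U" using rel_ideal_carrier[OF uq_rel_carrier] by blast
  then have "crep a - b + b \<in> ?U" using b(1) unfolding free_algebra_carrier by (rule wspan_add)
  then have ca: "crep a \<in> ?U" by simp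
  have "act_free q n (crep a) (crep f) - act_free q n (crep a) d = act_free q n (crep a) (crep f - d)"
    unfolding act_free_frep by (rule clin_diff[symmetric, OF clin_frep_right]) simp
  also have "\<dots> \<in> kern"
    by (rule act_free_kern[OF ca d(2)[OF D_alg_nonempty[OF f]]])
  finally have 1: "L (act_free q n (crep a) (crep f)) = L (act_free q n (crep a) d)"
    by (rule L_cong(1))
  have "crep (act q n N a f) - act_free q n (crep a) (crep f) \<in> kern"
    using crep_in[OF self_in_cls] rel_ideal_kern unfolding act_def A_cls_def cls_iff by blast
  then have "nu c q n N (act q n N a f) = L (act_free q n (crep a) (crep f))"
    unfolding nu_crep by (rule L_cong(1))
  also have "\<dots> = counit_free (crep a) * L d"
    unfolding 1 by (rule L_act_free(1)[OF ca d(1)])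
  also have "L d = nu c q n N f"
    unfolding nu_crep by (rule L_cong(1)[OF d(2)[OF D_alg_nonempty[OF f]], symmetric])
  finally show ?thesis by (simp add: counit_def)
qed

lemma nu_positive:
  assumes f: "f \<in> D_alg q n N" and nz: "f \<noteq> \<zero>\<^bsub>A_alg q n N\<^esub>"
  shows "nu c q n N (A_star f \<otimes>\<^bsub>A_alg q n N\<^esub> f) \<in> \<real> \<and> 0 < Re (nu c q n N (A_star f \<otimes>\<^bsub>A_alg q n N\<^esub> f))"
proof (rule D_algE[OF f])
  fix d
  assume d: "f = cls (coords N) (coord_rel q n N) d" "d \<in> D_span" "d \<in> wspan (homog N True 0)" "d \<in> C"
    and k: "\<And>f'. f' \<in> f \<Longrightarrow> f' - d \<in> kern"
  \<comment> \<open>A nonzero coset only yields that d is nonzero in the free algebra; this suffices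
    because T is injective on \<open>D_span\<close>.\<close>
  have "d \<noteq> 0" using nz d(1) by (metis A_alg_def presented_algebra_zero)
  have e: "nu c q n N (A_star f \<otimes>\<^bsub>A_alg q n N\<^esub> f) = L (fstar d * d)"
    by (rule nu_star_mult[OF f d(4)]) (rule k)
  show ?thesis unfolding e by (rule L_star_mult_pos[OF d(2) \<open>d \<noteq> 0\<close> d(4) d(3)])
qed

end

theorem theorem6p3:
  fixes q c :: real and n m N :: nat
  assumes "0 < q" and "q < 1" and "n \<ge> 1" and "m \<ge> 2" and "N = n + m" and "c > 0"
  shows
    "(\<forall>f\<in>D_alg q n N. \<forall>f'\<in>f.
        trace_converges n N (T0_free q n N f' \<circ> Q0 c q N) \<and>
        Tr n N (T0_free q n N f' \<circ> Q0 c q N) = nu c q n N f) \<and>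
     (\<forall>f\<in>D_alg q n N. \<forall>g\<in>D_alg q n N.
        nu c q n N (f \<oplus>\<^bsub>A_alg q n N\<^esub> g) = nu c q n N f + nu c q n N g) \<and>
     (\<forall>a. \<forall>f\<in>D_alg q n N. nu c q n N (A_scale q n N a f) = a * nu c q n N f) \<and>
     (\<forall>f\<in>D_alg q n N. f \<noteq> \<zero>\<^bsub>A_alg q n N\<^esub> \<longrightarrow>
        nu c q n N (A_star f \<otimes>\<^bsub>A_alg q n N\<^esub> f) \<in> \<real> \<and>
        0 < Re (nu c q n N (A_star f \<otimes>\<^bsub>A_alg q n N\<^esub> f))) \<and>
     (\<forall>a\<in>carrier (Uq q N). \<forall>f\<in>D_alg q n N.
        nu c q n N (act q n N a f) = counit a * nu c q n N f)"
proof -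
  interpret quantum_cone q c n m N
    using assms by unfold_locales
  show ?thesis
    unfolding conv_eq L_eq
    using D_alg_L nu_add nu_scale nu_positive nu_act by blast
qed

end
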